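(* Let $\nu\in\mathcal{M}(\Phi)$ and $x_0\in\mathbb{R}^d$. Then the following assertions are equivalent: (i) $x_0$ is a Lebesgue point of $\nu$; (ii) there exists $\ell\in\mathbb{C}$ such that $\displaystyle\lim_{t\to0^+}\mathbb{P}_t\big(|\nu-\ell\,dy|\big)(x_0)=0$; (iii) there exist $\ell\in\mathbb{C}$ and some $\alpha>0$ such that $\displaystyle\lim_{|x-x_0|<\alpha t\to0}\mathbb{P}_t\big(|\nu-\ell\,dy|\big)(x)=0$; (iii') there exists $\ell\in\mathbb{C}$ such that for all $\alpha>0$, $\displaystyle\lim_{|x-x_0|<\alpha t\to0}\mathbb{P}_t\big(|\nu-\ell\,dy|\big)(x)=0$. Moreover, if these assertions hold, then one can take $\ell=D\nu(x_0)$ in them, and for every $\alpha>0$ it also holds that $$\lim_{|x-x_0|<\alpha t\to0}\mathbb{P}_t\nu(x)=D\nu(x_0).$$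
   Context: Fix $d\ge1$. A locally finite complex measure in $\mathbb{R}^d$ is $\nu=\nu_1+i\nu_2$ where $\nu_1,\nu_2$ are signed Borel measures which are finite on compact sets; $|\nu|$ denotes its total variation (a positive Borel measure, finite on compact sets). $dy$ denotes Lebesgue measure, $|E|$ the Lebesgue measure of $E$, $B_r(x)=\{y\in\mathbb{R}^d:|y-x|<r\}$; for $\ell\in\mathbb{C}$, $\nu-\ell\,dy$ is the locally finite complex measure $E\mapsto\nu(E)-\ell|E|$ (for bounded Borel $E$). Lebesgue point: $x_0$ is a Lebesgue point of $\nu$ if there exists $\ell\in\mathbb{C}$ with $\lim_{r\to0^+}\frac{|\nu-\ell\,dy|(B_r(x_0))}{|B_r(x_0)|}=0$. Symmetric derivative: $D\nu(x_0)=\lim_{r\to0^+}\frac{\nu(B_r(x_0))}{|B_r(x_0)|}$ (when the limit exists; it exists and equals $\ell$ if $x_0$ is a Lebesgue point with value $\ell$). Poisson–Hermite semigroup: let $L=-\Delta+|x|^2$ be the Hermite operator in $\mathbb{R}^d$ and $\mathbb{P}_t=e^{-t\sqrt L}=\frac{t}{\sqrt{4\pi}}\int_0^\infty e^{-t^2/(4\tau)}e^{-\tau L}\frac{d\tau}{\tau^{3/2}}$, $t>0$. Its integral kernel is $$\mathbb{P}_t(x,y)=c_d\,t\int_0^1\frac{e^{-t^2/\kappa(s)}(1-s^2)^{\frac d2-1}e^{-\frac14\left(\frac{|x-y|^2}{s}+s|x+y|^2\right)}}{s^{d/2}\,\kappa(s)^{3/2}}\,ds,\qquad \kappa(s)=2\ln\frac{1+s}{1-s},$$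 where $c_d=8(4\pi)^{-(d+1)/2}>0$. Let $\Phi(y)=\dfrac{e^{-|y|^2/2}}{(1+|y|)^{d/2}[\log(e+|y|)]^{3/2}}$, and let $\mathcal{M}(\Phi)$ be the set of locally finite complex measures $\nu$ in $\mathbb{R}^d$ with $\int_{\mathbb{R}^d}\Phi\,d|\nu|<\infty$. For $\nu\in\mathcal{M}(\Phi)$ set $\mathbb{P}_t\nu(x)=\int_{\mathbb{R}^d}\mathbb{P}_t(x,y)\,d\nu(y)$, which converges absolutely for all $t>0$, $x\in\mathbb{R}^d$. (Note $dy\in\mathcal M(\Phi)$.) The notation $\lim_{|x-x_0|<\alpha t\to0}$ means the limit as $(t,x)\to(0,x_0)$ over points $(t,x)\in(0,\infty)\times\mathbb{R}^d$ with $|x-x_0|<\alpha t$. *)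

theory Defs
  imports "HOL-Analysis.Analysis"
begin

text \<open>
  A locally finite signed or complex measure need not have a value on unbounded sets (its positive
  and negative parts may both be infinite there). It is therefore represented by a set function of
  which only the values on bounded Borel sets are relevant.
\<close>

definition locally_finite_signed_measure :: "('a::euclidean_space set \<Rightarrow> real) \<Rightarrow> bool" where
  "locally_finite_signed_measure \<nu> \<longleftrightarrow>
     \<nu> {} = 0 \<and>
     (\<forall>A :: nat \<Rightarrow> 'a set. (\<forall>n. A n \<in> sets borel) \<and> disjoint_family A \<and> bounded (\<Union>n. A n) \<longrightarrow>
        (\<lambda>n. \<nu> (A n)) sums \<nu> (\<Union>n. A n))"

definition locally_finite_complex_measure :: "('a::euclidean_space set \<Rightarrow> complex) \<Rightarrow> bool" where
  "locally_finite_complex_measure \<nu> \<longleftrightarrow>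
     locally_finite_signed_measure (\<lambda>E. Re (\<nu> E)) \<and>
     locally_finite_signed_measure (\<lambda>E. Im (\<nu> E))"

text \<open>
  The total variation is the usual supremum over countable Borel partitions of \<open>E\<close>; the pieces are
  required to be bounded so that \<open>\<nu>\<close> is meaningful on them, which makes the formula valid for
  unbounded \<open>E\<close> too.
\<close>

definition total_variation :: "('a::euclidean_space set \<Rightarrow> complex) \<Rightarrow> 'a measure" where
  "total_variation \<nu> = measure_of UNIV (sets borel)
     (\<lambda>E. SUP A \<in> {A :: nat \<Rightarrow> 'a set. (\<forall>n. A n \<in> sets borel \<and> bounded (A n)) \<and>
                     disjoint_family A \<and> (\<Union>n. A n) = E}.
        (\<Sum>n. ennreal (norm (\<nu> (A n)))))"

text \<open>
  Positive part of the Jordan decomposition; the negative part of \<open>\<nu>\<close> is the positive part of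
  \<open>-\<nu>\<close>. Since \<open>\<nu> {} = 0\<close>, the truncation of negative values by \<^const>\<open>ennreal\<close> does not affect
  the supremum.
\<close>

definition positive_part :: "('a::euclidean_space set \<Rightarrow> real) \<Rightarrow> 'a measure" where
  "positive_part \<nu> = measure_of UNIV (sets borel)
     (\<lambda>E. SUP F \<in> {F. F \<in> sets borel \<and> bounded F \<and> F \<subseteq> E}. ennreal (\<nu> F))"

definition signed_integral :: "('a::euclidean_space set \<Rightarrow> real) \<Rightarrow> ('a \<Rightarrow> real) \<Rightarrow> real" where
  "signed_integral \<nu> f =
     (\<integral>y. f y \<partial>positive_part \<nu>) - (\<integral>y. f y \<partial>positive_part (\<lambda>E. - \<nu> E))"

definition complex_measure_integral ::
    "('a::euclidean_space set \<Rightarrow> complex) \<Rightarrow> ('a \<Rightarrow> real) \<Rightarrow> complex" where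
  "complex_measure_integral \<nu> f =
     Complex (signed_integral (\<lambda>E. Re (\<nu> E)) f) (signed_integral (\<lambda>E. Im (\<nu> E)) f)"

definition minus_const_lebesgue ::
    "('a::euclidean_space set \<Rightarrow> complex) \<Rightarrow> complex \<Rightarrow> 'a set \<Rightarrow> complex" where
  "minus_const_lebesgue \<nu> l E = \<nu> E - l * of_real (measure lborel E)"

definition lebesgue_point_value ::
    "('a::euclidean_space set \<Rightarrow> complex) \<Rightarrow> 'a \<Rightarrow> complex \<Rightarrow> bool" where
  "lebesgue_point_value \<nu> x0 l \<longleftrightarrow>
     ((\<lambda>r. emeasure (total_variation (minus_const_lebesgue \<nu> l)) (ball x0 r)
             / emeasure lborel (ball x0 r)) \<longlongrightarrow> 0) (at_right 0)"

definition lebesgue_point :: "('a::euclidean_space set \<Rightarrow> complex) \<Rightarrow> 'a \<Rightarrow> bool" where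
  "lebesgue_point \<nu> x0 \<longleftrightarrow> (\<exists>l. lebesgue_point_value \<nu> x0 l)"

definition ball_average :: "('a::euclidean_space set \<Rightarrow> complex) \<Rightarrow> 'a \<Rightarrow> real \<Rightarrow> complex" where
  "ball_average \<nu> x0 r = \<nu> (ball x0 r) / of_real (measure lborel (ball x0 r))"

text \<open>Only meaningful when the limit exists.\<close>

definition symmetric_derivative :: "('a::euclidean_space set \<Rightarrow> complex) \<Rightarrow> 'a \<Rightarrow> complex" where
  "symmetric_derivative \<nu> x0 = Lim (at_right 0) (ball_average \<nu> x0)"

definition kappa :: "real \<Rightarrow> real" where
  "kappa s = 2 * ln ((1 + s) / (1 - s))"

text \<open>
  The kernel of \<open>exp (- t * sqrt L)\<close>, \<open>L = - \<Delta> + |x|\<^sup>2\<close>: Mehler's kernel of \<open>exp (- \<tau> * L)\<close> inserted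
  in the subordination formula, with the change of variables \<open>s = tanh \<tau>\<close>, i.e. \<open>4 * \<tau> = kappa s\<close>.
\<close>

definition poisson_hermite_kernel :: "real \<Rightarrow> 'a::euclidean_space \<Rightarrow> 'a \<Rightarrow> real" where
  "poisson_hermite_kernel t x y =
     8 * (4 * pi) powr (- (real DIM('a) + 1) / 2) * t *
     (LINT s:{0<..<1}|lborel.
        exp (- t\<^sup>2 / kappa s) * (1 - s\<^sup>2) powr (real DIM('a) / 2 - 1) *
        exp (- (1 / 4) * ((norm (x - y))\<^sup>2 / s + s * (norm (x + y))\<^sup>2)) /
        (s powr (real DIM('a) / 2) * kappa s powr (3 / 2)))"

definition Phi :: "'a::euclidean_space \<Rightarrow> real" where
  "Phi y = exp (- (norm y)\<^sup>2 / 2) /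
     ((1 + norm y) powr (real DIM('a) / 2) * ln (exp 1 + norm y) powr (3 / 2))"

definition M_Phi :: "('a::euclidean_space set \<Rightarrow> complex) set" where
  "M_Phi = {\<nu>. locally_finite_complex_measure \<nu> \<and>
               (\<integral>\<^sup>+ y. ennreal (Phi y) \<partial>total_variation \<nu>) < \<infinity>}"

definition poisson_hermite ::
    "real \<Rightarrow> ('a::euclidean_space set \<Rightarrow> complex) \<Rightarrow> 'a \<Rightarrow> complex" where
  "poisson_hermite t \<nu> x = complex_measure_integral \<nu> (poisson_hermite_kernel t x)"

text \<open>
  The same operator on positive measures. The kernel is positive for \<open>t > 0\<close>, so the integral is
  taken in \<open>[0, \<infinity>]\<close>: a divergent integral would count as \<open>\<infinity>\<close>, not as the default value 0 of the
  Bochner integral.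
\<close>

definition poisson_hermite_pos :: "real \<Rightarrow> 'a::euclidean_space measure \<Rightarrow> 'a \<Rightarrow> ennreal" where
  "poisson_hermite_pos t \<mu> x = (\<integral>\<^sup>+ y. ennreal (poisson_hermite_kernel t x y) \<partial>\<mu>)"

text \<open>The limit over \<open>|x - x0| < \<alpha> * t \<rightarrow> 0\<close>, as a filter on pairs \<open>(t, x)\<close>.\<close>

definition nontangential :: "real \<Rightarrow> 'a::euclidean_space \<Rightarrow> (real \<times> 'a) filter" where
  "nontangential \<alpha> x0 = at (0, x0) within {(t, x). 0 < t \<and> norm (x - x0) < \<alpha> * t}"

end

theory Submission
  imports Defs "HOL-Probability.Distributions"
begin

text \<open>
  The kernel behaves locally like the Poisson kernel of \<open>- \<Delta>\<close>, and far away it is dominated by the weight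
  \<open>Phi\<close>. Precisely, with \<open>d\<close> the dimension, for bounded \<open>x\<close> and all \<open>t > 0\<close> and \<open>y\<close>,
  \<open>P\<^sub>t(x, y) \<le> C * t * Phi y * (1 + (t\<^sup>2 + |x - y|\<^sup>2) powr (- (d + 1) / 2))\<close>
  (\<open>poisson_hermite_kernel_le\<close>), while \<open>P\<^sub>t(x0, y) \<ge> c * t ^ (- d)\<close> for \<open>|x0 - y| < t \<le> 1/2\<close>
  (\<open>poisson_hermite_kernel_ge\<close>). In the integral over \<open>s\<close> defining the kernel, the singular power comes from \<open>s\<close> near 0
  and the weight \<open>Phi\<close> from \<open>s\<close> near 1.

  Let \<open>\<mu> = |\<nu> - l dy|\<close>. The lower bound shows that \<open>P\<^sub>t \<mu> (x0)\<close> controls the mean of \<open>\<mu>\<close> over the ball of radius \<open>t\<close>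
  about \<open>x0\<close>; so the radial limit 0 forces \<open>x0\<close> to be a Lebesgue point with value \<open>l\<close>. Conversely let \<open>x0\<close> be such a
  point and let \<open>(t, x)\<close> stay in a cone. By the upper bound, the part of the integral over \<open>|y - x0| < \<delta>\<close> is at most a
  Poisson integral of \<open>\<mu>\<close> centred at \<open>x0\<close>. A dyadic decomposition bounds it by a multiple of the supremum of the means of
  \<open>\<mu>\<close> over the balls about \<open>x0\<close> of radius at most \<open>\<delta>\<close> (\<open>nn_integral_poisson_kernel_le\<close>). The rest is at most a constant, depending on \<open>\<delta>\<close>,
  times \<open>t\<close> times the \<open>\<mu>\<close>-integral of \<open>Phi\<close>, hence tends to 0. Thus the limit is 0 in every cone, and a limit in
  one cone contains the radial limit. This closes the circle of equivalences.

  The number \<open>l\<close> is the limit of the ball averages, hence the symmetric derivative. For \<open>P\<^sub>t \<nu>\<close> itself,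
  \<open>|P\<^sub>t \<nu> - l * P\<^sub>t 1| \<le> 2 * P\<^sub>t \<mu>\<close>, and \<open>P\<^sub>t 1\<close> tends to 1 because its Gaussian integrals can be computed
  (\<open>nn_integral_poisson_hermite_kernel\<close>).

  The measures involved are suprema of set functions, so one first has to see that they are measures, and that
  integration against \<open>\<nu> - l dy\<close>, defined through Jordan decompositions, is controlled by \<open>|\<nu> - l dy|\<close>. The Jordan parts
  of \<open>\<nu>\<close> are finite on bounded sets because they lie below \<open>|\<nu>|\<close>, against which the positive continuous function
  \<open>Phi\<close> is integrable.
\<close>

section \<open>Measures attached to a locally finite set function\<close>

text \<open>
  The total variation and the positive part are both defined as suprema. For a supremum,
  superadditivity on two disjoint sets comes from joining two competitors, and countable subadditivity
  from cutting one competitor along the sets. Superadditivity makes \<open>m\<close> monotone, so it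
  bounds all partial sums.
\<close>

lemma countably_additive_if_superadditive_and_subadditive:
  fixes m :: "'a set \<Rightarrow> ennreal"
  assumes "m {} = 0"
    and super: "\<And>A B. A \<in> sets M \<Longrightarrow> B \<in> sets M \<Longrightarrow> A \<inter> B = {} \<Longrightarrow> m A + m B \<le> m (A \<union> B)"
    and sub: "\<And>A :: nat \<Rightarrow> 'a set. (\<And>n. A n \<in> sets M) \<Longrightarrow> disjoint_family A \<Longrightarrow>
                m (\<Union>n. A n) \<le> (\<Sum>n. m (A n))"
  shows "countably_additive (sets M) m"
  unfolding countably_additive_def
proof (intro allI impI)
  fix A :: "nat \<Rightarrow> 'a set"
  assume A: "range A \<subseteq> sets M" "disjoint_family A"
  have mono: "m B \<le> m C" if "B \<in> sets M" "C \<in> sets M" "B \<subseteq> C" for B C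
  proof -
    have "m B \<le> m B + m (C - B)" by simp
    also have "\<dots> \<le> m (B \<union> (C - B))" using that by (intro super) auto
    also have "B \<union> (C - B) = C" using that by auto
    finally show ?thesis .
  qed
  have fin: "(\<Sum>i<n. m (A i)) \<le> m (\<Union>i<n. A i)" for n
  proof (induction n)
    case (Suc n)
    have "A i \<inter> A n = {}" if "i < n" for i
      using A(2) that by (simp add: disjoint_family_on_def)
    then have "(\<Union>i<n. A i) \<inter> A n = {}" by blast
    then have "m (\<Union>i<n. A i) + m (A n) \<le> m ((\<Union>i<n. A i) \<union> A n)"
      using A(1) by (intro super) auto
    also have "(\<Union>i<n. A i) \<union> A n = (\<Union>i<Suc n. A i)" by (auto simp: less_Suc_eq)
    finally show ?case using Suc by (auto intro: order_trans add_right_mono)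
  qed (simp add: assms)
  show "(\<Sum>n. m (A n)) = m (\<Union>n. A n)"
  proof (rule antisym)
    show "(\<Sum>n. m (A n)) \<le> m (\<Union>n. A n)"
    proof (rule suminf_le_const)
      fix n
      have "m (\<Union>i<n. A i) \<le> m (\<Union>n. A n)" using A(1) by (intro mono) auto
      with fin[of n] show "(\<Sum>i<n. m (A i)) \<le> m (\<Union>n. A n)" by (rule order_trans)
    qed simp
    show "m (\<Union>n. A n) \<le> (\<Sum>n. m (A n))" using A by (intro sub) auto
  qed
qed

lemma SUP_add_SUP_le_ennreal:
  fixes c :: ennreal
  assumes "I \<noteq> {}" "J \<noteq> {}" and le: "\<And>i j. i \<in> I \<Longrightarrow> j \<in> J \<Longrightarrow> f i + g j \<le> c"
  shows "(SUP i\<in>I. f i) + (SUP j\<in>J. g j) \<le> c"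
proof -
  have "(SUP i\<in>I. f i) + g j \<le> c" if "j \<in> J" for j
    unfolding ennreal_SUP_add_left[OF assms(1), symmetric] using le that by (auto intro: SUP_least)
  then show ?thesis
    unfolding ennreal_SUP_add_right[OF assms(2)] by (auto intro: SUP_least)
qed

lemma suminf_swap_ennreal:
  fixes f :: "nat \<Rightarrow> nat \<Rightarrow> ennreal"
  shows "(\<Sum>n. \<Sum>i. f n i) = (\<Sum>i. \<Sum>n. f n i)"
  using nn_integral_suminf[of "\<lambda>i n. f n i" "count_space UNIV"]
  by (simp add: nn_integral_count_space_nat)

lemma locally_finite_complex_measure_empty:
  "locally_finite_complex_measure \<nu> \<Longrightarrow> \<nu> {} = 0"
  by (auto simp: locally_finite_complex_measure_def locally_finite_signed_measure_def
      intro: complex_eqI)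

lemma locally_finite_complex_measure_sums:
  assumes "locally_finite_complex_measure \<nu>" "\<And>n. A n \<in> sets borel" "disjoint_family A"
    "bounded (\<Union>n. A n)"
  shows "(\<lambda>n. \<nu> (A n)) sums \<nu> (\<Union>n. A n)"
  using assms
  by (auto simp: locally_finite_complex_measure_def locally_finite_signed_measure_def
      sums_complex_iff)

lemma locally_finite_signed_measure_sums:
  assumes "locally_finite_signed_measure \<nu>" "\<And>n. A n \<in> sets borel" "disjoint_family A"
    "bounded (\<Union>n. A n)"
  shows "(\<lambda>n. \<nu> (A n)) sums \<nu> (\<Union>n. A n)"
  using assms by (auto simp: locally_finite_signed_measure_def)

lemma locally_finite_signed_measure_Un:
  assumes "locally_finite_signed_measure \<nu>" "A \<in> sets borel" "B \<in> sets borel"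
    "bounded A" "bounded B" "A \<inter> B = {}"
  shows "\<nu> (A \<union> B) = \<nu> A + \<nu> B"
proof -
  have e: "\<nu> {} = 0" using assms(1) by (simp add: locally_finite_signed_measure_def)
  have "(\<lambda>n. \<nu> (binaryset A B n)) sums \<nu> (\<Union>n. binaryset A B n)"
    using assms
    by (intro locally_finite_signed_measure_sums)
       (auto simp: UN_binaryset_eq disjoint_family_on_def binaryset_def)
  with binaryset_sums[of \<nu> A B, OF e] show ?thesis
    by (simp add: UN_binaryset_eq sums_iff)
qed

lemma locally_finite_signed_measure_uminus:
  "locally_finite_signed_measure \<nu> \<Longrightarrow> locally_finite_signed_measure (\<lambda>E. - \<nu> E)"
  by (auto simp: locally_finite_signed_measure_def intro: sums_minus)

lemma locally_finite_signed_measure_minus_lborel: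
  assumes "locally_finite_signed_measure \<nu>"
  shows "locally_finite_signed_measure (\<lambda>E. \<nu> E - c * measure lborel E)"
  unfolding locally_finite_signed_measure_def
proof (intro conjI allI impI)
  show "\<nu> {} - c * measure lborel {} = 0"
    using assms by (simp add: locally_finite_signed_measure_def)
next
  fix A :: "nat \<Rightarrow> 'a set"
  assume A: "(\<forall>n. A n \<in> sets borel) \<and> disjoint_family A \<and> bounded (\<Union>n. A n)"
  then have "(\<lambda>n. measure lborel (A n)) sums measure lborel (\<Union>n. A n)"
    using emeasure_bounded_finite[of "\<Union>n. A n"] by (intro measure_UNION) auto
  moreover have "(\<lambda>n. \<nu> (A n)) sums \<nu> (\<Union>n. A n)"
    using A assms by (auto intro: locally_finite_signed_measure_sums)
  ultimately show "(\<lambda>n. \<nu> (A n) - c * measure lborel (A n)) sums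
      (\<nu> (\<Union>n. A n) - c * measure lborel (\<Union>n. A n))"
    by (intro sums_diff sums_mult)
qed

lemma locally_finite_minus_const_lebesgue:
  assumes "locally_finite_complex_measure \<nu>"
  shows "locally_finite_complex_measure (minus_const_lebesgue \<nu> l)"
  using assms
  by (auto simp: locally_finite_complex_measure_def minus_const_lebesgue_def
      intro: locally_finite_signed_measure_minus_lborel)

subsection \<open>The total variation\<close>

definition bounded_partitions :: "'a::euclidean_space set \<Rightarrow> (nat \<Rightarrow> 'a set) set" where
  "bounded_partitions E =
     {A. (\<forall>n. A n \<in> sets borel \<and> bounded (A n)) \<and> disjoint_family A \<and> (\<Union>n. A n) = E}"

text \<open>
  Every Borel set has a partition into bounded Borel sets, its intersections with annuli, so the
  supremum is never taken over the empty set.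
\<close>

lemma countably_additive_total_variation:
  fixes \<nu> :: "'a::euclidean_space set \<Rightarrow> complex"
  assumes \<nu>: "locally_finite_complex_measure \<nu>"
  shows "countably_additive (sets borel)
    (\<lambda>E. SUP A \<in> bounded_partitions E. (\<Sum>n. ennreal (norm (\<nu> (A n)))))"
    (is "countably_additive _ ?m")
proof (rule countably_additive_if_superadditive_and_subadditive)
  note e = locally_finite_complex_measure_empty[OF \<nu>]
  have "?m {} \<le> 0"
    by (rule SUP_least) (auto simp: bounded_partitions_def e)
  then show "?m {} = 0" by simp
next
  fix E F :: "'a set"
  assume EF: "E \<inter> F = {}"
  have ne: "bounded_partitions E \<noteq> {}" if "E \<in> sets borel" for E :: "'a set"
  proof -
    define A where "A n = E \<inter> (ball 0 (real (Suc n)) - ball 0 (real n))" for n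
    have "disjoint_family A"
    proof -
      have False if "m < n" "x \<in> A m" "x \<in> A n" for m n x
        using that by (auto simp: A_def)
      then show ?thesis
        unfolding disjoint_family_on_def by (metis disjoint_iff linorder_neqE_nat)
    qed
    moreover have "(\<Union>n. A n) = E"
    proof -
      have "\<exists>n. x \<in> A n" if "x \<in> E" for x
        using that unfolding A_def
        by (intro exI[of _ "nat \<lfloor>norm x\<rfloor>"]) (auto, linarith+)
      then show ?thesis by (auto simp: A_def)
    qed
    moreover have "bounded (A n)" for n
      using bounded_subset[of "ball 0 (real (Suc n))" "A n"] by (auto simp: A_def)
    ultimately have "A \<in> bounded_partitions E"
      using that by (auto simp: bounded_partitions_def A_def)
    then show ?thesis by blast
  qed
  assume bor: "E \<in> sets borel" "F \<in> sets borel"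
  have *: "(\<Sum>n. ennreal (norm (\<nu> (A n)))) + (\<Sum>n. ennreal (norm (\<nu> (B n)))) \<le> ?m (E \<union> F)"
    if A: "A \<in> bounded_partitions E" and B: "B \<in> bounded_partitions F" for A B
  proof -
    (* the partition of the union lists the pieces of the two partitions alternately *)
    define C where "C n = (if even n then A (n div 2) else B (n div 2))" for n
    have "C \<in> bounded_partitions (E \<union> F)"
    proof -
      have disj: "A m \<inter> B n = {}" "m \<noteq> n \<Longrightarrow> A m \<inter> A n = {}" "m \<noteq> n \<Longrightarrow> B m \<inter> B n = {}" for m n
        using A B EF by (auto simp: bounded_partitions_def disjoint_family_on_def)
      have "C m \<inter> C n = {}" if "m \<noteq> n" for m n
      proof (cases "even m = even n")
        case True
        with that have "m div 2 \<noteq> n div 2" by presburger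
        then show ?thesis using True disj(2,3)[of "m div 2" "n div 2"] by (simp add: C_def)
      next
        case False
        then show ?thesis
          using disj(1)[of "m div 2" "n div 2"] disj(1)[of "n div 2" "m div 2"]
          by (auto simp: C_def)
      qed
      then have "disjoint_family C" by (simp add: disjoint_family_on_def)
      moreover have "(\<Union>n. C n) = (\<Union>n. A n) \<union> (\<Union>n. B n)"
      proof -
        have "A n = C (2 * n)" "B n = C (2 * n + 1)" for n by (auto simp: C_def)
        then have "(\<Union>n. A n) \<union> (\<Union>n. B n) \<subseteq> (\<Union>n. C n)" by blast
        then show ?thesis by (auto simp: C_def split: if_splits)
      qed
      ultimately show ?thesis using A B by (auto simp: bounded_partitions_def C_def)
    qed
    then have "(\<Sum>n. ennreal (norm (\<nu> (C n)))) \<le> ?m (E \<union> F)" by (rule SUP_upper)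
    moreover have "(\<Sum>n. ennreal (norm (\<nu> (A n)))) + (\<Sum>n. ennreal (norm (\<nu> (B n))))
        = (\<Sum>n. ennreal (norm (\<nu> (A n))) + ennreal (norm (\<nu> (B n))))"
      by (intro suminf_add) auto
    moreover have "(\<Sum>i<n. ennreal (norm (\<nu> (A i))) + ennreal (norm (\<nu> (B i))))
        = (\<Sum>i<2*n. ennreal (norm (\<nu> (C i))))" for n
      by (induction n) (simp_all add: C_def add.assoc del: sum_ennreal)
    then have "(\<Sum>n. ennreal (norm (\<nu> (A n))) + ennreal (norm (\<nu> (B n))))
        \<le> (\<Sum>n. ennreal (norm (\<nu> (C n))))"
      by (intro suminf_le_const) (simp_all add: sum_le_suminf del: sum_ennreal)
    ultimately show ?thesis by simp
  qed
  show "?m E + ?m F \<le> ?m (E \<union> F)"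
    by (rule SUP_add_SUP_le_ennreal[OF ne[OF bor(1)] ne[OF bor(2)] *])
next
  fix E :: "nat \<Rightarrow> 'a set"
  assume E: "\<And>n. E n \<in> sets borel" "disjoint_family E"
  show "?m (\<Union>n. E n) \<le> (\<Sum>n. ?m (E n))"
  proof (rule SUP_least)
    fix A assume A: "A \<in> bounded_partitions (\<Union>n. E n)"
    have "ennreal (norm (\<nu> (A n))) \<le> (\<Sum>i. ennreal (norm (\<nu> (A n \<inter> E i))))" for n
    proof -
      have "(\<lambda>i. \<nu> (A n \<inter> E i)) sums \<nu> (\<Union>i. A n \<inter> E i)"
        using A E
        by (intro locally_finite_complex_measure_sums[OF \<nu>])
           (auto simp: bounded_partitions_def disjoint_family_on_def bounded_Int intro: bounded_subset[of "A n"])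
      also have "(\<Union>i. A n \<inter> E i) = A n" using A by (auto simp: bounded_partitions_def)
      finally have lim: "(\<lambda>m. ennreal (norm (\<Sum>i<m. \<nu> (A n \<inter> E i)))) \<longlonglongrightarrow> ennreal (norm (\<nu> (A n)))"
        by (intro tendsto_ennrealI tendsto_norm) (simp add: sums_def)
      have le: "ennreal (norm (\<Sum>i<m. \<nu> (A n \<inter> E i))) \<le> (\<Sum>i. ennreal (norm (\<nu> (A n \<inter> E i))))" for m
      proof -
        have "ennreal (norm (\<Sum>i<m. \<nu> (A n \<inter> E i))) \<le> (\<Sum>i<m. ennreal (norm (\<nu> (A n \<inter> E i))))"
          by (simp add: norm_sum ennreal_leI)
        also have "\<dots> \<le> (\<Sum>i. ennreal (norm (\<nu> (A n \<inter> E i))))" by (rule sum_le_suminf) auto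
        finally show ?thesis .
      qed
      show ?thesis by (rule Lim_bounded[OF lim, of 0]) (use le in blast)
    qed
    then have "(\<Sum>n. ennreal (norm (\<nu> (A n)))) \<le> (\<Sum>n. \<Sum>i. ennreal (norm (\<nu> (A n \<inter> E i))))"
      by (intro suminf_le) auto
    also have "\<dots> = (\<Sum>i. \<Sum>n. ennreal (norm (\<nu> (A n \<inter> E i))))"
      by (rule suminf_swap_ennreal)
    also have "\<dots> \<le> (\<Sum>i. ?m (E i))"
    proof (intro suminf_le)
      fix i
      have "disjoint_family (\<lambda>n. A n \<inter> E i)"
        using A unfolding bounded_partitions_def disjoint_family_on_def by blast
      moreover have "(\<Union>n. A n \<inter> E i) = E i" using A by (auto simp: bounded_partitions_def)
      ultimately have "(\<lambda>n. A n \<inter> E i) \<in> bounded_partitions (E i)"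
        using A E(1) by (auto simp: bounded_partitions_def bounded_Int)
      then show "(\<Sum>n. ennreal (norm (\<nu> (A n \<inter> E i)))) \<le> ?m (E i)" by (rule SUP_upper2) simp
    qed auto
    finally show "(\<Sum>n. ennreal (norm (\<nu> (A n)))) \<le> (\<Sum>i. ?m (E i))" .
  qed
qed

lemma sets_total_variation [simp, measurable_cong]: "sets (total_variation \<nu>) = sets borel"
  and space_total_variation [simp]: "space (total_variation \<nu>) = UNIV"
  by (auto simp: total_variation_def sets.sigma_sets_eq[of borel, simplified] space_measure_of_conv
      sets_measure_of_conv)

lemma emeasure_total_variation:
  assumes "locally_finite_complex_measure \<nu>" "E \<in> sets borel"
  shows "emeasure (total_variation \<nu>) E =
    (SUP A \<in> bounded_partitions E. (\<Sum>n. ennreal (norm (\<nu> (A n)))))"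
proof (rule emeasure_measure_of)
  show "total_variation \<nu> = measure_of UNIV (sets borel)
      (\<lambda>E. SUP A \<in> bounded_partitions E. (\<Sum>n. ennreal (norm (\<nu> (A n)))))"
    by (simp add: total_variation_def bounded_partitions_def)
  show "countably_additive (sets (total_variation \<nu>))
      (\<lambda>E. SUP A \<in> bounded_partitions E. (\<Sum>n. ennreal (norm (\<nu> (A n)))))"
    using countably_additive_total_variation[OF assms(1)] by simp
  show "positive (sets (total_variation \<nu>))
      (\<lambda>E. SUP A \<in> bounded_partitions E. (\<Sum>n. ennreal (norm (\<nu> (A n)))))"
  proof -
    have "(SUP A \<in> bounded_partitions {}. (\<Sum>n. ennreal (norm (\<nu> (A n))))) \<le> 0"
      by (rule SUP_least)
         (auto simp: bounded_partitions_def locally_finite_complex_measure_empty[OF assms(1)])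
    then show ?thesis by (simp add: positive_def)
  qed
qed (use assms in auto)

lemma norm_le_total_variation:
  assumes "locally_finite_complex_measure \<nu>" "E \<in> sets borel" "bounded E"
  shows "ennreal (norm (\<nu> E)) \<le> emeasure (total_variation \<nu>) E"
proof -
  let ?A = "\<lambda>n::nat. if n = 0 then E else {}"
  have "?A \<in> bounded_partitions E"
    using assms by (auto simp: bounded_partitions_def disjoint_family_on_def)
  then have "(\<Sum>n. ennreal (norm (\<nu> (?A n)))) \<le> emeasure (total_variation \<nu>) E"
    unfolding emeasure_total_variation[OF assms(1,2)] by (rule SUP_upper)
  also have "(\<Sum>n. ennreal (norm (\<nu> (?A n)))) = (\<Sum>n\<in>{0}. ennreal (norm (\<nu> (?A n))))"
    by (rule suminf_finite)
       (auto simp: locally_finite_complex_measure_empty[OF assms(1)])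
  finally show ?thesis by simp
qed

lemma total_variation_minus_const_lebesgue_le:
  assumes \<nu>: "locally_finite_complex_measure \<nu>" and E: "E \<in> sets borel"
  shows "emeasure (total_variation (minus_const_lebesgue \<nu> l)) E
    \<le> emeasure (total_variation \<nu>) E + ennreal (norm l) * emeasure lborel E"
  unfolding emeasure_total_variation[OF locally_finite_minus_const_lebesgue[OF \<nu>] E]
proof (rule SUP_least)
  fix A assume A: "A \<in> bounded_partitions E"
  have "ennreal (norm (minus_const_lebesgue \<nu> l (A n)))
      \<le> ennreal (norm (\<nu> (A n))) + ennreal (norm l) * emeasure lborel (A n)" for n
  proof -
    have "norm (minus_const_lebesgue \<nu> l (A n)) \<le> norm (\<nu> (A n)) + norm l * measure lborel (A n)"
      unfolding minus_const_lebesgue_def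
      by (rule order_trans[OF norm_triangle_ineq4]) (simp add: norm_mult)
    moreover have "emeasure lborel (A n) = ennreal (measure lborel (A n))"
      using A emeasure_bounded_finite[of "A n"]
      by (intro emeasure_eq_ennreal_measure) (auto simp: bounded_partitions_def less_top)
    ultimately show ?thesis
      by (simp add: ennreal_mult[symmetric] ennreal_plus[symmetric] ennreal_leI del: ennreal_plus)
  qed
  then have "(\<Sum>n. ennreal (norm (minus_const_lebesgue \<nu> l (A n))))
      \<le> (\<Sum>n. ennreal (norm (\<nu> (A n))) + ennreal (norm l) * emeasure lborel (A n))"
    by (intro suminf_le) auto
  also have "\<dots> = (\<Sum>n. ennreal (norm (\<nu> (A n)))) + (\<Sum>n. ennreal (norm l) * emeasure lborel (A n))"
    by (intro suminf_add[symmetric]) auto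
  also have "(\<Sum>n. ennreal (norm l) * emeasure lborel (A n)) = ennreal (norm l) * emeasure lborel E"
    using A by (auto simp: bounded_partitions_def intro!: arg_cong2[where f="(*)"] suminf_emeasure)
  also have "(\<Sum>n. ennreal (norm (\<nu> (A n)))) + ennreal (norm l) * emeasure lborel E
      \<le> emeasure (total_variation \<nu>) E + ennreal (norm l) * emeasure lborel E"
    unfolding emeasure_total_variation[OF \<nu> E] using A by (intro add_right_mono SUP_upper)
  finally show "(\<Sum>n. ennreal (norm (minus_const_lebesgue \<nu> l (A n))))
      \<le> emeasure (total_variation \<nu>) E + ennreal (norm l) * emeasure lborel E" .
qed

subsection \<open>The positive part\<close>

lemma countably_additive_positive_part:
  fixes \<nu> :: "'a::euclidean_space set \<Rightarrow> real"
  assumes \<nu>: "locally_finite_signed_measure \<nu>"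
  shows "countably_additive (sets borel)
    (\<lambda>E. SUP F \<in> {F. F \<in> sets borel \<and> bounded F \<and> F \<subseteq> E}. ennreal (\<nu> F))"
    (is "countably_additive _ ?m")
proof (rule countably_additive_if_superadditive_and_subadditive)
  have e: "\<nu> {} = 0" using \<nu> by (simp add: locally_finite_signed_measure_def)
  have "?m {} \<le> 0"
    by (rule SUP_least) (auto simp: e)
  then show "?m {} = 0" by simp
next
  fix A B :: "'a set"
  assume AB: "A \<inter> B = {}"
  have *: "ennreal (\<nu> F) + ennreal (\<nu> G) \<le> ?m (A \<union> B)"
    if F: "F \<in> sets borel" "bounded F" "F \<subseteq> A" and G: "G \<in> sets borel" "bounded G" "G \<subseteq> B" for F G
  proof -
    consider "\<nu> F \<le> 0" | "\<nu> G \<le> 0" | "\<nu> F \<ge> 0" "\<nu> G \<ge> 0" by linarith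
    then show ?thesis
    proof cases
      case 3
      have "\<nu> (F \<union> G) = \<nu> F + \<nu> G"
        using F G AB by (intro locally_finite_signed_measure_Un[OF \<nu>]) auto
      then have "ennreal (\<nu> F) + ennreal (\<nu> G) = ennreal (\<nu> (F \<union> G))"
        using 3 by simp
      also have "\<dots> \<le> ?m (A \<union> B)"
        using F G by (intro SUP_upper) auto
      finally show ?thesis .
    qed (use F G in \<open>auto simp: ennreal_neg intro!: SUP_upper\<close>)
  qed
  have ne: "{F. F \<in> sets borel \<and> bounded F \<and> F \<subseteq> A} \<noteq> {}" for A :: "'a set"
    by (auto intro!: exI[of _ "{}"])
  show "?m A + ?m B \<le> ?m (A \<union> B)"
    by (rule SUP_add_SUP_le_ennreal[OF ne ne]) (use * in auto)
next
  fix E :: "nat \<Rightarrow> 'a set"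
  assume E: "\<And>n. E n \<in> sets borel" "disjoint_family E"
  show "?m (\<Union>n. E n) \<le> (\<Sum>n. ?m (E n))"
  proof (rule SUP_least)
    fix F assume F: "F \<in> {F. F \<in> sets borel \<and> bounded F \<and> F \<subseteq> (\<Union>n. E n)}"
    have "(\<lambda>i. \<nu> (F \<inter> E i)) sums \<nu> (\<Union>i. F \<inter> E i)"
      using F E
      by (intro locally_finite_signed_measure_sums[OF \<nu>])
         (auto simp: disjoint_family_on_def intro: bounded_subset[of F])
    also have "(\<Union>i. F \<inter> E i) = F" using F by auto
    finally have lim: "(\<lambda>m. ennreal (\<Sum>i<m. \<nu> (F \<inter> E i))) \<longlonglongrightarrow> ennreal (\<nu> F)"
      by (intro tendsto_ennrealI) (simp add: sums_def)
    have le: "ennreal (\<Sum>i<m. \<nu> (F \<inter> E i)) \<le> (\<Sum>i. ?m (E i))" for m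
    proof -
      have "ennreal (\<Sum>i<m. \<nu> (F \<inter> E i)) \<le> ennreal (\<Sum>i<m. max 0 (\<nu> (F \<inter> E i)))"
        by (intro ennreal_leI sum_mono) auto
      also have "\<dots> = (\<Sum>i<m. ennreal (max 0 (\<nu> (F \<inter> E i))))"
        by simp
      also have "\<dots> \<le> (\<Sum>i<m. ?m (E i))"
      proof (rule sum_mono)
        fix i
        have "ennreal (max 0 (\<nu> (F \<inter> E i))) = ennreal (\<nu> (F \<inter> E i))"
          by (auto simp: max_def ennreal_neg)
        also have "\<dots> \<le> ?m (E i)"
          using F E by (intro SUP_upper) (auto intro: bounded_subset[of F])
        finally show "ennreal (max 0 (\<nu> (F \<inter> E i))) \<le> ?m (E i)" .
      qed
      also have "\<dots> \<le> (\<Sum>i. ?m (E i))" by (rule sum_le_suminf) auto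
      finally show ?thesis .
    qed
    show "ennreal (\<nu> F) \<le> (\<Sum>i. ?m (E i))" by (rule Lim_bounded[OF lim, of 0]) (use le in blast)
  qed
qed

lemma sets_positive_part [simp, measurable_cong]: "sets (positive_part \<nu>) = sets borel"
  and space_positive_part [simp]: "space (positive_part \<nu>) = UNIV"
  by (auto simp: positive_part_def sets.sigma_sets_eq[of borel, simplified] space_measure_of_conv
      sets_measure_of_conv)

lemma emeasure_positive_part:
  assumes "locally_finite_signed_measure \<nu>" "E \<in> sets borel"
  shows "emeasure (positive_part \<nu>) E =
    (SUP F \<in> {F. F \<in> sets borel \<and> bounded F \<and> F \<subseteq> E}. ennreal (\<nu> F))"
proof (rule emeasure_measure_of)
  show "positive_part \<nu> = measure_of UNIV (sets borel)
      (\<lambda>E. SUP F \<in> {F. F \<in> sets borel \<and> bounded F \<and> F \<subseteq> E}. ennreal (\<nu> F))"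
    by (simp add: positive_part_def)
  show "countably_additive (sets (positive_part \<nu>))
      (\<lambda>E. SUP F \<in> {F. F \<in> sets borel \<and> bounded F \<and> F \<subseteq> E}. ennreal (\<nu> F))"
    using countably_additive_positive_part[OF assms(1)] by simp
  show "positive (sets (positive_part \<nu>))
      (\<lambda>E. SUP F \<in> {F. F \<in> sets borel \<and> bounded F \<and> F \<subseteq> E}. ennreal (\<nu> F))"
  proof -
    have "(SUP F \<in> {F. F \<in> sets borel \<and> bounded F \<and> F \<subseteq> {}}. ennreal (\<nu> F)) \<le> 0"
      using assms(1) by (intro SUP_least) (auto simp: locally_finite_signed_measure_def)
    then show ?thesis by (simp add: positive_def)
  qed
qed (use assms in auto)

text \<open>
  Splitting \<open>B\<close> into \<open>F\<close> and \<open>B - F\<close> turns the supremum of \<open>\<nu> F\<close> into that of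
  \<open>\<nu> B + (- \<nu>) (B - F)\<close>. This is the Jordan decomposition on \<open>B\<close>, here for an inequality
  \<open>\<nu> B \<le> c - b\<close> and written without subtraction since both parts take values in \<open>[0, \<infinity>]\<close>.
\<close>

lemma positive_part_le_Jordan:
  assumes \<nu>: "locally_finite_signed_measure \<nu>" and B: "B \<in> sets borel" "bounded B"
    and bc: "\<nu> B + b \<le> c" "0 \<le> b" "0 \<le> c"
  shows "emeasure (positive_part \<nu>) B + ennreal b
    \<le> emeasure (positive_part (\<lambda>E. - \<nu> E)) B + ennreal c"
proof -
  let ?S = "{F. F \<in> sets borel \<and> bounded F \<and> F \<subseteq> B}"
  have "ennreal (\<nu> F) + ennreal b \<le> emeasure (positive_part (\<lambda>E. - \<nu> E)) B + ennreal c"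
    if F: "F \<in> ?S" for F
  proof -
    (* replacing F by {} where \<nu> F is negative realizes the truncation in ennreal *)
    define G where "G = (if 0 \<le> \<nu> F then F else {})"
    have G: "G \<in> ?S" "\<nu> G = max 0 (\<nu> F)"
      using F \<nu> by (auto simp: G_def locally_finite_signed_measure_def)
    then have "\<nu> B = \<nu> G + \<nu> (B - G)"
      using locally_finite_signed_measure_Un[OF \<nu>, of G "B - G"] B bounded_subset[of B "B - G"]
      by (auto simp: Un_absorb1)
    then have "max 0 (\<nu> F) + b \<le> max 0 (- \<nu> (B - G)) + c" using bc G by linarith
    then have "ennreal (max 0 (\<nu> F) + b) \<le> ennreal (max 0 (- \<nu> (B - G)) + c)"
      by (rule ennreal_leI)
    moreover have "ennreal (max 0 (\<nu> F) + b) = ennreal (\<nu> F) + ennreal b"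
      using bc by (subst ennreal_plus) (auto simp: max_def ennreal_neg)
    moreover have "ennreal (max 0 (- \<nu> (B - G)) + c) = ennreal (- \<nu> (B - G)) + ennreal c"
      using bc by (subst ennreal_plus) (auto simp: max_def ennreal_neg)
    moreover have "ennreal (- \<nu> (B - G)) + ennreal c
        \<le> emeasure (positive_part (\<lambda>E. - \<nu> E)) B + ennreal c"
      unfolding emeasure_positive_part[OF locally_finite_signed_measure_uminus[OF \<nu>] B(1)]
      using G(1) B bounded_subset[of B "B - G"] by (intro add_right_mono SUP_upper) auto
    ultimately show ?thesis by (metis order_trans)
  qed
  moreover have "?S \<noteq> {}" by (auto intro!: exI[of _ "{}"])
  ultimately show ?thesis
    unfolding emeasure_positive_part[OF \<nu> B(1)]
    by (subst ennreal_SUP_add_left[symmetric]) (auto intro: SUP_least)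
qed

section \<open>Comparison of integrals\<close>

lemma sum_list_SUP_ennreal:
  fixes F :: "'b \<Rightarrow> nat \<Rightarrow> ennreal"
  assumes "\<And>M. M \<in> set Ms \<Longrightarrow> incseq (F M)"
  shows "(\<Sum>M\<leftarrow>Ms. SUP n. F M n) = (SUP n. \<Sum>M\<leftarrow>Ms. F M n)"
  using assms
proof (induction Ms)
  case (Cons M Ms)
  have "incseq (\<lambda>n. \<Sum>M\<leftarrow>Ms. F M n)"
    using Cons.prems by (auto simp: incseq_def intro!: sum_list_mono)
  then show ?case using Cons by (simp add: ennreal_SUP_add)
qed simp

text \<open>
  Signed combinations of infinite measures make no sense. Comparisons between them are therefore
  stated as inequalities between sums of positive measures, and they pass from bounded sets to all
  Borel sets by exhaustion and to functions by monotone approximation.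
\<close>

lemma nn_integral_sum_list_mono_measure:
  fixes f :: "'a::real_normed_vector \<Rightarrow> ennreal" and Ms Ns :: "'a measure list"
  assumes f: "f \<in> borel_measurable borel"
    and sets: "\<And>M. M \<in> set (Ms @ Ns) \<Longrightarrow> sets M = sets borel"
    and le: "\<And>B. B \<in> sets borel \<Longrightarrow> bounded B \<Longrightarrow>
      (\<Sum>M\<leftarrow>Ms. emeasure M B) \<le> (\<Sum>N\<leftarrow>Ns. emeasure N B)"
  shows "(\<Sum>M\<leftarrow>Ms. \<integral>\<^sup>+y. f y \<partial>M) \<le> (\<Sum>N\<leftarrow>Ns. \<integral>\<^sup>+y. f y \<partial>N)"
  using f
proof (induction rule: borel_measurable_induct)
  case (cong f g)
  then have "f = g" by auto
  with cong show ?case by simp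
next
  case (set A)
  have exhaust: "(\<Sum>M\<leftarrow>Ms. emeasure M A) = (SUP n. \<Sum>M\<leftarrow>Ms. emeasure M (A \<inter> ball 0 (real n)))"
    if "\<And>M. M \<in> set Ms \<Longrightarrow> sets M = sets borel" for Ms
  proof -
    have "\<exists>n. norm x < real n" for x :: 'a using reals_Archimedean2 by blast
    then have A: "A = (\<Union>n. A \<inter> ball 0 (real n))" by auto
    have inc: "incseq (\<lambda>n. A \<inter> ball 0 (real n))" by (auto simp: incseq_def)
    have "emeasure M A = (SUP n. emeasure M (A \<inter> ball 0 (real n)))" if "M \<in> set Ms" for M
      using inc set that \<open>\<And>M. M \<in> set Ms \<Longrightarrow> sets M = sets borel\<close>
      by (subst A, subst SUP_emeasure_incseq[symmetric]) auto
    then have "(\<Sum>M\<leftarrow>Ms. emeasure M A) = (\<Sum>M\<leftarrow>Ms. SUP n. emeasure M (A \<inter> ball 0 (real n)))"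
      by (intro arg_cong[where f=sum_list] map_cong) auto
    also have "\<dots> = (SUP n. \<Sum>M\<leftarrow>Ms. emeasure M (A \<inter> ball 0 (real n)))"
      using that set by (intro sum_list_SUP_ennreal) (auto simp: incseq_def intro!: emeasure_mono)
    finally show ?thesis .
  qed
  have "(\<Sum>M\<leftarrow>Ms. emeasure M A) \<le> (\<Sum>N\<leftarrow>Ns. emeasure N A)"
    using sets set by (subst (1 2) exhaust) (auto intro!: SUP_mono' le bounded_Int)
  moreover have "(\<Sum>M\<leftarrow>Ms. \<integral>\<^sup>+y. indicator A y \<partial>M) = (\<Sum>M\<leftarrow>Ms. emeasure M A)"
    if "\<And>M. M \<in> set Ms \<Longrightarrow> sets M = sets borel" for Ms
    using that set by (intro arg_cong[where f=sum_list] map_cong) auto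
  ultimately show ?case using sets by simp
next
  case (mult u c)
  have "(\<Sum>M\<leftarrow>Ms. \<integral>\<^sup>+y. c * u y \<partial>M) = c * (\<Sum>M\<leftarrow>Ms. \<integral>\<^sup>+y. u y \<partial>M)"
    if "\<And>M. M \<in> set Ms \<Longrightarrow> sets M = sets borel" for Ms
    using that mult measurable_cong_sets[of _ borel borel borel]
    by (subst sum_list_const_mult[symmetric], intro arg_cong[where f=sum_list] map_cong)
       (auto intro!: nn_integral_cmult)
  then show ?case using sets mult by (auto intro!: mult_left_mono)
next
  case (add u v)
  have "(\<Sum>M\<leftarrow>Ms. \<integral>\<^sup>+y. v y + u y \<partial>M) = (\<Sum>M\<leftarrow>Ms. \<integral>\<^sup>+y. v y \<partial>M) + (\<Sum>M\<leftarrow>Ms. \<integral>\<^sup>+y. u y \<partial>M)"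
    if "\<And>M. M \<in> set Ms \<Longrightarrow> sets M = sets borel" for Ms
    using that add measurable_cong_sets[of _ borel borel borel]
    by (subst sum_list_addf[symmetric], intro arg_cong[where f=sum_list] map_cong)
       (auto intro!: nn_integral_add)
  then show ?case using sets add by (auto intro!: add_mono)
next
  case (seq U)
  have "(\<Sum>M\<leftarrow>Ms. \<integral>\<^sup>+y. (SUP i. U i) y \<partial>M) = (SUP i. \<Sum>M\<leftarrow>Ms. \<integral>\<^sup>+y. U i y \<partial>M)"
    if "\<And>M. M \<in> set Ms \<Longrightarrow> sets M = sets borel" for Ms
  proof -
    have "(\<integral>\<^sup>+y. (SUP i. U i) y \<partial>M) = (SUP i. \<integral>\<^sup>+y. U i y \<partial>M)" if "M \<in> set Ms" for M
    proof -
      have "sets M = sets borel" using that \<open>\<And>M. M \<in> set Ms \<Longrightarrow> sets M = sets borel\<close> by blast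
      then show ?thesis
        unfolding SUP_apply using seq measurable_cong_sets[of M borel borel borel]
        by (intro nn_integral_monotone_convergence_SUP) auto
    qed
    then have "(\<Sum>M\<leftarrow>Ms. \<integral>\<^sup>+y. (SUP i. U i) y \<partial>M) = (\<Sum>M\<leftarrow>Ms. SUP i. \<integral>\<^sup>+y. U i y \<partial>M)"
      by (intro arg_cong[where f=sum_list] map_cong) auto
    also have "\<dots> = (SUP i. \<Sum>M\<leftarrow>Ms. \<integral>\<^sup>+y. U i y \<partial>M)"
      using seq
      by (intro sum_list_SUP_ennreal) (auto simp: incseq_def le_fun_def intro!: nn_integral_mono)
    finally show ?thesis .
  qed
  then show ?case using sets seq by (auto intro!: SUP_mono')
qed

lemma signed_integral_uminus:
  "signed_integral (\<lambda>E. - \<nu> E) f = - signed_integral \<nu> f"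
  by (simp add: signed_integral_def)

text \<open>
  On bounded sets \<open>\<nu> - a dy \<le> \<mu>\<close> means \<open>\<nu>\<^sup>+ + a\<^sup>- dy \<le> \<nu>\<^sup>- + a\<^sup>+ dy + \<mu>\<close>. In this form the inequality can be
  integrated over the whole space.
\<close>

lemma signed_integral_minus_lborel_le:
  fixes \<nu> :: "'a::euclidean_space set \<Rightarrow> real"
  assumes \<nu>: "locally_finite_signed_measure \<nu>"
    and \<mu>: "sets \<mu> = sets borel"
    and le: "\<And>B. B \<in> sets borel \<Longrightarrow> bounded B \<Longrightarrow>
      ennreal (\<nu> B - a * measure lborel B) \<le> emeasure \<mu> B"
    and f: "f \<in> borel_measurable borel" "\<And>y. 0 \<le> f y"
    and fin: "(\<integral>\<^sup>+y. f y \<partial>positive_part \<nu>) < \<infinity>" "(\<integral>\<^sup>+y. f y \<partial>positive_part (\<lambda>E. - \<nu> E)) < \<infinity>"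
      "(\<integral>\<^sup>+y. f y \<partial>lborel) < \<infinity>" "(\<integral>\<^sup>+y. f y \<partial>\<mu>) < \<infinity>"
  shows "signed_integral \<nu> f - a * (\<integral>y. f y \<partial>lborel) \<le> enn2real (\<integral>\<^sup>+y. f y \<partial>\<mu>)"
proof -
  define ap am where "ap = max 0 a" and "am = max 0 (- a)"
  have a: "a = ap - am" "0 \<le> ap" "0 \<le> am" by (auto simp: ap_def am_def)
  let ?N = "positive_part (\<lambda>E. - \<nu> E)"
  have "(\<Sum>M\<leftarrow>[positive_part \<nu>, scale_measure (ennreal am) lborel]. \<integral>\<^sup>+y. f y \<partial>M)
      \<le> (\<Sum>M\<leftarrow>[?N, scale_measure (ennreal ap) lborel, \<mu>]. \<integral>\<^sup>+y. f y \<partial>M)"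
  proof (rule nn_integral_sum_list_mono_measure)
    fix B :: "'a set"
    assume B: "B \<in> sets borel" "bounded B"
    have lb: "emeasure lborel B = ennreal (measure lborel B)"
      using emeasure_bounded_finite[OF B(2)] by (intro emeasure_eq_ennreal_measure) auto
    show "(\<Sum>M\<leftarrow>[positive_part \<nu>, scale_measure (ennreal am) lborel]. emeasure M B)
        \<le> (\<Sum>M\<leftarrow>[?N, scale_measure (ennreal ap) lborel, \<mu>]. emeasure M B)"
    proof (cases "emeasure \<mu> B = \<infinity>")
      case False
      then have m: "emeasure \<mu> B = ennreal (measure \<mu> B)"
        by (intro emeasure_eq_ennreal_measure) auto
      have "\<nu> B - a * measure lborel B \<le> measure \<mu> B"
        using le[OF B] unfolding m by (simp add: ennreal_le_iff)
      then have "\<nu> B + am * measure lborel B \<le> ap * measure lborel B + measure \<mu> B"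
        by (subst (asm) a(1)) (simp add: algebra_simps)
      then have "emeasure (positive_part \<nu>) B + ennreal (am * measure lborel B)
        \<le> emeasure ?N B + ennreal (ap * measure lborel B + measure \<mu> B)"
        using a by (intro positive_part_le_Jordan[OF \<nu> B]) auto
      then show ?thesis
        using a by (simp add: lb m ennreal_mult add.assoc)
    qed simp
  qed (use f \<mu> in auto)
  moreover have "f \<in> borel_measurable M" if "sets M = sets borel" for M :: "'a measure"
    using f that measurable_cong_sets by blast
  ultimately have *: "(\<integral>\<^sup>+y. f y \<partial>positive_part \<nu>) + ennreal am * (\<integral>\<^sup>+y. f y \<partial>lborel)
      \<le> (\<integral>\<^sup>+y. f y \<partial>?N) + ennreal ap * (\<integral>\<^sup>+y. f y \<partial>lborel) + (\<integral>\<^sup>+y. f y \<partial>\<mu>)"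
    using f by (simp add: nn_integral_scale_measure add.assoc)
  obtain p n l m where pnlm: "(\<integral>\<^sup>+y. f y \<partial>positive_part \<nu>) = ennreal p" "(\<integral>\<^sup>+y. f y \<partial>?N) = ennreal n"
    "(\<integral>\<^sup>+y. f y \<partial>lborel) = ennreal l" "(\<integral>\<^sup>+y. f y \<partial>\<mu>) = ennreal m"
    and nn: "0 \<le> p" "0 \<le> n" "0 \<le> l" "0 \<le> m"
    using fin by (auto simp: less_top_ennreal)
  have "ennreal (p + am * l) \<le> ennreal (n + ap * l + m)"
    using * nn a by (simp add: pnlm ennreal_mult)
  then have "p + am * l \<le> n + ap * l + m"
    using nn a by (subst (asm) ennreal_le_iff) auto
  moreover have "(\<integral>y. f y \<partial>positive_part \<nu>) = p" "(\<integral>y. f y \<partial>?N) = n" "(\<integral>y. f y \<partial>lborel) = l"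
    using f nn by (subst integral_eq_nn_integral; simp add: pnlm)+
  ultimately show ?thesis
    unfolding signed_integral_def by (subst a(1)) (simp add: pnlm nn algebra_simps)
qed

text \<open>
  Applied with \<open>s\<close> equal to plus or minus the real or imaginary part of \<open>\<nu>\<close>: integrability with respect
  to \<open>|\<nu>|\<close> passes to the four measures of the Jordan decompositions.
\<close>

lemma positive_part_le_total_variation:
  assumes \<nu>: "locally_finite_complex_measure \<nu>" and s: "locally_finite_signed_measure s"
    and le: "\<And>B. s B \<le> norm (\<nu> B)" and E: "E \<in> sets borel"
  shows "emeasure (positive_part s) E \<le> emeasure (total_variation \<nu>) E"
  unfolding emeasure_positive_part[OF s E]
proof (rule SUP_least)
  fix F assume F: "F \<in> {F. F \<in> sets borel \<and> bounded F \<and> F \<subseteq> E}"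
  have "ennreal (s F) \<le> ennreal (norm (\<nu> F))" by (intro ennreal_leI le)
  also have "\<dots> \<le> emeasure (total_variation \<nu>) F" using F \<nu> by (intro norm_le_total_variation) auto
  also have "\<dots> \<le> emeasure (total_variation \<nu>) E" using F E by (intro emeasure_mono) auto
  finally show "ennreal (s F) \<le> emeasure (total_variation \<nu>) E" .
qed

lemma nn_integral_positive_part_le_total_variation:
  fixes f :: "'a::euclidean_space \<Rightarrow> ennreal"
  assumes \<nu>: "locally_finite_complex_measure \<nu>" and s: "locally_finite_signed_measure s"
    and le: "\<And>B. s B \<le> norm (\<nu> B)" and f: "f \<in> borel_measurable borel"
  shows "(\<integral>\<^sup>+y. f y \<partial>positive_part s) \<le> (\<integral>\<^sup>+y. f y \<partial>total_variation \<nu>)"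
proof -
  have "(\<Sum>M\<leftarrow>[positive_part s]. \<integral>\<^sup>+y. f y \<partial>M) \<le> (\<Sum>M\<leftarrow>[total_variation \<nu>]. \<integral>\<^sup>+y. f y \<partial>M)"
    by (rule nn_integral_sum_list_mono_measure)
       (use f positive_part_le_total_variation[OF \<nu> s le] in auto)
  then show ?thesis by simp
qed

lemma nn_integral_total_variation_minus_le:
  fixes f :: "'a::euclidean_space \<Rightarrow> ennreal"
  assumes \<nu>: "locally_finite_complex_measure \<nu>" and f: "f \<in> borel_measurable borel"
  shows "(\<integral>\<^sup>+y. f y \<partial>total_variation (minus_const_lebesgue \<nu> l))
    \<le> (\<integral>\<^sup>+y. f y \<partial>total_variation \<nu>) + ennreal (norm l) * (\<integral>\<^sup>+y. f y \<partial>lborel)"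
proof -
  have "(\<Sum>M\<leftarrow>[total_variation (minus_const_lebesgue \<nu> l)]. \<integral>\<^sup>+y. f y \<partial>M)
      \<le> (\<Sum>M\<leftarrow>[total_variation \<nu>, scale_measure (ennreal (norm l)) lborel]. \<integral>\<^sup>+y. f y \<partial>M)"
    by (rule nn_integral_sum_list_mono_measure)
       (use f total_variation_minus_const_lebesgue_le[OF \<nu>] in auto)
  then show ?thesis using f by (simp add: nn_integral_scale_measure)
qed

text \<open>
  The factor 2 comes from estimating real and imaginary parts separately.
\<close>

lemma complex_measure_integral_minus_lborel_le:
  fixes \<nu> :: "'a::euclidean_space set \<Rightarrow> complex"
  assumes \<nu>: "locally_finite_complex_measure \<nu>"
    and f: "f \<in> borel_measurable borel" "\<And>y. 0 \<le> f y"
    and fin: "(\<integral>\<^sup>+y. f y \<partial>total_variation \<nu>) < \<infinity>" "(\<integral>\<^sup>+y. f y \<partial>lborel) < \<infinity>"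
  shows "norm (complex_measure_integral \<nu> f - l * of_real (\<integral>y. f y \<partial>lborel))
    \<le> 2 * enn2real (\<integral>\<^sup>+y. f y \<partial>total_variation (minus_const_lebesgue \<nu> l))"
proof -
  let ?\<mu> = "total_variation (minus_const_lebesgue \<nu> l)"
  let ?I = "enn2real (\<integral>\<^sup>+y. f y \<partial>?\<mu>)"
  have fin\<mu>: "(\<integral>\<^sup>+y. f y \<partial>?\<mu>) < \<infinity>"
    using nn_integral_total_variation_minus_le[OF \<nu>, of "\<lambda>y. ennreal (f y)" l] f fin
    by (auto simp: ennreal_mult_less_top intro: le_less_trans)
  have part: "\<bar>signed_integral s f - a * (\<integral>y. f y \<partial>lborel)\<bar> \<le> ?I"
    if s: "locally_finite_signed_measure s" and le: "\<And>B. \<bar>s B\<bar> \<le> norm (\<nu> B)"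
      and sa: "\<And>B. \<bar>s B - a * measure lborel B\<bar> \<le> norm (minus_const_lebesgue \<nu> l B)" for s a
  proof -
    note s' = locally_finite_signed_measure_uminus[OF s]
    have le1: "s B \<le> norm (\<nu> B)" and le2: "- s B \<le> norm (\<nu> B)" for B
      using le[of B] by linarith+
    have finp: "(\<integral>\<^sup>+y. f y \<partial>positive_part s) < \<infinity>" "(\<integral>\<^sup>+y. f y \<partial>positive_part (\<lambda>E. - s E)) < \<infinity>"
      using f(1) fin(1)
      by (auto intro!: le_less_trans[OF nn_integral_positive_part_le_total_variation[OF \<nu> s le1]]
          le_less_trans[OF nn_integral_positive_part_le_total_variation[OF \<nu> s' le2]])
    have \<mu>le: "ennreal c \<le> emeasure ?\<mu> B"
      if "B \<in> sets borel" "bounded B" "c \<le> norm (minus_const_lebesgue \<nu> l B)" for c B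
      using norm_le_total_variation[OF locally_finite_minus_const_lebesgue[OF \<nu>] that(1,2), of l]
        ennreal_leI[OF that(3)] by (rule order_trans[rotated])
    have "signed_integral s f - a * (\<integral>y. f y \<partial>lborel) \<le> ?I"
      using sa by (intro signed_integral_minus_lborel_le s f fin fin\<mu> finp \<mu>le) (auto dest: abs_le_D1)
    moreover have "signed_integral (\<lambda>E. - s E) f - (- a) * (\<integral>y. f y \<partial>lborel) \<le> ?I"
    proof (intro signed_integral_minus_lborel_le s' f fin fin\<mu> finp \<mu>le)
      show "- s B - - a * measure lborel B \<le> norm (minus_const_lebesgue \<nu> l B)" for B
        using sa[of B] by linarith
    qed (use finp in auto)
    ultimately show ?thesis by (simp add: signed_integral_uminus)
  qed
  have "\<bar>signed_integral (\<lambda>E. Re (\<nu> E)) f - Re l * (\<integral>y. f y \<partial>lborel)\<bar> \<le> ?I"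
    using \<nu> abs_Re_le_cmod[of "minus_const_lebesgue \<nu> l _"]
    by (intro part) (auto simp: locally_finite_complex_measure_def abs_Re_le_cmod minus_const_lebesgue_def)
  moreover have "\<bar>signed_integral (\<lambda>E. Im (\<nu> E)) f - Im l * (\<integral>y. f y \<partial>lborel)\<bar> \<le> ?I"
    using \<nu> abs_Im_le_cmod[of "minus_const_lebesgue \<nu> l _"]
    by (intro part) (auto simp: locally_finite_complex_measure_def abs_Im_le_cmod minus_const_lebesgue_def)
  ultimately show ?thesis
    by (intro order_trans[OF cmod_le]) (simp add: complex_measure_integral_def)
qed

section \<open>Bounds for the kernel\<close>

text \<open>
  The integrand of the kernel, in the variable \<open>s\<close> of the subordination formula.
\<close>

definition hermite_integrand :: "real \<Rightarrow> 'a::euclidean_space \<Rightarrow> 'a \<Rightarrow> real \<Rightarrow> real" where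
  "hermite_integrand t x y s =
     exp (- t\<^sup>2 / kappa s) * (1 - s\<^sup>2) powr (real DIM('a) / 2 - 1) *
     exp (- (1 / 4) * ((norm (x - y))\<^sup>2 / s + s * (norm (x + y))\<^sup>2)) /
     (s powr (real DIM('a) / 2) * kappa s powr (3 / 2))"

lemma hermite_integrand_eq:
  fixes x y :: "'a::euclidean_space"
  shows "hermite_integrand t x y s =
     exp (- t\<^sup>2 / kappa s) * (1 - s\<^sup>2) powr (real DIM('a) / 2 - 1) *
     exp (- (1 / 4) * ((norm (x - y))\<^sup>2 / s + s * (norm (x + y))\<^sup>2)) *
     (1 / (s powr (real DIM('a) / 2) * kappa s powr (3 / 2)))"
  unfolding hermite_integrand_def by (simp only: times_divide_eq_right mult_1_right)

lemma hermite_integrand_nonneg: "0 \<le> hermite_integrand t x y s"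
  by (simp add: hermite_integrand_def)

lemma kappa_ge:
  assumes "0 < s" "s < 1"
  shows "2 * s \<le> kappa s"
proof -
  have "ln ((1 - s) / (1 + s)) \<le> (1 - s) / (1 + s) - 1"
    using assms by (intro ln_le_minus_one) auto
  also have "\<dots> = - (2 * s / (1 + s))" using assms by (simp add: field_simps)
  also have "\<dots> \<le> - s" using assms by (simp add: field_simps)
  finally show ?thesis using assms by (simp add: kappa_def ln_div)
qed

lemma kappa_le:
  assumes "0 < s" "s < 1"
  shows "kappa s \<le> 4 * s / (1 - s)"
proof -
  have "ln ((1 + s) / (1 - s)) \<le> (1 + s) / (1 - s) - 1"
    using assms by (intro ln_le_minus_one) auto
  also have "\<dots> = 2 * s / (1 - s)" using assms by (simp add: field_simps)
  finally show ?thesis by (simp add: kappa_def)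
qed

lemma kappa_pos: "0 < s \<Longrightarrow> s < 1 \<Longrightarrow> 0 < kappa s"
  using kappa_ge[of s] by linarith

text \<open>
  In terms of \<open>z = Q / s\<close> this is the boundedness of \<open>(1 + z) powr m * exp (- z / 16)\<close>. The right-hand side
  has an elementary primitive in \<open>s\<close>, with \<open>Q powr (1 - m) / (m - 1)\<close> as its integral over \<open>s > 0\<close>.
\<close>

lemma exp_minus_div_mult_powr_le:
  fixes Q s m :: real
  assumes "0 \<le> Q" "0 < s" "1 \<le> m"
  shows "exp (- Q / (16 * s)) * s powr (- m) \<le> (16 * m) powr m * (s + Q) powr (- m)"
proof -
  define z where "z = Q / s"
  have z: "0 \<le> z" "s + Q = s * (1 + z)" using assms by (auto simp: z_def field_simps)
  have "1 + z \<le> 16 * m + z" using assms by simp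
  also have "\<dots> = 16 * m * (1 + z / (16 * m))" using assms by (simp add: field_simps)
  also have "\<dots> \<le> 16 * m * exp (z / (16 * m))"
    using assms by (intro mult_left_mono exp_ge_add_one_self) auto
  finally have "(1 + z) powr m \<le> (16 * m * exp (z / (16 * m))) powr m"
    using z assms by (intro powr_mono2) auto
  also have "\<dots> = (16 * m) powr m * exp (z / 16)"
    using assms by (simp add: powr_mult exp_powr_real)
  finally have "exp (- z / 16) * (1 + z) powr m \<le> exp (- z / 16) * ((16 * m) powr m * exp (z / 16))"
    by (intro mult_left_mono) auto
  also have "\<dots> = (16 * m) powr m" by (simp add: exp_minus)
  finally have "exp (- z / 16) * (1 + z) powr m * (s + Q) powr (- m) \<le> (16 * m) powr m * (s + Q) powr (- m)"
    by (intro mult_right_mono) auto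
  moreover have "(1 + z) powr m * (s + Q) powr (- m) = s powr (- m)"
  proof -
    have "(s + Q) powr (- m) = s powr (- m) * (1 + z) powr (- m)"
      unfolding z(2) using z(1) assms by (simp add: powr_mult)
    then show ?thesis using z(1) by (simp add: powr_minus)
  qed
  moreover have "- Q / (16 * s) = - z / 16" by (simp add: z_def)
  ultimately show ?thesis by (simp only: mult.assoc)
qed

text \<open>
  For \<open>s \<le> 1/4\<close> one quarter of \<open>|x - y|\<^sup>2 / (4 * s)\<close> is kept as a Gaussian on the scale \<open>s\<close>. The remaining
  three quarters are at least \<open>3/4 * |x - y|\<^sup>2\<close>, which for bounded \<open>x\<close> yields decay \<open>exp (- 5/8 * |y|\<^sup>2)\<close>. Since
  \<open>5/8 > 1/2\<close> this is better than the decay of \<open>Phi\<close>.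
\<close>

lemma hermite_integrand_le_near_zero:
  fixes x y :: "'a::euclidean_space"
  defines "m \<equiv> (real DIM('a) + 3) / 2"
  assumes s: "0 < s" "s \<le> 1 / 4" and x: "norm x \<le> R"
  shows "hermite_integrand t x y s \<le>
    2 * exp (15 / 4 * R\<^sup>2) * (16 * m) powr m * exp (- (5 / 8) * (norm y)\<^sup>2) *
    (s + (t\<^sup>2 + (norm (x - y))\<^sup>2)) powr (- m)"
proof -
  let ?A = "(norm (x - y))\<^sup>2" and ?d = "real DIM('a)"
  have k: "s \<le> kappa s" "kappa s \<le> 16 * s" "0 < kappa s"
  proof -
    show "s \<le> kappa s" "0 < kappa s" using kappa_ge[of s] s by linarith+
    have "4 * s / (1 - s) \<le> 16 * s" using s by (simp add: field_simps)
    then show "kappa s \<le> 16 * s" using kappa_le[of s] s by linarith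
  qed
  have 1: "exp (- t\<^sup>2 / kappa s) \<le> exp (- t\<^sup>2 / (16 * s))"
    using k s by (simp add: frac_le)
  have 2: "(1 - s\<^sup>2) powr (?d / 2 - 1) \<le> 2"
  proof -
    have s2: "1 / 4 \<le> 1 - s\<^sup>2"
      using s power_mono[of s "1/4" 2] by (simp add: power2_eq_square)
    have "(1 - s\<^sup>2) powr (?d / 2 - 1) \<le> (1 - s\<^sup>2) powr (- (1 / 2))"
      using s2 by (intro powr_mono') (auto simp: field_simps Suc_le_eq)
    also have "\<dots> \<le> (1 / 4) powr (- (1 / 2))"
      using s2 by (intro powr_mono2') auto
    also have "\<dots> = 2" by (simp add: powr_minus powr_half_sqrt real_sqrt_divide)
    finally show ?thesis .
  qed
  have 3: "exp (- (1 / 4) * (?A / s + s * (norm (x + y))\<^sup>2))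
      \<le> exp (15 / 4 * R\<^sup>2) * exp (- (5 / 8) * (norm y)\<^sup>2) * exp (- ?A / (16 * s))"
  proof -
    have "norm y \<le> norm (x - y) + R"
      using norm_triangle_sub[of y x] x by (simp add: norm_minus_commute)
    then have "(norm y)\<^sup>2 \<le> (norm (x - y) + R)\<^sup>2" by (intro power_mono) auto
    (* the cross term is bounded by ?A / 5 + 5 * R\<^sup>2 *)
    also have "\<dots> \<le> 6 / 5 * ?A + 6 * R\<^sup>2"
      using zero_le_power2[of "norm (x - y) - 5 * R"] by (simp add: power2_eq_square algebra_simps)
    finally have "5 / 8 * (norm y)\<^sup>2 \<le> 3 / 4 * ?A + 15 / 4 * R\<^sup>2" by simp
    moreover have "4 * ?A \<le> ?A / s" using s mult_right_mono[of s "1/4" ?A] by (simp add: field_simps)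
    moreover have "0 \<le> s * (norm (x + y))\<^sup>2" using s by simp
    moreover have "?A / (16 * s) = (?A / s) / 16" by simp
    ultimately have "- (1 / 4) * (?A / s + s * (norm (x + y))\<^sup>2)
      \<le> 15 / 4 * R\<^sup>2 + - (5 / 8) * (norm y)\<^sup>2 + - (?A / (16 * s))" by argo
    then show ?thesis by (simp add: exp_add[symmetric])
  qed
  have 4: "1 / (s powr (?d / 2) * kappa s powr (3 / 2)) \<le> s powr (- m)"
  proof -
    have "s powr m = s powr (?d / 2) * s powr (3 / 2)"
      by (simp add: m_def powr_add[symmetric] add_divide_distrib)
    also have "\<dots> \<le> s powr (?d / 2) * kappa s powr (3 / 2)"
      using s k by (intro mult_left_mono powr_mono2) auto
    finally have "1 / (s powr (?d / 2) * kappa s powr (3 / 2)) \<le> 1 / s powr m"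
      using s k by (intro frac_le) auto
    then show ?thesis by (simp add: powr_minus_divide)
  qed
  have "hermite_integrand t x y s \<le> exp (- t\<^sup>2 / (16 * s)) * 2 *
      (exp (15 / 4 * R\<^sup>2) * exp (- (5 / 8) * (norm y)\<^sup>2) * exp (- ?A / (16 * s))) * s powr (- m)"
    unfolding hermite_integrand_eq
    by (rule mult_mono[OF mult_mono[OF mult_mono[OF 1 2] 3] 4]) auto
  also have "\<dots> = 2 * exp (15 / 4 * R\<^sup>2) * exp (- (5 / 8) * (norm y)\<^sup>2) *
      (exp (- (t\<^sup>2 + ?A) / (16 * s)) * s powr (- m))"
  proof -
    have "exp (- (t\<^sup>2 + ?A) / (16 * s)) = exp (- t\<^sup>2 / (16 * s)) * exp (- ?A / (16 * s))"
      using s by (simp add: exp_add[symmetric] field_simps)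
    then show ?thesis by (simp only: mult_ac)
  qed
  also have "\<dots> \<le> 2 * exp (15 / 4 * R\<^sup>2) * exp (- (5 / 8) * (norm y)\<^sup>2) *
      ((16 * m) powr m * (s + (t\<^sup>2 + ?A)) powr (- m))"
    using s by (intro mult_left_mono exp_minus_div_mult_powr_le) (auto simp: m_def)
  finally show ?thesis by (simp add: mult_ac)
qed

lemma nn_integral_add_powr:
  fixes Q p :: real
  assumes "0 < Q" "0 < p"
  shows "(\<integral>\<^sup>+s\<in>{0..}. ennreal ((s + Q) powr (- p - 1)) \<partial>lborel) = ennreal (Q powr (- p) / p)"
proof -
  have "(\<integral>\<^sup>+s. ennreal ((s + Q) powr (- p - 1)) * indicator {0..} s \<partial>lborel)
      = 0 - (- ((0 + Q) powr (- p) / p))"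
  proof (rule nn_integral_FTC_atLeast)
    fix s :: real assume "0 \<le> s"
    then show "((\<lambda>s. - ((s + Q) powr (- p) / p)) has_real_derivative (s + Q) powr (- p - 1)) (at s)"
      using assms by (auto intro!: derivative_eq_intros)
  next
    have "filterlim (\<lambda>s. s + Q) at_top at_top"
      by (intro filterlim_at_top_mono[OF filterlim_ident] eventually_at_top_linorderI[of 0])
         (use assms in auto)
    then have "((\<lambda>s. (s + Q) powr (- p)) \<longlongrightarrow> 0) at_top"
      using assms by (intro tendsto_neg_powr) auto
    then show "((\<lambda>s. - ((s + Q) powr (- p) / p)) \<longlongrightarrow> 0) at_top"
      using tendsto_minus[OF tendsto_divide[OF _ tendsto_const[of p]]] assms by fastforce
  qed auto
  then show ?thesis by simp
qed

text \<open>
  The behaviour at \<open>s = 1\<close> produces the weight \<open>Phi\<close>. At \<open>s = 1\<close> the exponent is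
  \<open>- (|x|\<^sup>2 + |y|\<^sup>2) / 2\<close>, and it decreases away from it on the scale \<open>1 - s \<approx> 1 / (1 + |y|)\<close>.
  On this scale \<open>(1 - s) powr (d / 2 - 1)\<close> integrates to \<open>(1 + |y|) powr (- d / 2)\<close> and
  \<open>kappa s\<close> is comparable with \<open>ln (e + |y|)\<close>.
\<close>

lemma ln_le_mult_kappa:
  assumes s: "1 / 4 \<le> s" "s < 1" and "0 \<le> r"
  shows "ln (exp 1 + r) \<le> (1 + (1 - s) * (1 + r)) * (3 * kappa s)"
proof -
  define v w where "v = 1 - s" and "w = v * (1 + r)"
  have v: "0 < v" "v < 1" and w: "0 < w" using s assms by (auto simp: v_def w_def)
  have "exp 1 + r \<le> exp 1 * (1 + r)"
    using mult_right_mono[of 1 "exp (1::real)" r] assms by (simp add: algebra_simps)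
  also have "\<dots> = exp 1 * w / v" using v by (simp add: w_def)
  finally have "ln (exp 1 + r) \<le> ln (exp 1 * w / v)"
    using assms by (subst ln_le_cancel_iff) (auto intro: add_pos_nonneg simp: v w)
  also have "\<dots> = 1 + ln w + ln (1 / v)"
    using v w by (simp add: ln_mult ln_div)
  also have "\<dots> \<le> 1 + w + ln (1 / v)"
    using ln_le_minus_one[OF w] by simp
  also have "\<dots> \<le> (1 + w) * (1 + ln (1 / v))"
    using v w by (simp add: algebra_simps ln_div mult_nonneg_nonpos)
  also have "\<dots> \<le> (1 + w) * (3 * kappa s)"
  proof (rule mult_left_mono)
    have "ln (1 / v) \<le> ln ((1 + s) / (1 - s))"
      using s by (subst ln_le_cancel_iff) (auto simp: v_def divide_right_mono)
    moreover have "1 \<le> 2 * kappa s" using kappa_ge[of s] s by linarith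
    ultimately show "1 + ln (1 / v) \<le> 3 * kappa s"
      unfolding kappa_def using s by simp
  qed (use w in auto)
  finally show ?thesis by (simp add: v_def w_def)
qed

text \<open>
  Put \<open>w = (1 - s) * (1 + |y|)\<close>. Up to a constant the exponent is at most \<open>- |y|\<^sup>2 / 2 - 3 * w\<close>, because it
  contains a negative multiple of \<open>((1 - s) * |y|)\<^sup>2\<close>, which dominates the linear terms. Of the factor \<open>exp (- 3 * w)\<close> two thirds compensate
  \<open>(1 + w) powr (3 / 2)\<close>, which is lost in replacing \<open>kappa s\<close> by \<open>ln (e + |y|)\<close>; the last third makes the
  integral in \<open>s\<close> converge on the scale \<open>1 / (1 + |y|)\<close>.
\<close>

lemma hermite_integrand_le_near_one:
  fixes x y :: "'a::euclidean_space"
  assumes s: "1 / 4 \<le> s" "s < 1" and x: "norm x \<le> R"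
  shows "hermite_integrand t x y s \<le>
    2 powr (real DIM('a) / 2) * 4 powr (real DIM('a) / 2) * 3 powr (3 / 2) * exp ((4 * R + 3)\<^sup>2 + 3) *
    (exp (- (norm y)\<^sup>2 / 2) / ln (exp 1 + norm y) powr (3 / 2)) *
    ((1 - s) powr (real DIM('a) / 2 - 1) * exp (- ((1 - s) * (1 + norm y))))"
proof -
  let ?d = "real DIM('a)"
  define v w q where "v = 1 - s" and "w = v * (1 + norm y)" and "q = v * norm y"
  have v: "0 < v" "v \<le> 1" using s by (auto simp: v_def)
  then have w: "0 \<le> w" "w \<le> q + 1" and q: "0 \<le> q" by (auto simp: w_def q_def algebra_simps)
  have R: "0 \<le> R" using norm_ge_zero[of x] x by linarith
  have k: "0 < kappa s" using kappa_pos[of s] s by simp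
  have 1: "exp (- t\<^sup>2 / kappa s) \<le> 1" using k by simp
  have 2: "(1 - s\<^sup>2) powr (?d / 2 - 1) \<le> v powr (?d / 2 - 1) * 2 powr (?d / 2)"
  proof -
    have "1 - s\<^sup>2 = v * (1 + s)" by (simp add: v_def power2_eq_square algebra_simps)
    then have "(1 - s\<^sup>2) powr (?d / 2 - 1) = v powr (?d / 2 - 1) * (1 + s) powr (?d / 2 - 1)"
      using s v by (simp add: powr_mult)
    also have "(1 + s) powr (?d / 2 - 1) \<le> (1 + s) powr (?d / 2)"
      using s by (intro powr_mono) auto
    also have "\<dots> \<le> 2 powr (?d / 2)" using s by (intro powr_mono2) auto
    finally show ?thesis by (simp add: mult_left_mono)
  qed
  have 3: "exp (- (1 / 4) * ((norm (x - y))\<^sup>2 / s + s * (norm (x + y))\<^sup>2)) * exp (2 * w)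
      \<le> exp ((4 * R + 3)\<^sup>2 + 3) * exp (- (norm y)\<^sup>2 / 2) * exp (- w)"
  proof -
    have E: "(norm (x - y))\<^sup>2 / s + s * (norm (x + y))\<^sup>2
      = ((norm x)\<^sup>2 + (norm y)\<^sup>2) * (2 + v\<^sup>2 / s) - 2 * ((x \<bullet> y) * (v * (1 + s) / s))"
    proof -
      have n: "(norm (x - y))\<^sup>2 = (norm x)\<^sup>2 + (norm y)\<^sup>2 - 2 * (x \<bullet> y)"
        "(norm (x + y))\<^sup>2 = (norm x)\<^sup>2 + (norm y)\<^sup>2 + 2 * (x \<bullet> y)"
        by (simp_all add: power2_norm_eq_inner inner_diff inner_add inner_commute)
      show ?thesis
        unfolding n v_def using s by (simp add: field_simps power2_eq_square)
    qed
    have "(x \<bullet> y) * (v * (1 + s) / s) \<le> (R * norm y) * (v * 8)"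
    proof -
      have a: "(1 + s) / s \<le> 8" using s by (simp add: field_simps)
      have "x \<bullet> y \<le> norm x * norm y" by (rule norm_cauchy_schwarz)
      also have "\<dots> \<le> R * norm y" using x by (intro mult_right_mono) auto
      finally have "(x \<bullet> y) * (v * (1 + s) / s) \<le> (R * norm y) * (v * (1 + s) / s)"
        using s v by (intro mult_right_mono) auto
      also have "\<dots> = (R * norm y * v) * ((1 + s) / s)" by simp
      also have "\<dots> \<le> (R * norm y * v) * 8" using a R v by (intro mult_left_mono) auto
      finally show ?thesis by (simp add: mult_ac)
    qed
    moreover have "(norm y)\<^sup>2 * (2 + v\<^sup>2) \<le> ((norm x)\<^sup>2 + (norm y)\<^sup>2) * (2 + v\<^sup>2 / s)"
      using s by (intro mult_mono add_mono) (auto simp: field_simps mult_left_le_one_le)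
    ultimately have "(norm y)\<^sup>2 * (2 + v\<^sup>2) - 16 * R * q \<le> (norm (x - y))\<^sup>2 / s + s * (norm (x + y))\<^sup>2"
      unfolding E q_def by (simp only: mult_ac)
    then have "2 * (norm y)\<^sup>2 + q\<^sup>2 - 16 * R * q \<le> (norm (x - y))\<^sup>2 / s + s * (norm (x + y))\<^sup>2"
      by (simp add: q_def power_mult_distrib algebra_simps)
    moreover have "- (q\<^sup>2 / 4) + (4 * R + 3) * q \<le> (4 * R + 3)\<^sup>2"
      using zero_le_power2[of "q / 2 - (4 * R + 3)"] by (simp add: power2_eq_square algebra_simps)
    ultimately have "- (1 / 4) * ((norm (x - y))\<^sup>2 / s + s * (norm (x + y))\<^sup>2) + 2 * w
      \<le> ((4 * R + 3)\<^sup>2 + 3) + - (norm y)\<^sup>2 / 2 + - w"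
      using w by (simp add: algebra_simps)
    then show ?thesis by (simp only: exp_add[symmetric] exp_le_cancel_iff)
  qed
  have ln1: "1 \<le> ln (exp 1 + norm y)"
    by (subst ln_ge_iff) (auto intro: add_pos_nonneg)
  have 4: "1 / (s powr (?d / 2) * kappa s powr (3 / 2))
      \<le> 4 powr (?d / 2) * (3 powr (3 / 2) * exp (2 * w) / ln (exp 1 + norm y) powr (3 / 2))"
  proof -
    have "ln (exp 1 + norm y) \<le> exp w * (3 * kappa s)"
      using ln_le_mult_kappa[OF s, of "norm y"] k
      by (intro order_trans[OF _ mult_right_mono[OF exp_ge_add_one_self[of w]]])
         (auto simp: w_def v_def)
    then have "ln (exp 1 + norm y) powr (3 / 2) \<le> (exp w * (3 * kappa s)) powr (3 / 2)"
      using ln1 by (intro powr_mono2) auto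
    also have "\<dots> = exp (3 / 2 * w) * 3 powr (3 / 2) * kappa s powr (3 / 2)"
      using k by (simp add: powr_mult exp_powr_real)
    also have "\<dots> \<le> exp (2 * w) * 3 powr (3 / 2) * kappa s powr (3 / 2)"
      using w by (intro mult_right_mono) auto
    finally have "1 / kappa s powr (3 / 2) \<le> 3 powr (3 / 2) * exp (2 * w) / ln (exp 1 + norm y) powr (3 / 2)"
      using k ln1 by (simp add: field_simps)
    moreover have "1 / s powr (?d / 2) \<le> 4 powr (?d / 2)"
    proof -
      have "1 / s powr (?d / 2) = (1 / s) powr (?d / 2)" using s by (simp add: powr_divide)
      also have "\<dots> \<le> 4 powr (?d / 2)" using s by (intro powr_mono2) (auto simp: field_simps)
      finally show ?thesis .
    qed
    ultimately have "(1 / s powr (?d / 2)) * (1 / kappa s powr (3 / 2))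
      \<le> 4 powr (?d / 2) * (3 powr (3 / 2) * exp (2 * w) / ln (exp 1 + norm y) powr (3 / 2))"
      by (intro mult_mono) auto
    then show ?thesis by simp
  qed
  let ?E = "exp (- (1 / 4) * ((norm (x - y))\<^sup>2 / s + s * (norm (x + y))\<^sup>2))"
  have "hermite_integrand t x y s
      \<le> 1 * (v powr (?d / 2 - 1) * 2 powr (?d / 2)) * ?E *
        (4 powr (?d / 2) * (3 powr (3 / 2) * exp (2 * w) / ln (exp 1 + norm y) powr (3 / 2)))"
    unfolding hermite_integrand_eq
    by (rule mult_mono[OF mult_mono[OF mult_mono[OF 1 2] order_refl] 4]) auto
  also have "\<dots> = 2 powr (?d / 2) * 4 powr (?d / 2) * 3 powr (3 / 2) *
      (v powr (?d / 2 - 1) / ln (exp 1 + norm y) powr (3 / 2)) * (?E * exp (2 * w))"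
    by simp
  also have "\<dots> \<le> 2 powr (?d / 2) * 4 powr (?d / 2) * 3 powr (3 / 2) *
      (v powr (?d / 2 - 1) / ln (exp 1 + norm y) powr (3 / 2)) *
      (exp ((4 * R + 3)\<^sup>2 + 3) * exp (- (norm y)\<^sup>2 / 2) * exp (- w))"
    by (intro mult_left_mono 3) auto
  finally show ?thesis by (simp add: v_def w_def mult_ac)
qed

lemma nn_integral_powr_mult_exp:
  fixes Y a :: real
  assumes "0 < Y" "0 < a"
  shows "(\<integral>\<^sup>+s\<in>{..1}. ennreal ((1 - s) powr (a - 1) * exp (- ((1 - s) * Y))) \<partial>lborel)
    = ennreal (Gamma a * Y powr (- a))"
proof -
  let ?I = "\<integral>\<^sup>+s\<in>{..1}. ennreal ((1 - s) powr (a - 1) * exp (- ((1 - s) * Y))) \<partial>lborel"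
  have "ennreal (Gamma a) = (\<integral>\<^sup>+u. ennreal (indicator {0..} u * u powr (a - 1) / exp u) \<partial>lborel)"
    by (rule Gamma_conv_nn_integral_real) fact
  also have "\<dots> = ennreal \<bar>- Y\<bar> * (\<integral>\<^sup>+s. ennreal (indicator {0..} (Y + (- Y) * s) *
      (Y + (- Y) * s) powr (a - 1) / exp (Y + (- Y) * s)) \<partial>lborel)"
    using assms by (intro nn_integral_real_affine) auto
  also have "(\<integral>\<^sup>+s. ennreal (indicator {0..} (Y + (- Y) * s) *
      (Y + (- Y) * s) powr (a - 1) / exp (Y + (- Y) * s)) \<partial>lborel)
      = (\<integral>\<^sup>+s. ennreal (Y powr (a - 1)) *
          (ennreal ((1 - s) powr (a - 1) * exp (- ((1 - s) * Y))) * indicator {..1} s) \<partial>lborel)"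
  proof (rule nn_integral_cong)
    fix s :: real
    have "Y + (- Y) * s = Y * (1 - s)" by (simp add: algebra_simps)
    then show "ennreal (indicator {0..} (Y + (- Y) * s) * (Y + (- Y) * s) powr (a - 1) / exp (Y + (- Y) * s))
      = ennreal (Y powr (a - 1)) *
          (ennreal ((1 - s) powr (a - 1) * exp (- ((1 - s) * Y))) * indicator {..1} s)"
      using assms
      by (cases "s \<le> 1")
         (auto simp: indicator_def zero_le_mult_iff powr_mult ennreal_mult[symmetric] exp_minus
            divide_inverse mult_ac)
  qed
  also have "\<dots> = ennreal (Y powr (a - 1)) * ?I"
    by (rule nn_integral_cmult) auto
  finally have "ennreal (Gamma a) = ennreal (Y powr a) * ?I"
    using assms by (simp add: mult.assoc[symmetric] ennreal_mult[symmetric] powr_diff)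
  then have "ennreal (Y powr (- a)) * ennreal (Gamma a) = ennreal (Y powr (- a)) * (ennreal (Y powr a) * ?I)"
    by simp
  also have "\<dots> = ?I"
    using assms by (simp add: mult.assoc[symmetric] ennreal_mult[symmetric] powr_add[symmetric])
  finally show ?thesis using assms by (simp add: ennreal_mult[symmetric] mult.commute Gamma_real_pos less_imp_le)
qed

lemma ln_exp_1_plus_ge_1: "0 \<le> r \<Longrightarrow> 1 \<le> ln (exp 1 + r :: real)"
  by (subst ln_ge_iff) (auto intro: add_pos_nonneg)

lemma Phi_denominator_ge_1:
  "1 \<le> (1 + norm (y::'a::euclidean_space)) powr (real DIM('a) / 2) * ln (exp 1 + norm y) powr (3 / 2)"
proof -
  have "1 * 1 \<le> (1 + norm y) powr (real DIM('a) / 2) * ln (exp 1 + norm y) powr (3 / 2)"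
    using ln_exp_1_plus_ge_1[of "norm y"] by (intro mult_mono ge_one_powr_ge_zero) auto
  then show ?thesis by simp
qed

lemma Phi_pos: "0 < Phi y"
  unfolding Phi_def using Phi_denominator_ge_1[of y] by (intro divide_pos_pos) auto

lemma Phi_le: "Phi y \<le> exp (- (norm y)\<^sup>2 / 2)"
proof -
  have "Phi y \<le> exp (- (norm y)\<^sup>2 / 2) / 1"
    unfolding Phi_def by (rule divide_left_mono[OF Phi_denominator_ge_1]) (use Phi_denominator_ge_1[of y] in auto)
  then show ?thesis by simp
qed

lemma Phi_le_1: "Phi y \<le> 1"
  using Phi_le[of y] by (rule order_trans) simp

lemma borel_measurable_Phi [measurable]: "Phi \<in> borel_measurable borel"
  unfolding Phi_def[abs_def] by measurable

text \<open>
  The surplus \<open>exp (- |y|\<^sup>2 / 8)\<close> absorbs the denominator of \<open>Phi\<close>, which grows at most exponentially in \<open>|y|\<close>.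
\<close>

lemma exp_le_Phi:
  fixes y :: "'a::euclidean_space"
  shows "exp (- (5 / 8) * (norm y)\<^sup>2) \<le> exp (2 * ((real DIM('a) + 3) / 2)\<^sup>2) * Phi y"
proof -
  define r e where "r = norm y" and "e = (real DIM('a) + 3) / 2"
  have r: "0 \<le> r" by (simp add: r_def)
  have l1: "1 \<le> ln (exp 1 + r)" using r by (rule ln_exp_1_plus_ge_1)
  have "exp 1 + r \<le> exp 1 * (1 + r)"
    using mult_right_mono[of 1 "exp (1::real)" r] r by (simp add: algebra_simps)
  also have "\<dots> \<le> exp 1 * exp r" by (intro mult_left_mono) auto
  also have "\<dots> = exp (1 + r)" by (simp add: exp_add)
  finally have "ln (exp 1 + r) \<le> ln (exp (1 + r))"
    using r by (subst ln_le_cancel_iff) (auto intro: add_pos_nonneg)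
  also have "\<dots> \<le> exp r" by simp
  finally have l: "ln (exp 1 + r) powr (3 / 2) \<le> exp r powr (3 / 2)"
    using l1 by (intro powr_mono2) auto
  have "(1 + r) powr (real DIM('a) / 2) \<le> exp r powr (real DIM('a) / 2)"
    using r by (intro powr_mono2) auto
  with l have "(1 + r) powr (real DIM('a) / 2) * ln (exp 1 + r) powr (3 / 2)
      \<le> exp r powr (real DIM('a) / 2) * exp r powr (3 / 2)"
    by (intro mult_mono) auto
  also have "\<dots> = exp (r * e)"
    by (simp add: exp_powr_real e_def exp_add[symmetric] add_divide_distrib distrib_left)
  also have "\<dots> \<le> exp (r\<^sup>2 / 8 + 2 * e\<^sup>2)"
    using zero_le_power2[of "r / 2 - 2 * e"] by (simp add: power2_eq_square algebra_simps)
  finally have D: "(1 + r) powr (real DIM('a) / 2) * ln (exp 1 + r) powr (3 / 2) \<le> exp (r\<^sup>2 / 8 + 2 * e\<^sup>2)"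
    (is "?D \<le> _") .
  have D0: "0 < ?D" using Phi_denominator_ge_1[of y] by (simp add: r_def)
  have "exp (- (5 / 8) * r\<^sup>2) * ?D \<le> exp (- (5 / 8) * r\<^sup>2) * exp (r\<^sup>2 / 8 + 2 * e\<^sup>2)"
    by (intro mult_left_mono D) auto
  also have "\<dots> = exp (2 * e\<^sup>2) * exp (- r\<^sup>2 / 2)" by (simp add: exp_add[symmetric])
  finally show ?thesis
    using D0 unfolding Phi_def r_def[symmetric] e_def[symmetric] times_divide_eq_right
    by (simp add: pos_le_divide_eq)
qed

lemma borel_measurable_kappa [measurable]: "kappa \<in> borel_measurable borel"
  unfolding kappa_def[abs_def] by measurable

lemma borel_measurable_hermite_integrand [measurable]:
  assumes [measurable]: "f \<in> borel_measurable M" "g \<in> borel_measurable M"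
  shows "(\<lambda>p. hermite_integrand t x (f p) (g p)) \<in> borel_measurable M"
  unfolding hermite_integrand_def by measurable

text \<open>
  The part \<open>s \<le> 1/4\<close> contributes the power of \<open>t\<^sup>2 + |x - y|\<^sup>2\<close>, as for the Poisson kernel of \<open>- \<Delta>\<close>; the part
  \<open>s \<ge> 1/4\<close> contributes the constant 1. Both carry the weight \<open>Phi y\<close>.
\<close>

lemma nn_integral_hermite_integrand_le:
  fixes R :: real
  obtains C where "0 < C" and "\<And>t (x::'a::euclidean_space) y. 0 < t \<Longrightarrow> norm x \<le> R \<Longrightarrow>
    (\<integral>\<^sup>+s\<in>{0<..<1}. ennreal (hermite_integrand t x y s) \<partial>lborel)
      \<le> ennreal (C * (Phi y * (1 + (t\<^sup>2 + (norm (x - y))\<^sup>2) powr (- (real DIM('a) + 1) / 2))))"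
proof -
  define d p m where "d = real DIM('a)" and "p = (d + 1) / 2" and "m = (d + 3) / 2"
  have d: "0 < d" "0 < p" "m = p + 1" by (auto simp: d_def p_def m_def field_simps)
  define K1 where "K1 = 2 * exp (15 / 4 * R\<^sup>2) * (16 * m) powr m"
  define K2 where "K2 = 2 powr (d / 2) * 4 powr (d / 2) * 3 powr (3 / 2) * exp ((4 * R + 3)\<^sup>2 + 3)"
  define K3 where "K3 = exp (2 * m\<^sup>2)"
  define C where "C = K1 * K3 / p + K2 * Gamma (d / 2)"
  have K: "0 < K1" "0 < K2" "0 < K3" using d by (auto simp: K1_def K2_def K3_def)
  have C: "0 < C" using K d by (auto simp: C_def intro!: add_pos_pos)
  have "(\<integral>\<^sup>+s\<in>{0<..<1}. ennreal (hermite_integrand t x y s) \<partial>lborel)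
      \<le> ennreal (C * (Phi y * (1 + (t\<^sup>2 + (norm (x - y))\<^sup>2) powr (- p))))"
    if t: "0 < t" and x: "norm x \<le> R" for t and x y :: 'a
  proof -
    define Q where "Q = t\<^sup>2 + (norm (x - y))\<^sup>2"
    have Q: "0 < Q" using t by (auto simp: Q_def intro: add_pos_nonneg)
    define a b where "a = K1 * exp (- (5 / 8) * (norm y)\<^sup>2)"
      and "b = K2 * (exp (- (norm y)\<^sup>2 / 2) / ln (exp 1 + norm y) powr (3 / 2))"
    have ab: "0 \<le> a" "0 \<le> b" using K by (auto simp: a_def b_def)
    let ?f = "\<lambda>s. (s + Q) powr (- p - 1)"
    let ?g = "\<lambda>s. (1 - s) powr (d / 2 - 1) * exp (- ((1 - s) * (1 + norm y)))"
    have "(\<integral>\<^sup>+s\<in>{0<..<1}. ennreal (hermite_integrand t x y s) \<partial>lborel)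
      \<le> (\<integral>\<^sup>+s. ennreal a * (ennreal (?f s) * indicator {0..} s) +
              ennreal b * (ennreal (?g s) * indicator {..1} s) \<partial>lborel)"
    proof (intro nn_integral_mono)
      fix s :: real
      show "ennreal (hermite_integrand t x y s) * indicator {0<..<1} s
        \<le> ennreal a * (ennreal (?f s) * indicator {0..} s) + ennreal b * (ennreal (?g s) * indicator {..1} s)"
      proof (cases "s \<in> {0<..<1}")
        case True
        have "hermite_integrand t x y s \<le> a * ?f s + b * ?g s"
        proof (cases "s \<le> 1 / 4")
          case s: True
          have "hermite_integrand t x y s \<le> 2 * exp (15 / 4 * R\<^sup>2) * (16 * m) powr m *
              exp (- (5 / 8) * (norm y)\<^sup>2) * (s + Q) powr (- m)"
            unfolding m_def d_def Q_def
            by (rule hermite_integrand_le_near_zero) (use s True x in auto)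
          also have "- m = - p - 1" using d by simp
          finally have "hermite_integrand t x y s \<le> a * ?f s"
            by (simp only: a_def K1_def mult_ac)
          moreover have "0 \<le> b * ?g s" using ab by simp
          ultimately show ?thesis by simp
        next
          case s: False
          have "hermite_integrand t x y s \<le> b * ?g s"
            unfolding b_def K2_def d_def
            by (rule hermite_integrand_le_near_one) (use s True x in auto)
          moreover have "0 \<le> a * ?f s" using ab by simp
          ultimately show ?thesis by simp
        qed
        then have "ennreal (hermite_integrand t x y s) \<le> ennreal (a * ?f s + b * ?g s)"
          by (rule ennreal_leI)
        then show ?thesis using True ab by (simp add: ennreal_mult)
      qed simp
    qed
    also have "\<dots> = ennreal a * (\<integral>\<^sup>+s\<in>{0..}. ennreal (?f s) \<partial>lborel) +
        ennreal b * (\<integral>\<^sup>+s\<in>{..1}. ennreal (?g s) \<partial>lborel)"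
      by (subst nn_integral_add) (auto simp: nn_integral_cmult)
    also have "\<dots> = ennreal a * ennreal (Q powr (- p) / p) +
        ennreal b * ennreal (Gamma (d / 2) * (1 + norm y) powr (- (d / 2)))"
    proof -
      have "(\<integral>\<^sup>+s\<in>{0..}. ennreal (?f s) \<partial>lborel) = ennreal (Q powr (- p) / p)"
        by (rule nn_integral_add_powr) (use Q d in auto)
      moreover have "(\<integral>\<^sup>+s\<in>{..1}. ennreal (?g s) \<partial>lborel) = ennreal (Gamma (d / 2) * (1 + norm y) powr (- (d / 2)))"
        by (rule nn_integral_powr_mult_exp) (use d in \<open>auto intro: add_pos_nonneg\<close>)
      ultimately show ?thesis by simp
    qed
    also have "\<dots> = ennreal (a * Q powr (- p) / p + b * (Gamma (d / 2) * (1 + norm y) powr (- (d / 2))))"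
    proof -
      have "0 \<le> Gamma (d / 2)" using d by (intro Gamma_real_nonneg) auto
      then show ?thesis using ab d by (simp add: ennreal_mult[symmetric])
    qed
    also have "\<dots> \<le> ennreal (C * (Phi y * (1 + Q powr (- p))))"
    proof (rule ennreal_leI)
      have "a \<le> K1 * K3 * Phi y"
        using exp_le_Phi[of y] K by (simp add: a_def K3_def m_def d_def)
      then have "a * (Q powr (- p) / p) \<le> K1 * K3 * Phi y * (Q powr (- p) / p)"
        using d by (intro mult_right_mono) auto
      moreover have "b * (Gamma (d / 2) * (1 + norm y) powr (- (d / 2))) = K2 * Gamma (d / 2) * Phi y"
        unfolding b_def Phi_def d_def powr_minus divide_inverse inverse_mult_distrib
        by (simp only: mult_ac)
      moreover have "0 \<le> K2 * Gamma (d / 2) * Phi y * Q powr (- p)" "0 \<le> K1 * K3 / p * Phi y"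
        using K d Phi_pos[of y] by auto
      moreover have "C * (Phi y * (1 + Q powr (- p))) = K1 * K3 * Phi y * (Q powr (- p) / p) +
          K2 * Gamma (d / 2) * Phi y + (K2 * Gamma (d / 2) * Phi y * Q powr (- p) + K1 * K3 / p * Phi y)"
        by (simp add: C_def distrib_left distrib_right)
      ultimately show "a * Q powr (- p) / p + b * (Gamma (d / 2) * (1 + norm y) powr (- (d / 2)))
        \<le> C * (Phi y * (1 + Q powr (- p)))"
        by (simp only: times_divide_eq_right[symmetric])
    qed
    finally show ?thesis by (simp add: Q_def)
  qed
  moreover have "- p = - (real DIM('a) + 1) / 2" by (simp add: p_def d_def field_simps)
  ultimately show thesis using that[OF C] by (simp only:)
qed

definition hermite_const :: "'a::euclidean_space itself \<Rightarrow> real" where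
  "hermite_const _ = 8 * (4 * pi) powr (- (real DIM('a) + 1) / 2)"

lemma hermite_const_pos: "0 < hermite_const TYPE('a::euclidean_space)"
  by (simp add: hermite_const_def)

text \<open>
  The integral defining the kernel converges, so it can be treated in \<open>[0, \<infinity>]\<close>, where lower bounds and
  Tonelli's theorem apply directly.
\<close>

lemma ennreal_poisson_hermite_kernel:
  fixes x y :: "'a::euclidean_space"
  assumes "0 < t"
  shows "ennreal (poisson_hermite_kernel t x y) = ennreal (hermite_const TYPE('a) * t) *
    (\<integral>\<^sup>+s\<in>{0<..<1}. ennreal (hermite_integrand t x y s) \<partial>lborel)"
proof -
  let ?h = "\<lambda>s. indicator {0<..<1} s *\<^sub>R hermite_integrand t x y s"
  have eq: "(\<integral>\<^sup>+s\<in>{0<..<1}. ennreal (hermite_integrand t x y s) \<partial>lborel) = (\<integral>\<^sup>+s. ennreal (?h s) \<partial>lborel)"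
    by (intro nn_integral_cong) (auto simp: indicator_def)
  have nn: "0 \<le> ?h s" for s by (simp add: hermite_integrand_nonneg)
  obtain C where "0 < C" and le: "\<And>t (x'::'a) y. 0 < t \<Longrightarrow> norm x' \<le> norm x \<Longrightarrow>
    (\<integral>\<^sup>+s\<in>{0<..<1}. ennreal (hermite_integrand t x' y s) \<partial>lborel)
      \<le> ennreal (C * (Phi y * (1 + (t\<^sup>2 + (norm (x' - y))\<^sup>2) powr (- (real DIM('a) + 1) / 2))))"
    by (rule nn_integral_hermite_integrand_le[where 'a='a, of "norm x"]) (rule that)
  from le[OF assms order_refl, of y] have "(\<integral>\<^sup>+s. ennreal (?h s) \<partial>lborel) < \<infinity>"
    unfolding eq by (rule le_less_trans) simp
  then have "integrable lborel ?h"
    using nn by (intro integrableI_nonneg) auto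
  then have "(\<integral>\<^sup>+s. ennreal (?h s) \<partial>lborel) = ennreal (\<integral>s. ?h s \<partial>lborel)"
    using nn by (intro nn_integral_eq_integral) auto
  moreover have "poisson_hermite_kernel t x y = hermite_const TYPE('a) * t * (\<integral>s. ?h s \<partial>lborel)"
    unfolding poisson_hermite_kernel_def hermite_const_def set_lebesgue_integral_def
    by (simp only: hermite_integrand_def)
  moreover have "0 \<le> (\<integral>s. ?h s \<partial>lborel)" using nn by (intro integral_nonneg_AE) auto
  ultimately show ?thesis
    using assms hermite_const_pos[where 'a='a] by (simp add: eq ennreal_mult)
qed

lemma poisson_hermite_kernel_nonneg:
  "0 \<le> t \<Longrightarrow> 0 \<le> poisson_hermite_kernel t x y"
  unfolding poisson_hermite_kernel_def set_lebesgue_integral_def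
  by (intro mult_nonneg_nonneg integral_nonneg_AE) auto

lemma borel_measurable_poisson_hermite_kernel [measurable]:
  "poisson_hermite_kernel t x \<in> borel_measurable borel"
proof -
  have "(\<lambda>y. \<integral>s. indicator {0<..<1} s *\<^sub>R hermite_integrand t x y s \<partial>lborel) \<in> borel_measurable borel"
    by measurable
  then show ?thesis
    unfolding poisson_hermite_kernel_def[abs_def] set_lebesgue_integral_def hermite_integrand_def
    by measurable
qed

lemma poisson_hermite_kernel_le:
  fixes R :: real
  obtains C where "0 < C" and "\<And>t (x::'a::euclidean_space) y. 0 < t \<Longrightarrow> norm x \<le> R \<Longrightarrow>
    poisson_hermite_kernel t x y
      \<le> C * (t * Phi y * (1 + (t\<^sup>2 + (norm (x - y))\<^sup>2) powr (- (real DIM('a) + 1) / 2)))"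
proof -
  obtain C where C: "0 < C" and le: "\<And>t (x::'a) y. 0 < t \<Longrightarrow> norm x \<le> R \<Longrightarrow>
    (\<integral>\<^sup>+s\<in>{0<..<1}. ennreal (hermite_integrand t x y s) \<partial>lborel)
      \<le> ennreal (C * (Phi y * (1 + (t\<^sup>2 + (norm (x - y))\<^sup>2) powr (- (real DIM('a) + 1) / 2))))"
    by (rule nn_integral_hermite_integrand_le[where 'a='a, of R]) (rule that)
  let ?c = "hermite_const TYPE('a)"
  have "poisson_hermite_kernel t x y
      \<le> (?c * C) * (t * Phi y * (1 + (t\<^sup>2 + (norm (x - y))\<^sup>2) powr (- (real DIM('a) + 1) / 2)))"
    if t: "0 < t" and x: "norm x \<le> R" for t and x y :: 'a
  proof -
    let ?B = "C * (Phi y * (1 + (t\<^sup>2 + (norm (x - y))\<^sup>2) powr (- (real DIM('a) + 1) / 2)))"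
    have B: "0 \<le> ?B" using C Phi_pos[of y] by (intro mult_nonneg_nonneg) auto
    have "ennreal (poisson_hermite_kernel t x y) \<le> ennreal (?c * t) * ennreal ?B"
      unfolding ennreal_poisson_hermite_kernel[OF t] by (intro mult_left_mono le t x) auto
    also have "\<dots> = ennreal (?c * t * ?B)"
      using t hermite_const_pos[where 'a='a] by (intro ennreal_mult[symmetric] B) auto
    finally have "poisson_hermite_kernel t x y \<le> ?c * t * ?B"
      using t B hermite_const_pos[where 'a='a] by (subst (asm) ennreal_le_iff) auto
    then show ?thesis by (simp add: mult_ac)
  qed
  moreover have "0 < ?c * C" using C hermite_const_pos[where 'a='a] by simp
  ultimately show thesis using that by blast
qed

text \<open>
  For \<open>|x - y| < t\<close> the times \<open>s\<close> comparable with \<open>t\<^sup>2\<close> alone contribute a multiple of \<open>t ^ (- d)\<close>.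
\<close>

lemma poisson_hermite_kernel_ge:
  fixes x :: "'a::euclidean_space"
  obtains c where "0 < c" and "\<And>t y. 0 < t \<Longrightarrow> t \<le> 1 / 2 \<Longrightarrow> y \<in> ball x t \<Longrightarrow>
    c / t ^ DIM('a) \<le> poisson_hermite_kernel t x y"
proof -
  define d where "d = real DIM('a)"
  define M where "M = (2 * norm x + 1)\<^sup>2"
  define c0 where "c0 = exp (- 4) * (1 / 2) powr (d / 2) * exp (- (2 + M)) / 8"
  have c0: "0 < c0" by (simp add: c0_def)
  let ?c = "hermite_const TYPE('a) * c0 / 8"
  have "?c / t ^ DIM('a) \<le> poisson_hermite_kernel t x y"
    if t: "0 < t" "t \<le> 1 / 2" and y: "y \<in> ball x t" for t y
  proof -
    have t2: "0 < t\<^sup>2" "t\<^sup>2 \<le> 1 / 4" using t power_mono[of t "1/2" 2] by (auto simp: power2_eq_square)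
    have pt: "c0 / t powr (d + 3) \<le> hermite_integrand t x y s" if s: "t\<^sup>2 / 8 \<le> s" "s \<le> t\<^sup>2 / 4" for s
    proof -
      have s01: "0 < s" "s \<le> 1 / 16" using s t2 by linarith+
      have k: "t\<^sup>2 / 4 \<le> kappa s" "kappa s \<le> 4 * t\<^sup>2" "0 < kappa s"
      proof -
        show "t\<^sup>2 / 4 \<le> kappa s" "0 < kappa s" using kappa_ge[of s] s s01 by linarith+
        have "4 * s / (1 - s) \<le> 16 * s" using s01 by (simp add: field_simps)
        then show "kappa s \<le> 4 * t\<^sup>2" using kappa_le[of s] s s01 by linarith
      qed
      have 1: "exp (- 4) \<le> exp (- t\<^sup>2 / kappa s)"
        using k by (simp add: divide_le_eq)
      have 2: "(1 / 2) powr (d / 2) \<le> (1 - s\<^sup>2) powr (d / 2 - 1)"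
      proof -
        have s2: "1 / 2 \<le> 1 - s\<^sup>2"
          using s01 power_mono[of s "1/16" 2] by (simp add: power2_eq_square)
        have "(1 / 2) powr (d / 2) \<le> (1 - s\<^sup>2) powr (d / 2)"
          using s2 by (intro powr_mono2) (auto simp: d_def)
        also have "\<dots> \<le> (1 - s\<^sup>2) powr (d / 2 - 1)"
          using s2 by (intro powr_mono') auto
        finally show ?thesis .
      qed
      have 3: "exp (- (2 + M)) \<le> exp (- (1 / 4) * ((norm (x - y))\<^sup>2 / s + s * (norm (x + y))\<^sup>2))"
      proof -
        have n: "norm (x - y) \<le> t" using y by (simp add: dist_norm)
        have "(norm (x - y))\<^sup>2 \<le> t\<^sup>2" using n by (intro power_mono) auto
        also have "\<dots> \<le> 8 * s" using s by simp
        finally have "(norm (x - y))\<^sup>2 / s \<le> 8" using s01 by (simp add: divide_le_eq)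
        moreover have "s * (norm (x + y))\<^sup>2 \<le> 1 * M"
        proof (intro mult_mono)
          have "norm y \<le> norm x + norm (x - y)"
            using norm_triangle_sub[of y x] by (simp add: norm_minus_commute)
          then have "norm (x + y) \<le> 2 * norm x + 1"
            using norm_triangle_ineq[of x y] n t by linarith
          then show "(norm (x + y))\<^sup>2 \<le> M" unfolding M_def by (intro power_mono) auto
        qed (use s01 in auto)
        moreover have "0 \<le> M" by (simp add: M_def)
        ultimately have "- (2 + M) \<le> - (1 / 4) * ((norm (x - y))\<^sup>2 / s + s * (norm (x + y))\<^sup>2)"
          by argo
        then show ?thesis by (simp only: exp_le_cancel_iff)
      qed
      have 4: "1 / (8 * t powr (d + 3)) \<le> 1 / (s powr (d / 2) * kappa s powr (3 / 2))"
      proof -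
        have "s powr (d / 2) * kappa s powr (3 / 2) \<le> (t\<^sup>2) powr (d / 2) * (4 * t\<^sup>2) powr (3 / 2)"
          using s s01 k t2 by (intro mult_mono powr_mono2) (auto simp: d_def)
        also have "\<dots> = 8 * t powr (d + 3)"
        proof -
          have "t\<^sup>2 = t powr 2" using t by (simp add: powr_numeral)
          moreover have "(4::real) powr (3 / 2) = 8"
          proof -
            have "(4::real) = 2 powr 2" by simp
            then show ?thesis by (simp only: powr_powr) simp
          qed
          ultimately show ?thesis
            by (simp add: powr_mult powr_powr powr_add mult_ac)
        qed
        finally show ?thesis using s01 k by (intro frac_le) auto
      qed
      have "c0 / t powr (d + 3) = exp (- 4) * (1 / 2) powr (d / 2) * exp (- (2 + M)) * (1 / (8 * t powr (d + 3)))"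
        by (simp add: c0_def)
      also have "\<dots> \<le> hermite_integrand t x y s"
        unfolding hermite_integrand_eq d_def[symmetric]
        by (rule mult_mono[OF mult_mono[OF mult_mono[OF 1 2] 3] 4]) auto
      finally show ?thesis .
    qed
    have "ennreal (c0 / t powr (d + 3) * (t\<^sup>2 / 8)) = (\<integral>\<^sup>+s\<in>{t\<^sup>2 / 8..t\<^sup>2 / 4}. ennreal (c0 / t powr (d + 3)) \<partial>lborel)"
      using c0 by (simp add: nn_integral_cmult_indicator ennreal_mult[symmetric])
    also have "\<dots> \<le> (\<integral>\<^sup>+s\<in>{0<..<1}. ennreal (hermite_integrand t x y s) \<partial>lborel)"
    proof (intro nn_integral_mono)
      fix s :: real
      have "s \<in> {0<..<1}" if "s \<in> {t\<^sup>2 / 8..t\<^sup>2 / 4}"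
        using that t2 unfolding atLeastAtMost_iff greaterThanLessThan_iff by linarith
      then show "ennreal (c0 / t powr (d + 3)) * indicator {t\<^sup>2 / 8..t\<^sup>2 / 4} s
          \<le> ennreal (hermite_integrand t x y s) * indicator {0<..<1} s"
        using pt[of s] by (auto simp: indicator_def ennreal_leI)
    qed
    finally have "ennreal (hermite_const TYPE('a) * t) * ennreal (c0 / t powr (d + 3) * (t\<^sup>2 / 8))
        \<le> ennreal (poisson_hermite_kernel t x y)"
      unfolding ennreal_poisson_hermite_kernel[OF t(1)] by (rule mult_left_mono) simp
    moreover have "(hermite_const TYPE('a) * t) * (c0 / t powr (d + 3) * (t\<^sup>2 / 8)) = ?c / t ^ DIM('a)"
    proof -
      have "t powr (d + 3) = t ^ DIM('a) * t ^ 3"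
        using t by (simp add: powr_add powr_realpow d_def powr_numeral)
      then show ?thesis using t by (simp add: field_simps power2_eq_square power3_eq_cube)
    qed
    ultimately show ?thesis
      using hermite_const_pos[where 'a='a] t c0 poisson_hermite_kernel_nonneg[of t x y]
      by (simp add: ennreal_mult[symmetric] ennreal_le_iff)
  qed
  moreover have "0 < ?c" using c0 hermite_const_pos[where 'a='a] by simp
  ultimately show thesis using that by blast
qed

section \<open>The total mass of the kernel\<close>

lemma nn_integral_gaussian_real:
  fixes a z :: real
  assumes "0 < a"
  shows "(\<integral>\<^sup>+u. ennreal (exp (- a * (u - z)\<^sup>2)) \<partial>lborel) = ennreal (sqrt (pi / a))"
proof -
  define \<sigma> where "\<sigma> = sqrt (1 / (2 * a))"
  have \<sigma>: "0 < \<sigma>" "\<sigma>\<^sup>2 = 1 / (2 * a)" using assms by (auto simp: \<sigma>_def)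
  have "exp (- a * (u - z)\<^sup>2) = sqrt (pi / a) * normal_density z \<sigma> u" for u
    using assms by (simp add: normal_density_def \<sigma>(2) real_sqrt_divide)
  then have "(\<integral>\<^sup>+u. ennreal (exp (- a * (u - z)\<^sup>2)) \<partial>lborel)
      = (\<integral>\<^sup>+u. ennreal (sqrt (pi / a)) * ennreal (normal_density z \<sigma> u) \<partial>lborel)"
    using assms by (simp add: ennreal_mult)
  also have "\<dots> = ennreal (sqrt (pi / a)) * (\<integral>\<^sup>+u. ennreal (normal_density z \<sigma> u) \<partial>lborel)"
    by (rule nn_integral_cmult) auto
  also have "(\<integral>\<^sup>+u. ennreal (normal_density z \<sigma> u) \<partial>lborel) = 1"
    using \<sigma> by (subst nn_integral_eq_integral) auto
  finally show ?thesis by simp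
qed

lemma nn_integral_gaussian:
  fixes z :: "'a::euclidean_space"
  assumes "0 < a"
  shows "(\<integral>\<^sup>+y. ennreal (exp (- a * (norm (y - z))\<^sup>2)) \<partial>lborel) = ennreal ((pi / a) powr (real DIM('a) / 2))"
proof -
  have "ennreal (exp (- a * (norm (y - z))\<^sup>2)) = (\<Prod>b\<in>Basis. ennreal (exp (- a * (y \<bullet> b - z \<bullet> b)\<^sup>2)))"
    for y :: 'a
  proof -
    have "(norm (y - z))\<^sup>2 = (\<Sum>b\<in>Basis. (y \<bullet> b - z \<bullet> b)\<^sup>2)"
      unfolding power2_norm_eq_inner by (subst euclidean_inner) (simp add: inner_diff_left power2_eq_square)
    then show ?thesis by (simp add: prod_ennreal sum_distrib_left exp_sum sum_negf[symmetric])
  qed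
  then have "(\<integral>\<^sup>+y. ennreal (exp (- a * (norm (y - z))\<^sup>2)) \<partial>lborel)
      = (\<integral>\<^sup>+y. (\<Prod>b\<in>Basis. ennreal (exp (- a * (y \<bullet> b - z \<bullet> b)\<^sup>2))) \<partial>lborel)" by simp
  also have "\<dots> = (\<Prod>b\<in>(Basis::'a set). \<integral>\<^sup>+u. ennreal (exp (- a * (u - z \<bullet> b)\<^sup>2)) \<partial>lborel)"
    by (rule nn_integral_lborel_prod) auto
  also have "\<dots> = ennreal (sqrt (pi / a) ^ DIM('a))"
    using assms by (simp only: nn_integral_gaussian_real[OF assms]) (simp add: ennreal_power)
  also have "sqrt (pi / a) ^ DIM('a) = (pi / a) powr (real DIM('a) / 2)"
    using assms by (simp add: powr_half_sqrt[symmetric] powr_realpow[symmetric] powr_powr)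
  finally show ?thesis .
qed

text \<open>
  The total mass of Mehler's kernel, that is the value at \<open>x\<close> of \<open>exp (- \<tau> * L)\<close> applied to the constant 1,
  in the variable \<open>s = tanh \<tau>\<close>.
\<close>

definition mehler_mass :: "'a::euclidean_space \<Rightarrow> real \<Rightarrow> real" where
  "mehler_mass x s =
     ((1 - s\<^sup>2) / (1 + s\<^sup>2)) powr (real DIM('a) / 2) * exp (- (s / (1 + s\<^sup>2)) * (norm x)\<^sup>2)"

lemma mehler_mass_bounds:
  assumes "0 < s" "s < 1"
  shows "0 \<le> mehler_mass x s" "mehler_mass x s \<le> 1"
proof -
  have "s\<^sup>2 < 1" using assms by (simp add: power_less_one_iff)
  then have "((1 - s\<^sup>2) / (1 + s\<^sup>2)) powr (real DIM('a) / 2) \<le> 1"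
    by (intro powr_le1) (auto simp: divide_le_eq add_pos_nonneg)
  moreover have "exp (- (s / (1 + s\<^sup>2)) * (norm x)\<^sup>2) \<le> 1"
    using assms by (simp add: add_nonneg_nonneg)
  ultimately show "mehler_mass x s \<le> 1" unfolding mehler_mass_def by (intro mult_le_one) auto
qed (simp add: mehler_mass_def)

lemma borel_measurable_mehler_mass [measurable]: "mehler_mass x \<in> borel_measurable borel"
  unfolding mehler_mass_def[abs_def] by measurable

text \<open>
  As a function of \<open>y\<close> the integrand is a Gaussian centred at \<open>m *\<^sub>R x\<close> with \<open>m = (1 - s\<^sup>2) / (1 + s\<^sup>2)\<close>.
\<close>

lemma nn_integral_hermite_integrand:
  fixes x :: "'a::euclidean_space"
  assumes s: "0 < s" "s < 1"
  shows "(\<integral>\<^sup>+y. ennreal (hermite_integrand t x y s) \<partial>lborel) =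
    ennreal ((4 * pi) powr (real DIM('a) / 2) *
      (exp (- t\<^sup>2 / kappa s) * kappa s powr (- 3 / 2) / (1 - s\<^sup>2) * mehler_mass x s))"
proof -
  let ?d = "real DIM('a)"
  define a where "a = (1 + s\<^sup>2) / (4 * s)"
  define m where "m = (1 - s\<^sup>2) / (1 + s\<^sup>2)"
  have s1: "0 < 1 - s\<^sup>2" "0 < 1 + s\<^sup>2" using s by (auto simp: power_less_one_iff add_pos_nonneg)
  have a: "0 < a" using s s1 by (simp add: a_def)
  define E where "E = exp (- t\<^sup>2 / kappa s) * (1 - s\<^sup>2) powr (?d / 2 - 1) *
    exp (- (s / (1 + s\<^sup>2)) * (norm x)\<^sup>2) / (s powr (?d / 2) * kappa s powr (3 / 2))"
  have E: "0 \<le> E" by (simp add: E_def)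
  have "hermite_integrand t x y s = E * exp (- a * (norm (y - m *\<^sub>R x))\<^sup>2)" for y
  proof -
    have n: "(norm (x - y))\<^sup>2 = (norm x)\<^sup>2 + (norm y)\<^sup>2 - 2 * (x \<bullet> y)"
      "(norm (x + y))\<^sup>2 = (norm x)\<^sup>2 + (norm y)\<^sup>2 + 2 * (x \<bullet> y)"
      "(norm (y - m *\<^sub>R x))\<^sup>2 = (norm y)\<^sup>2 + m\<^sup>2 * (norm x)\<^sup>2 - 2 * m * (x \<bullet> y)"
      by (simp_all add: power2_norm_eq_inner inner_diff inner_add inner_commute)
         (simp add: power2_eq_square algebra_simps)
    have c1: "a = (1 / s + s) / 4" using s by (simp add: a_def field_simps power2_eq_square)
    have c2: "a * m = (1 / s - s) / 4"
    proof -
      have "a * m = (1 - s\<^sup>2) / (4 * s)" using s1 unfolding a_def m_def by simp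
      then show ?thesis using s by (simp add: field_simps power2_eq_square)
    qed
    have c3: "s / (1 + s\<^sup>2) + a * m\<^sup>2 = a"
    proof -
      have "a * m\<^sup>2 = (1 - s\<^sup>2)\<^sup>2 / (4 * s * (1 + s\<^sup>2))"
        using s s1(2) by (simp add: a_def m_def power2_eq_square)
      moreover have "s / (1 + s\<^sup>2) = 4 * s\<^sup>2 / (4 * s * (1 + s\<^sup>2))"
        using s by (simp add: power2_eq_square)
      moreover have "a = (1 + s\<^sup>2)\<^sup>2 / (4 * s * (1 + s\<^sup>2))"
        using s1(2) by (simp add: a_def power2_eq_square)
      moreover have "4 * s\<^sup>2 + (1 - s\<^sup>2)\<^sup>2 = (1 + s\<^sup>2)\<^sup>2" by (simp add: power2_eq_square algebra_simps)
      ultimately show ?thesis by (metis add_divide_distrib)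
    qed
    have "- (1 / 4) * ((norm (x - y))\<^sup>2 / s + s * (norm (x + y))\<^sup>2)
        = - (a * ((norm x)\<^sup>2 + (norm y)\<^sup>2)) + 2 * (a * m) * (x \<bullet> y)"
      unfolding n c2 unfolding c1 by (simp add: algebra_simps add_divide_distrib diff_divide_distrib)
    also have "\<dots> = - (s / (1 + s\<^sup>2)) * (norm x)\<^sup>2 + - a * (norm (y - m *\<^sub>R x))\<^sup>2"
    proof -
      have "- q * X + - a * (Y + m\<^sup>2 * X - 2 * m * p) = - ((q + a * m\<^sup>2) * X + a * Y) + 2 * (a * m) * p"
        for q X Y p by (simp add: algebra_simps)
      then show ?thesis unfolding n by (simp only: c3 distrib_left)
    qed
    finally have e: "- (1 / 4) * ((norm (x - y))\<^sup>2 / s + s * (norm (x + y))\<^sup>2)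
        = - (s / (1 + s\<^sup>2)) * (norm x)\<^sup>2 + - a * (norm (y - m *\<^sub>R x))\<^sup>2" .
    have "p * q * (r * u) / v = (p * q * r / v) * u" for p q r u v :: real by simp
    then show ?thesis unfolding hermite_integrand_def E_def e exp_add .
  qed
  then have "(\<integral>\<^sup>+y. ennreal (hermite_integrand t x y s) \<partial>lborel)
      = (\<integral>\<^sup>+y. ennreal E * ennreal (exp (- a * (norm (y - m *\<^sub>R x))\<^sup>2)) \<partial>lborel)"
    using E by (simp add: ennreal_mult)
  also have "\<dots> = ennreal E * (\<integral>\<^sup>+y. ennreal (exp (- a * (norm (y - m *\<^sub>R x))\<^sup>2)) \<partial>lborel)"
    by (rule nn_integral_cmult) measurable
  also have "\<dots> = ennreal (E * (pi / a) powr (?d / 2))"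
    unfolding nn_integral_gaussian[OF a] using E by (simp add: ennreal_mult)
  also have "E * (pi / a) powr (?d / 2) = (4 * pi) powr (?d / 2) *
      (exp (- t\<^sup>2 / kappa s) * kappa s powr (- 3 / 2) / (1 - s\<^sup>2) * mehler_mass x s)"
  proof -
    have "pi / a = 4 * pi * s / (1 + s\<^sup>2)" using s by (simp add: a_def)
    then have "(pi / a) powr (?d / 2) = (4 * pi) powr (?d / 2) * s powr (?d / 2) / (1 + s\<^sup>2) powr (?d / 2)"
      using s s1 by (simp add: powr_divide powr_mult)
    moreover have "((1 - s\<^sup>2) / (1 + s\<^sup>2)) powr (?d / 2) = (1 - s\<^sup>2) powr (?d / 2) / (1 + s\<^sup>2) powr (?d / 2)"
      using s1 by (simp add: powr_divide)
    moreover have "(1 - s\<^sup>2) powr (?d / 2 - 1) = (1 - s\<^sup>2) powr (?d / 2) / (1 - s\<^sup>2)"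
      using s1 by (simp add: powr_diff)
    moreover have "kappa s powr (- 3 / 2) = 1 / kappa s powr (3 / 2)"
      by (simp add: powr_minus_divide[symmetric])
    ultimately show ?thesis
      using s by (simp add: E_def mehler_mass_def mult_ac)
  qed
  finally show ?thesis .
qed

text \<open>
  The substitution \<open>w = t\<^sup>2 / kappa s\<close> turns the subordination weight into the density of the
  Gamma distribution with parameter \<open>1/2\<close>. Its inverse is \<open>s = tanh (t\<^sup>2 / (4 * w))\<close>.
\<close>

lemma tanh_kappa:
  assumes "0 < s" "s < 1"
  shows "tanh (kappa s / 4) = s"
proof -
  define z where "z = (1 + s) / (1 - s)"
  have z: "0 < z" "z + 1 = 2 / (1 - s)" "z - 1 = 2 * s / (1 - s)" using assms by (auto simp: z_def field_simps)
  have "kappa s / 4 = ln (sqrt z)" using z by (simp add: kappa_def z_def[symmetric] ln_sqrt)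
  then have "tanh (kappa s / 4) = (z - 1) / (z + 1)" using z(1) by (simp add: tanh_ln_real)
  then show ?thesis using assms by (simp add: z)
qed

lemma kappa_tanh: "kappa (tanh u) = 4 * u"
  using artanh_tanh_real[of u] by (simp add: kappa_def artanh_def)

lemma nn_integral_subordination:
  fixes H :: "real \<Rightarrow> real"
  assumes t: "0 < t" and H[measurable]: "H \<in> borel_measurable borel"
    and H01: "\<And>s. 0 < s \<Longrightarrow> s < 1 \<Longrightarrow> 0 \<le> H s \<and> H s \<le> 1"
  shows "(\<integral>\<^sup>+s\<in>{0<..<1}. ennreal (t * exp (- t\<^sup>2 / kappa s) * kappa s powr (- 3 / 2) * (4 / (1 - s\<^sup>2)) * H s) \<partial>lborel)
    = (\<integral>\<^sup>+w\<in>{0<..}. ennreal (w powr (- 1 / 2) / exp w * H (tanh (t\<^sup>2 / (4 * w)))) \<partial>lborel)"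
proof -
  define f where "f w = w powr (- 1 / 2) / exp w * H (tanh (t\<^sup>2 / (4 * w)))" for w
  define g where "g s = t\<^sup>2 / kappa s" for s
  define g' where "g' s = - (t\<^sup>2 * (4 / (1 - s\<^sup>2)) / (kappa s)\<^sup>2)" for s
  let ?S = "{0<..<1::real}"
  have tanh_m[measurable]: "(tanh :: real \<Rightarrow> real) \<in> borel_measurable borel"
    by (intro borel_measurable_continuous_onI continuous_intros) auto
  have f_m[measurable]: "f \<in> borel_measurable borel" unfolding f_def by measurable
  have tanh01: "0 < tanh (t\<^sup>2 / (4 * w)) \<and> tanh (t\<^sup>2 / (4 * w)) < 1" if "0 < w" for w
    using that t by (simp add: tanh_real_lt_1)
  have f01: "0 \<le> f w" "f w \<le> w powr (- 1 / 2) / exp w" if "0 < w" for w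
  proof -
    have h: "0 \<le> H (tanh (t\<^sup>2 / (4 * w)))" "H (tanh (t\<^sup>2 / (4 * w))) \<le> 1"
      using H01[of "tanh (t\<^sup>2 / (4 * w))"] tanh01[OF that] by auto
    show "0 \<le> f w" unfolding f_def by (intro mult_nonneg_nonneg h) auto
    show "f w \<le> w powr (- 1 / 2) / exp w" unfolding f_def by (intro mult_left_le h) auto
  qed
  have "set_integrable lborel {0<..} f"
    unfolding set_integrable_def
  proof (rule integrableI_bounded)
    have "(\<integral>\<^sup>+w. ennreal (norm (indicator {0<..} w *\<^sub>R f w)) \<partial>lborel)
        \<le> (\<integral>\<^sup>+w. ennreal (indicator {0..} w * w powr (1 / 2 - 1) / exp w) \<partial>lborel)"
      using f01 by (intro nn_integral_mono) (auto simp: indicator_def intro!: ennreal_leI)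
    also have "\<dots> = ennreal (Gamma (1 / 2))" by (rule Gamma_conv_nn_integral_real[symmetric]) simp
    also have "\<dots> < \<infinity>" by simp
    finally show "(\<integral>\<^sup>+w. ennreal (norm (indicator {0<..} w *\<^sub>R f w)) \<partial>lborel) < \<infinity>" .
  qed measurable
  then have fint: "f absolutely_integrable_on {0<..}"
    unfolding set_integrable_def by (subst integrable_completion) auto
  have img: "g ` ?S = {0<..}"
  proof (intro equalityI subsetI)
    fix w assume "w \<in> g ` ?S"
    then show "w \<in> {0<..}" using t kappa_pos by (auto simp: g_def)
  next
    fix w :: real assume "w \<in> {0<..}"
    then have "w = g (tanh (t\<^sup>2 / (4 * w)))" "tanh (t\<^sup>2 / (4 * w)) \<in> ?S"
      using t tanh01[of w] by (auto simp: g_def kappa_tanh)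
    then show "w \<in> g ` ?S" by blast
  qed
  have inj: "inj_on g ?S"
  proof (rule inj_onI)
    fix r s assume rs: "r \<in> ?S" "s \<in> ?S" "g r = g s"
    then have k: "kappa r = kappa s" using t kappa_pos[of r] kappa_pos[of s] by (simp add: g_def field_simps)
    have "r = tanh (kappa r / 4)" by (rule tanh_kappa[symmetric]) (use rs in auto)
    also have "\<dots> = s" unfolding k by (rule tanh_kappa) (use rs in auto)
    finally show "r = s" .
  qed
  have der: "(g has_field_derivative g' s) (at s within ?S)" if "s \<in> ?S" for s
  proof -
    have s: "0 < s" "s < 1" and k: "kappa s \<noteq> 0" using that kappa_pos[of s] by auto
    have "kappa = (\<lambda>s. 4 * artanh s)" by (simp add: kappa_def artanh_def fun_eq_iff)
    moreover have "((\<lambda>s. 4 * artanh s) has_field_derivative 4 * (1 / (1 - s\<^sup>2))) (at s)"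
      using s by (intro DERIV_cmult artanh_real_has_field_derivative) auto
    ultimately have "(kappa has_field_derivative 4 / (1 - s\<^sup>2)) (at s)" by simp
    then have "(g has_field_derivative g' s) (at s)"
      unfolding g_def[abs_def] g'_def using k
      by (auto intro!: derivative_eq_intros simp: power2_eq_square)
    then show ?thesis by (rule has_field_derivative_at_within)
  qed
  have "(\<lambda>s. \<bar>g' s\<bar> * f (g s)) absolutely_integrable_on ?S \<and>
      integral ?S (\<lambda>s. \<bar>g' s\<bar> * f (g s)) = integral {0<..} f"
    using has_absolute_integral_change_of_variables_1'[OF _ der inj, of f "integral {0<..} f"] fint
    by (simp add: img)
  then have "((\<lambda>s. \<bar>g' s\<bar> * f (g s)) has_integral integral {0<..} f) ?S"
    by (metis set_lebesgue_integral_eq_integral(1) integrable_integral)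
  then have 1: "(\<integral>\<^sup>+s. ennreal (indicator ?S s * (\<bar>g' s\<bar> * f (g s))) \<partial>lborel) = ennreal (integral {0<..} f)"
  proof (rule nn_integral_has_integral_lebesgue[rotated])
    fix s assume "s \<in> ?S"
    then have "0 < g s" using t kappa_pos[of s] by (simp add: g_def)
    then show "0 \<le> \<bar>g' s\<bar> * f (g s)" using f01 by simp
  qed
  have "(f has_integral integral {0<..} f) {0<..}"
    using fint by (metis set_lebesgue_integral_eq_integral(1) integrable_integral)
  then have 2: "(\<integral>\<^sup>+w. ennreal (indicator {0<..} w * f w) \<partial>lborel) = ennreal (integral {0<..} f)"
    using f01 by (intro nn_integral_has_integral_lebesgue) auto
  have 3: "t * exp (- t\<^sup>2 / kappa s) * kappa s powr (- 3 / 2) * (4 / (1 - s\<^sup>2)) * H s = \<bar>g' s\<bar> * f (g s)"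
    if "s \<in> ?S" for s
  proof -
    have s: "0 < s" "s < 1" and k: "0 < kappa s" using that kappa_pos[of s] by auto
    have s2: "0 < 1 - s\<^sup>2" using s by (simp add: power_less_one_iff)
    have "tanh (t\<^sup>2 / (4 * g s)) = s"
      using tanh_kappa[OF s] t k by (simp add: g_def)
    then have fg: "f (g s) = g s powr (- 1 / 2) / exp (t\<^sup>2 / kappa s) * H s"
      by (simp add: f_def) (simp add: g_def)
    have "g s powr (- 1 / 2) = kappa s powr (1 / 2) / t"
    proof -
      have "t\<^sup>2 = t powr 2" using t by (simp add: powr_numeral)
      then show ?thesis
        using t k by (simp add: g_def powr_divide powr_powr powr_minus divide_simps)
    qed
    moreover have "\<bar>g' s\<bar> = t\<^sup>2 * (4 / (1 - s\<^sup>2)) * kappa s powr (- 2)"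
      using s2 k by (simp add: g'_def powr_minus powr_numeral divide_inverse)
    ultimately have "\<bar>g' s\<bar> * f (g s) =
        (t\<^sup>2 / t) * exp (- (t\<^sup>2 / kappa s)) * (kappa s powr (- 2) * kappa s powr (1 / 2)) * (4 / (1 - s\<^sup>2)) * H s"
      unfolding fg exp_minus by (simp only: divide_inverse mult_ac)
    also have "kappa s powr (- 2) * kappa s powr (1 / 2) = kappa s powr (- 3 / 2)"
      by (simp add: powr_add[symmetric])
    also have "t\<^sup>2 / t = t" using t by (simp add: power2_eq_square)
    finally show ?thesis by simp
  qed
  have "(\<integral>\<^sup>+s\<in>?S. ennreal (t * exp (- t\<^sup>2 / kappa s) * kappa s powr (- 3 / 2) * (4 / (1 - s\<^sup>2)) * H s) \<partial>lborel)
      = (\<integral>\<^sup>+s. ennreal (indicator ?S s * (\<bar>g' s\<bar> * f (g s))) \<partial>lborel)"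
    using 3 by (intro nn_integral_cong) (auto simp: indicator_def)
  also have "\<dots> = (\<integral>\<^sup>+w. ennreal (indicator {0<..} w * f w) \<partial>lborel)" by (simp only: 1 2)
  also have "\<dots> = (\<integral>\<^sup>+w\<in>{0<..}. ennreal (f w) \<partial>lborel)"
    by (intro nn_integral_cong) (auto simp: indicator_def)
  finally show ?thesis by (simp add: f_def)
qed

text \<open>
  The total mass of the kernel is a mean of \<open>mehler_mass x\<close>: the weight \<open>w powr (- 1/2) / exp w\<close> has integral
  \<open>Gamma (1/2) = sqrt pi\<close>.
\<close>

lemma nn_integral_poisson_hermite_kernel:
  fixes x :: "'a::euclidean_space"
  assumes t: "0 < t"
  shows "(\<integral>\<^sup>+y. ennreal (poisson_hermite_kernel t x y) \<partial>lborel) = ennreal (1 / sqrt pi) *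
    (\<integral>\<^sup>+w\<in>{0<..}. ennreal (w powr (- 1 / 2) / exp w * mehler_mass x (tanh (t\<^sup>2 / (4 * w)))) \<partial>lborel)"
proof -
  let ?c = "hermite_const TYPE('a)" and ?d = "real DIM('a)"
  have c: "?c * (4 * pi) powr (?d / 2) = 4 / sqrt pi"
  proof -
    have "?c * (4 * pi) powr (?d / 2) = 8 * (4 * pi) powr (- (1 / 2))"
      by (simp add: hermite_const_def powr_add[symmetric] add_divide_distrib diff_divide_distrib)
    also have "\<dots> = 4 / sqrt pi"
    proof -
      have "(4 * pi) powr (- (1 / 2)) = 1 / sqrt (4 * pi)"
        by (simp only: powr_minus_divide) (simp add: powr_half_sqrt)
      then show ?thesis by (simp add: real_sqrt_mult)
    qed
    finally show ?thesis .
  qed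
  have "(\<integral>\<^sup>+y. ennreal (poisson_hermite_kernel t x y) \<partial>lborel)
      = (\<integral>\<^sup>+y. \<integral>\<^sup>+s. ennreal (?c * t) * (ennreal (hermite_integrand t x y s) * indicator {0<..<1} s) \<partial>lborel \<partial>lborel)"
    by (simp only: ennreal_poisson_hermite_kernel[OF t]) (subst nn_integral_cmult, measurable)
  also have "\<dots> = (\<integral>\<^sup>+s. \<integral>\<^sup>+y. ennreal (?c * t) * (ennreal (hermite_integrand t x y s) * indicator {0<..<1} s) \<partial>lborel \<partial>lborel)"
    by (rule lborel_pair.Fubini') measurable
  also have "\<dots> = (\<integral>\<^sup>+s. ennreal (1 / sqrt pi) * (ennreal (t * exp (- t\<^sup>2 / kappa s) * kappa s powr (- 3 / 2) *
      (4 / (1 - s\<^sup>2)) * mehler_mass x s) * indicator {0<..<1} s) \<partial>lborel)"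
  proof (rule nn_integral_cong)
    fix s :: real
    show "(\<integral>\<^sup>+y. ennreal (?c * t) * (ennreal (hermite_integrand t x y s) * indicator {0<..<1} s) \<partial>lborel)
      = ennreal (1 / sqrt pi) * (ennreal (t * exp (- t\<^sup>2 / kappa s) * kappa s powr (- 3 / 2) *
          (4 / (1 - s\<^sup>2)) * mehler_mass x s) * indicator {0<..<1} s)"
    proof (cases "s \<in> {0<..<1}")
      case True
      then have s: "0 < s" "s < 1" by auto
      define h where "h = exp (- t\<^sup>2 / kappa s) * kappa s powr (- 3 / 2) / (1 - s\<^sup>2) * mehler_mass x s"
      have h: "0 \<le> h"
        unfolding h_def using s
        by (intro mult_nonneg_nonneg divide_nonneg_nonneg) (auto simp: mehler_mass_def power_le_one)
      have "(\<integral>\<^sup>+y. ennreal (?c * t) * ennreal (hermite_integrand t x y s) \<partial>lborel)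
          = ennreal (?c * t) * ennreal ((4 * pi) powr (?d / 2) * h)"
        by (subst nn_integral_cmult) (simp_all add: nn_integral_hermite_integrand[OF s] h_def)
      also have "\<dots> = ennreal (?c * t * ((4 * pi) powr (?d / 2) * h))"
        using h t hermite_const_pos[where 'a='a]
        by (intro ennreal_mult[symmetric] mult_nonneg_nonneg) auto
      also have "?c * t * ((4 * pi) powr (?d / 2) * h) = (?c * (4 * pi) powr (?d / 2)) * t * h"
        by simp
      also have "\<dots> = (1 / sqrt pi) * (t * exp (- t\<^sup>2 / kappa s) *
          kappa s powr (- 3 / 2) * (4 / (1 - s\<^sup>2)) * mehler_mass x s)"
        unfolding c h_def by simp
      also have "ennreal \<dots> = ennreal (1 / sqrt pi) * ennreal (t * exp (- t\<^sup>2 / kappa s) *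
          kappa s powr (- 3 / 2) * (4 / (1 - s\<^sup>2)) * mehler_mass x s)"
        using s t
        by (intro ennreal_mult mult_nonneg_nonneg divide_nonneg_nonneg) (auto simp: mehler_mass_def power_le_one)
      finally show ?thesis using True by simp
    qed simp
  qed
  also have "\<dots> = ennreal (1 / sqrt pi) * (\<integral>\<^sup>+s\<in>{0<..<1}. ennreal (t * exp (- t\<^sup>2 / kappa s) *
      kappa s powr (- 3 / 2) * (4 / (1 - s\<^sup>2)) * mehler_mass x s) \<partial>lborel)"
    by (rule nn_integral_cmult) measurable
  also have "(\<integral>\<^sup>+s\<in>{0<..<1}. ennreal (t * exp (- t\<^sup>2 / kappa s) *
      kappa s powr (- 3 / 2) * (4 / (1 - s\<^sup>2)) * mehler_mass x s) \<partial>lborel)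
      = (\<integral>\<^sup>+w\<in>{0<..}. ennreal (w powr (- 1 / 2) / exp w * mehler_mass x (tanh (t\<^sup>2 / (4 * w)))) \<partial>lborel)"
    by (rule nn_integral_subordination[OF t]) (auto simp: mehler_mass_bounds)
  finally show ?thesis .
qed

text \<open>
  For fixed \<open>w\<close> the argument \<open>tanh (t\<^sup>2 / (4 * w))\<close> tends to 0, where \<open>mehler_mass\<close> equals 1; dominated
  convergence applies because \<open>mehler_mass\<close> is at most 1.
\<close>

lemma tendsto_integral_poisson_hermite_kernel:
  fixes x0 :: "'a::euclidean_space"
  shows "((\<lambda>(t, x). \<integral>y. poisson_hermite_kernel t x y \<partial>lborel) \<longlongrightarrow> 1) (nontangential \<alpha> x0)"
  unfolding nontangential_def tendsto_at_iff_sequentially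
proof (intro allI impI)
  fix X :: "nat \<Rightarrow> real \<times> 'a"
  assume X: "\<forall>i. X i \<in> {(t, x). 0 < t \<and> norm (x - x0) < \<alpha> * t} - {(0, x0)}" and lim: "X \<longlonglongrightarrow> (0, x0)"
  define t x where "t i = fst (X i)" and "x i = snd (X i)" for i
  have t: "0 < t i" for i using X[rule_format, of i] by (simp add: t_def case_prod_beta)
  have lim_t: "t \<longlonglongrightarrow> 0" and lim_x: "x \<longlonglongrightarrow> x0"
    using tendsto_fst[OF lim] tendsto_snd[OF lim] by (auto simp: t_def[abs_def] x_def[abs_def])
  have tanh_m[measurable]: "(tanh :: real \<Rightarrow> real) \<in> borel_measurable borel"
    by (intro borel_measurable_continuous_onI continuous_intros) auto
  let ?u = "\<lambda>i w. ennreal (w powr (- 1 / 2) / exp w * mehler_mass (x i) (tanh ((t i)\<^sup>2 / (4 * w)))) *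
    indicator {0<..} w"
  let ?v = "\<lambda>w::real. ennreal (w powr (- 1 / 2) / exp w) * indicator {0<..} w"
  have v: "(\<integral>\<^sup>+w. ?v w \<partial>lborel) = ennreal (sqrt pi)"
  proof -
    have "(\<integral>\<^sup>+w. ?v w \<partial>lborel) = (\<integral>\<^sup>+w. ennreal (indicator {0..} w * w powr (1 / 2 - 1) / exp w) \<partial>lborel)"
      by (intro nn_integral_cong) (auto simp: indicator_def)
    also have "\<dots> = ennreal (Gamma (1 / 2))" by (rule Gamma_conv_nn_integral_real[symmetric]) simp
    finally show ?thesis by (simp add: Gamma_one_half_real)
  qed
  have "(\<lambda>i. \<integral>\<^sup>+w. ?u i w \<partial>lborel) \<longlonglongrightarrow> (\<integral>\<^sup>+w. ?v w \<partial>lborel)"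
  proof (rule nn_integral_dominated_convergence)
    show "AE w in lborel. ?u i w \<le> ?v w" for i
    proof (intro AE_I2)
      fix w :: real
      show "?u i w \<le> ?v w"
      proof (cases "0 < w")
        case True
        have "mehler_mass (x i) (tanh ((t i)\<^sup>2 / (4 * w))) \<le> 1"
          using t[of i] True by (intro mehler_mass_bounds) (auto simp: tanh_real_lt_1)
        then have "w powr (- 1 / 2) / exp w * mehler_mass (x i) (tanh ((t i)\<^sup>2 / (4 * w))) \<le> w powr (- 1 / 2) / exp w"
          by (intro mult_left_le) auto
        then show ?thesis using True by (simp add: ennreal_leI)
      qed simp
    qed
    show "(\<integral>\<^sup>+w. ?v w \<partial>lborel) < \<infinity>" unfolding v by simp
    show "AE w in lborel. (\<lambda>i. ?u i w) \<longlonglongrightarrow> ?v w"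
    proof (intro AE_I2)
      fix w :: real
      show "(\<lambda>i. ?u i w) \<longlonglongrightarrow> ?v w"
      proof (cases "0 < w")
        case True
        have "(\<lambda>i. tanh ((t i)\<^sup>2 / (4 * w))) \<longlonglongrightarrow> tanh (0\<^sup>2 / (4 * w))"
          using True by (intro tendsto_intros lim_t) auto
        then have s: "(\<lambda>i. tanh ((t i)\<^sup>2 / (4 * w))) \<longlonglongrightarrow> 0" by simp
        have "(\<lambda>i. mehler_mass (x i) (tanh ((t i)\<^sup>2 / (4 * w)))) \<longlonglongrightarrow>
            ((1 - 0\<^sup>2) / (1 + 0\<^sup>2)) powr (real DIM('a) / 2) * exp (- (0 / (1 + 0\<^sup>2)) * (norm x0)\<^sup>2)"
          unfolding mehler_mass_def by (intro tendsto_intros s lim_x) auto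
        then have "(\<lambda>i. mehler_mass (x i) (tanh ((t i)\<^sup>2 / (4 * w)))) \<longlonglongrightarrow> 1" by simp
        then have "(\<lambda>i. w powr (- 1 / 2) / exp w * mehler_mass (x i) (tanh ((t i)\<^sup>2 / (4 * w)))) \<longlonglongrightarrow>
            w powr (- 1 / 2) / exp w * 1" by (intro tendsto_intros)
        then show ?thesis using True by (auto intro: tendsto_ennrealI)
      qed simp
    qed
  qed measurable
  then have "(\<lambda>i. ennreal (1 / sqrt pi) * (\<integral>\<^sup>+w. ?u i w \<partial>lborel)) \<longlonglongrightarrow> ennreal (1 / sqrt pi) * ennreal (sqrt pi)"
    unfolding v by (intro ennreal_tendsto_cmult) auto
  then have "(\<lambda>i. \<integral>\<^sup>+y. ennreal (poisson_hermite_kernel (t i) (x i) y) \<partial>lborel) \<longlonglongrightarrow> ennreal 1"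
    by (simp add: nn_integral_poisson_hermite_kernel[OF t] ennreal_mult[symmetric])
  then have "(\<lambda>i. enn2real (\<integral>\<^sup>+y. ennreal (poisson_hermite_kernel (t i) (x i) y) \<partial>lborel)) \<longlonglongrightarrow> 1"
    by (intro tendsto_enn2real) auto
  moreover have "enn2real (\<integral>\<^sup>+y. ennreal (poisson_hermite_kernel (t i) (x i) y) \<partial>lborel) =
      (\<integral>y. poisson_hermite_kernel (t i) (x i) y \<partial>lborel)" for i
    using t[of i] by (intro integral_eq_nn_integral[symmetric]) (auto intro!: AE_I2 poisson_hermite_kernel_nonneg)
  ultimately show "((\<lambda>(t, x). \<integral>y. poisson_hermite_kernel t x y \<partial>lborel) \<circ> X) \<longlonglongrightarrow> 1"
    by (simp add: o_def case_prod_beta t_def x_def)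
qed

section \<open>Lebesgue points and nontangential limits\<close>

lemma tendsto_0_ennreal_iff:
  "((f \<longlongrightarrow> (0::ennreal)) F) \<longleftrightarrow> (\<forall>\<eta>>0. eventually (\<lambda>x. f x \<le> ennreal \<eta>) F)"
proof (intro iffI allI impI)
  fix \<eta> :: real assume "(f \<longlongrightarrow> 0) F" "0 < \<eta>"
  then have "eventually (\<lambda>x. f x < ennreal \<eta>) F" by (intro order_tendstoD) auto
  then show "eventually (\<lambda>x. f x \<le> ennreal \<eta>) F" by (rule eventually_mono) auto
next
  assume *: "\<forall>\<eta>>0. eventually (\<lambda>x. f x \<le> ennreal \<eta>) F"
  show "(f \<longlongrightarrow> 0) F"
  proof (rule order_tendstoI)
    fix a :: ennreal assume "0 < a"
    then obtain b where b: "0 < b" "b < a" using dense by blast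
    then have "b < top" by (meson less_le_trans top_greatest)
    with b obtain \<eta> where \<eta>: "b = ennreal \<eta>" "0 < \<eta>" by (cases b) auto
    have "eventually (\<lambda>x. f x \<le> ennreal \<eta>) F" using * \<eta> by blast
    then show "eventually (\<lambda>x. f x < a) F" by (rule eventually_mono) (use b \<eta> in auto)
  qed auto
qed

text \<open>
  The Lebesgue point condition for the measure \<open>|\<nu> - l dy|\<close>, freed from the volume of the unit ball and from
  quotients in \<open>[0, \<infinity>]\<close>.
\<close>

definition vanishing_density :: "'a::euclidean_space measure \<Rightarrow> 'a \<Rightarrow> bool" where
  "vanishing_density \<mu> x0 \<longleftrightarrow>
     (\<forall>\<eta>>0. \<forall>\<^sub>F r in at_right 0. emeasure \<mu> (ball x0 r) \<le> ennreal (\<eta> * r ^ DIM('a)))"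

lemma vanishing_density_iff:
  fixes x0 :: "'a::euclidean_space"
  shows "vanishing_density \<mu> x0 \<longleftrightarrow>
    ((\<lambda>r. emeasure \<mu> (ball x0 r) / emeasure lborel (ball x0 r)) \<longlongrightarrow> 0) (at_right 0)"
proof -
  define V where "V = unit_ball_vol (real DIM('a))"
  have V: "0 < V" by (simp add: V_def)
  have le_iff: "emeasure \<mu> (ball x0 r) / emeasure lborel (ball x0 r) \<le> ennreal \<eta> \<longleftrightarrow>
      emeasure \<mu> (ball x0 r) \<le> ennreal (\<eta> * V * r ^ DIM('a))" if "0 < r" "0 < \<eta>" for r \<eta>
  proof -
    have b: "emeasure lborel (ball x0 r) = ennreal (V * r ^ DIM('a))"
      using that by (simp add: emeasure_ball V_def)
    have pos: "0 < V * r ^ DIM('a)" using V that by simp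
    have e: "ennreal (\<eta> * V * r ^ DIM('a)) = ennreal (V * r ^ DIM('a)) * ennreal \<eta>"
      using pos that by (simp add: ennreal_mult[symmetric] mult_ac)
    show ?thesis
    proof
      assume "emeasure \<mu> (ball x0 r) / emeasure lborel (ball x0 r) \<le> ennreal \<eta>"
      then have "ennreal (V * r ^ DIM('a)) * (emeasure \<mu> (ball x0 r) / ennreal (V * r ^ DIM('a)))
          \<le> ennreal (V * r ^ DIM('a)) * ennreal \<eta>"
        unfolding b by (rule mult_left_mono) simp
      moreover have "ennreal (V * r ^ DIM('a)) * (emeasure \<mu> (ball x0 r) / ennreal (V * r ^ DIM('a))) = emeasure \<mu> (ball x0 r)"
        using pos that by (subst ennreal_times_divide, subst mult.commute, subst mult_divide_eq_ennreal) auto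
      ultimately show "emeasure \<mu> (ball x0 r) \<le> ennreal (\<eta> * V * r ^ DIM('a))" unfolding e by simp
    next
      assume "emeasure \<mu> (ball x0 r) \<le> ennreal (\<eta> * V * r ^ DIM('a))"
      then show "emeasure \<mu> (ball x0 r) / emeasure lborel (ball x0 r) \<le> ennreal \<eta>"
        unfolding b e using pos by (intro divide_le_posI_ennreal) auto
    qed
  qed
  have pos: "\<forall>\<^sub>F r in at_right (0::real). 0 < r" by (simp add: eventually_at_right_less)
  show ?thesis
    unfolding vanishing_density_def tendsto_0_ennreal_iff
  proof safe
    fix \<eta> :: real
    assume *: "\<forall>\<eta>>0. \<forall>\<^sub>F r in at_right 0. emeasure \<mu> (ball x0 r) \<le> ennreal (\<eta> * r ^ DIM('a))" and \<eta>: "0 < \<eta>"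
    have "\<forall>\<^sub>F r in at_right 0. emeasure \<mu> (ball x0 r) \<le> ennreal (\<eta> * V * r ^ DIM('a))"
      using * \<eta> V by simp
    with pos show "\<forall>\<^sub>F r in at_right 0. emeasure \<mu> (ball x0 r) / emeasure lborel (ball x0 r) \<le> ennreal \<eta>"
      by eventually_elim (simp only: le_iff[OF _ \<eta>])
  next
    fix \<eta> :: real
    assume *: "\<forall>\<eta>>0. \<forall>\<^sub>F r in at_right 0. emeasure \<mu> (ball x0 r) / emeasure lborel (ball x0 r) \<le> ennreal \<eta>" and \<eta>: "0 < \<eta>"
    have \<eta>V: "0 < \<eta> / V" using \<eta> V by simp
    have "\<forall>\<^sub>F r in at_right 0. emeasure \<mu> (ball x0 r) / emeasure lborel (ball x0 r) \<le> ennreal (\<eta> / V)"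
      using * \<eta>V by blast
    with pos show "\<forall>\<^sub>F r in at_right 0. emeasure \<mu> (ball x0 r) \<le> ennreal (\<eta> * r ^ DIM('a))"
    proof eventually_elim
      case (elim r)
      then show ?case using le_iff[OF _ \<eta>V, of r] V by simp
    qed
  qed
qed

text \<open>
  The kernel at height \<open>t\<close> dominates \<open>c * t ^ (- d)\<close> on the ball of radius \<open>t\<close>, so the Poisson integral at \<open>x0\<close>
  dominates the mean of \<open>\<mu>\<close> over this ball.
\<close>

lemma vanishing_density_if_poisson_hermite_pos_tendsto_0:
  fixes x0 :: "'a::euclidean_space"
  assumes \<mu>: "sets \<mu> = sets borel"
    and lim: "((\<lambda>t. poisson_hermite_pos t \<mu> x0) \<longlongrightarrow> 0) (at_right 0)"
  shows "vanishing_density \<mu> x0"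
  unfolding vanishing_density_def
proof (intro allI impI)
  fix \<eta> :: real assume \<eta>: "0 < \<eta>"
  obtain c where c: "0 < c" and ge: "\<And>t y. 0 < t \<Longrightarrow> t \<le> 1 / 2 \<Longrightarrow> y \<in> ball x0 t \<Longrightarrow>
    c / t ^ DIM('a) \<le> poisson_hermite_kernel t x0 y"
    by (rule poisson_hermite_kernel_ge[of x0]) (rule that)
  have "\<forall>\<^sub>F t in at_right 0. poisson_hermite_pos t \<mu> x0 \<le> ennreal (c * \<eta>)"
    using lim c \<eta> unfolding tendsto_0_ennreal_iff by simp
  moreover have "\<forall>\<^sub>F t in at_right (0::real). t \<in> {0<..<1/2}"
    by (rule eventually_at_rightI[of 0 "1 / 2"]) auto
  ultimately show "\<forall>\<^sub>F r in at_right 0. emeasure \<mu> (ball x0 r) \<le> ennreal (\<eta> * r ^ DIM('a))"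
  proof eventually_elim
    case (elim t)
    then have t: "0 < t" "t \<le> 1 / 2" by auto
    let ?q = "ennreal (c / t ^ DIM('a))"
    have "?q * emeasure \<mu> (ball x0 t) = (\<integral>\<^sup>+y. ?q * indicator (ball x0 t) y \<partial>\<mu>)"
      using \<mu> by (simp add: nn_integral_cmult_indicator)
    also have "\<dots> \<le> poisson_hermite_pos t \<mu> x0"
      unfolding poisson_hermite_pos_def using ge[OF t]
      by (intro nn_integral_mono) (auto simp: indicator_def intro!: ennreal_leI)
    also have "\<dots> \<le> ennreal (c * \<eta>)" by (rule elim)
    finally have "ennreal (t ^ DIM('a) / c) * (?q * emeasure \<mu> (ball x0 t)) \<le> ennreal (t ^ DIM('a) / c) * ennreal (c * \<eta>)"
      by (rule mult_left_mono) simp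
    moreover have "ennreal (t ^ DIM('a) / c) * ?q = 1"
      using c t by (subst ennreal_mult[symmetric]) auto
    moreover have "ennreal (t ^ DIM('a) / c) * ennreal (c * \<eta>) = ennreal (\<eta> * t ^ DIM('a))"
      using c t \<eta> by (subst ennreal_mult[symmetric]) auto
    ultimately show ?case by (simp only: mult.assoc[symmetric] mult_1_left)
  qed
qed

text \<open>
  The ball of radius \<open>\<delta>\<close> is cut into the dyadic shells where \<open>|x0 - y|\<close> is comparable with
  \<open>2 ^ k * t\<close>. On each shell the Poisson kernel is at most \<open>2 ^ (- k)\<close> times the reciprocal volume.
\<close>

lemma nn_integral_poisson_kernel_le:
  fixes x0 :: "'a::euclidean_space"
  assumes \<mu>: "sets \<mu> = sets borel" and t: "0 < t" and \<delta>: "0 < \<delta>" and \<eta>: "0 \<le> \<eta>"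
    and le: "\<And>r. 0 < r \<Longrightarrow> r \<le> \<delta> \<Longrightarrow> emeasure \<mu> (ball x0 r) \<le> ennreal (\<eta> * r ^ DIM('a))"
  shows "(\<integral>\<^sup>+y\<in>ball x0 \<delta>. ennreal (t / (t + dist x0 y) ^ (DIM('a) + 1)) \<partial>\<mu>)
    \<le> ennreal (2 ^ (DIM('a) + 2) * \<eta>)"
proof -
  define d where "d = DIM('a)"
  define a where "a k = 2 ^ (d + 1) / (2 ^ k * (2 ^ k * t) ^ d)" for k :: nat
  define r where "r k = min (2 ^ k * t) \<delta>" for k :: nat
  have a: "0 \<le> a k" and r: "0 < r k" "r k \<le> \<delta>" for k
    using t \<delta> by (auto simp: a_def r_def)
  have pt: "ennreal (t / (t + dist x0 y) ^ (d + 1)) * indicator (ball x0 \<delta>) y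
      \<le> (\<Sum>k. ennreal (a k) * indicator (ball x0 (r k)) y)" for y
  proof (cases "y \<in> ball x0 \<delta>")
    case True
    let ?\<rho> = "dist x0 y"
    obtain n where "?\<rho> / t < 2 ^ n" using real_arch_pow[of 2 "?\<rho> / t"] by auto
    then have ex: "\<exists>n. ?\<rho> < 2 ^ n * t" using t by (auto simp: divide_less_eq)
    define k where "k = (LEAST n. ?\<rho> < 2 ^ n * t)"
    have k: "?\<rho> < 2 ^ k * t" unfolding k_def by (rule LeastI_ex[OF ex])
    have half: "2 ^ k * t / 2 \<le> t + ?\<rho>"
    proof (cases k)
      case 0
      then show ?thesis using t by (simp add: add_increasing2)
    next
      case (Suc j)
      then have "\<not> ?\<rho> < 2 ^ j * t" using not_less_Least[of j "\<lambda>n. ?\<rho> < 2 ^ n * t"] by (simp add: k_def)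
      then show ?thesis using Suc t by simp
    qed
    have "t / (t + ?\<rho>) ^ (d + 1) \<le> t / (2 ^ k * t / 2) ^ (d + 1)"
      using half t by (intro divide_left_mono power_mono mult_pos_pos zero_less_power) (auto intro: add_pos_nonneg)
    also have "\<dots> = a k"
      using t by (simp add: a_def power_divide field_simps)
    finally have "ennreal (t / (t + ?\<rho>) ^ (d + 1)) * indicator (ball x0 \<delta>) y
        \<le> ennreal (a k) * indicator (ball x0 (r k)) y"
      using True k by (simp add: r_def ennreal_leI)
    also have "\<dots> \<le> (\<Sum>k. ennreal (a k) * indicator (ball x0 (r k)) y)"
    proof -
      have "f k \<le> suminf f" for f :: "nat \<Rightarrow> ennreal"
        using sum_le_suminf[of f "{k}"] by simp
      then show ?thesis .
    qed
    finally show ?thesis .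
  qed simp
  have "(\<integral>\<^sup>+y\<in>ball x0 \<delta>. ennreal (t / (t + dist x0 y) ^ (d + 1)) \<partial>\<mu>)
      \<le> (\<integral>\<^sup>+y. (\<Sum>k. ennreal (a k) * indicator (ball x0 (r k)) y) \<partial>\<mu>)"
    by (intro nn_integral_mono pt)
  also have "\<dots> = (\<Sum>k. ennreal (a k) * emeasure \<mu> (ball x0 (r k)))"
  proof -
    have [measurable_cong]: "sets \<mu> = sets borel" by (rule \<mu>)
    have "(\<lambda>y. ennreal (a k) * indicator (ball x0 (r k)) y) \<in> borel_measurable \<mu>" for k
      by (intro borel_measurable_times_ennreal borel_measurable_const borel_measurable_indicator) (simp add: \<mu>)
    then show ?thesis
      by (subst nn_integral_suminf) (simp_all add: nn_integral_cmult_indicator \<mu>)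
  qed
  also have "\<dots> \<le> (\<Sum>k. ennreal (2 ^ (d + 1) * \<eta> * (1 / 2) ^ k))"
  proof (rule suminf_le)
    fix k
    have "ennreal (a k) * emeasure \<mu> (ball x0 (r k)) \<le> ennreal (a k) * ennreal (\<eta> * r k ^ d)"
      unfolding d_def by (intro mult_left_mono le r) auto
    also have "\<dots> = ennreal (a k * (\<eta> * r k ^ d))"
      using a \<eta> r[of k] by (intro ennreal_mult[symmetric]) auto
    also have "\<dots> \<le> ennreal (a k * (\<eta> * (2 ^ k * t) ^ d))"
      using a[of k] \<eta> r(1)[of k] by (intro ennreal_leI mult_left_mono power_mono) (auto simp: r_def)
    also have "a k * (\<eta> * (2 ^ k * t) ^ d) = 2 ^ (d + 1) * \<eta> * (1 / 2) ^ k"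
      using t by (simp add: a_def power_divide)
    finally show "ennreal (a k) * emeasure \<mu> (ball x0 (r k)) \<le> ennreal (2 ^ (d + 1) * \<eta> * (1 / 2) ^ k)" .
  qed auto
  also have "\<dots> = ennreal (2 ^ (d + 1) * \<eta> * 2)"
    using \<eta> sums_mult[OF geometric_sums[of "1/2::real"], of "2 ^ (d + 1) * \<eta>"]
    by (intro suminf_ennreal_eq) auto
  finally show ?thesis by (simp add: d_def mult_ac)
qed

lemma eventually_nontangential:
  fixes x0 :: "'a::euclidean_space"
  assumes "0 < e"
  shows "\<forall>\<^sub>F p in nontangential \<alpha> x0. 0 < fst p \<and> fst p < e \<and> norm (snd p - x0) < \<alpha> * fst p \<and> norm (snd p - x0) < e"
  unfolding nontangential_def eventually_at
proof (intro exI conjI ballI impI)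
  fix p :: "real \<times> 'a"
  assume p: "p \<in> {(t, x). 0 < t \<and> norm (x - x0) < \<alpha> * t}" and d: "p \<noteq> (0, x0) \<and> dist p (0, x0) < e"
  show "0 < fst p" "norm (snd p - x0) < \<alpha> * fst p" using p by auto
  have "dist (fst p) (fst (0::real, x0)) < e" "dist (snd p) (snd (0::real, x0)) < e"
    using d le_less_trans[OF dist_fst_le[of p "(0, x0)"]] le_less_trans[OF dist_snd_le[of p "(0, x0)"]] by auto
  then show "fst p < e" "norm (snd p - x0) < e" by (auto simp: dist_norm)
qed (rule assms)

text \<open>
  In a cone, \<open>t + |x0 - y|\<close> is at most a multiple of \<open>sqrt (t\<^sup>2 + |x - y|\<^sup>2)\<close>, so the kernel at \<open>(t, x)\<close> is bounded
  by a kernel centred at \<open>x0\<close>. Near \<open>x0\<close>, where \<open>Phi \<le> 1\<close>, this is a Poisson kernel tested on small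
  densities; at distance at least \<open>\<delta>\<close> it is at most \<open>t\<close> times a multiple of \<open>Phi\<close>, whose \<open>\<mu>\<close>-integral is finite.
\<close>

lemma poisson_hermite_pos_tendsto_0:
  fixes x0 :: "'a::euclidean_space"
  assumes \<mu>: "sets \<mu> = sets borel" and fin: "(\<integral>\<^sup>+y. ennreal (Phi y) \<partial>\<mu>) < \<infinity>"
    and dens: "vanishing_density \<mu> x0" and \<alpha>: "0 < \<alpha>"
  shows "((\<lambda>(t, x). poisson_hermite_pos t \<mu> x) \<longlongrightarrow> 0) (nontangential \<alpha> x0)"
  unfolding tendsto_0_ennreal_iff
proof (intro allI impI)
  fix \<eta> :: real assume \<eta>: "0 < \<eta>"
  define d where "d = DIM('a)"
  define A where "A = 2 * (1 + \<alpha>)"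
  have A: "0 < A" using \<alpha> by (simp add: A_def)
  obtain F where F: "(\<integral>\<^sup>+y. ennreal (Phi y) \<partial>\<mu>) = ennreal F" "0 \<le> F"
    using fin by (auto simp: less_top_ennreal)
  obtain C where C: "0 < C" and le: "\<And>t (x::'a) y. 0 < t \<Longrightarrow> norm x \<le> norm x0 + 1 \<Longrightarrow>
    poisson_hermite_kernel t x y
      \<le> C * (t * Phi y * (1 + (t\<^sup>2 + (norm (x - y))\<^sup>2) powr (- (real DIM('a) + 1) / 2)))"
    by (rule poisson_hermite_kernel_le[where 'a='a, of "norm x0 + 1"]) (rule that)
  (* the part over the ball of radius \<delta> then contributes \<eta> / 2, for every t *)
  define \<epsilon> where "\<epsilon> = \<eta> / (2 * (C * A ^ (d + 1) * 2 ^ (d + 2)))"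
  have \<epsilon>: "0 < \<epsilon>" using \<eta> C A by (simp add: \<epsilon>_def)
  have "\<forall>\<^sub>F r in at_right 0. emeasure \<mu> (ball x0 r) \<le> ennreal (\<epsilon> * r ^ DIM('a))"
    using dens \<epsilon> by (simp add: vanishing_density_def)
  then obtain \<delta>' where \<delta>': "0 < \<delta>'" "\<And>r. 0 < r \<Longrightarrow> r < \<delta>' \<Longrightarrow> emeasure \<mu> (ball x0 r) \<le> ennreal (\<epsilon> * r ^ DIM('a))"
    by (auto simp: eventually_at_right_field)
  define \<delta> where "\<delta> = \<delta>' / 2"
  have \<delta>: "0 < \<delta>" "\<And>r. 0 < r \<Longrightarrow> r \<le> \<delta> \<Longrightarrow> emeasure \<mu> (ball x0 r) \<le> ennreal (\<epsilon> * r ^ DIM('a))"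
    using \<delta>' by (auto simp: \<delta>_def)
  define B where "B = C * (1 + A ^ (d + 1) / \<delta> ^ (d + 1))"
  have B: "0 < B" using C A \<delta>(1) by (auto simp: B_def intro!: mult_pos_pos add_pos_nonneg)
  (* for t < e the part outside the ball contributes at most \<eta> / 2; adding 1 avoids division by 0 *)
  define e where "e = min 1 (\<eta> / (2 * (B * F + 1)))"
  have BF: "0 < B * F + 1" using B F(2) by (intro add_nonneg_pos) auto
  then have e: "0 < e" using \<eta> by (simp add: e_def)
  have bound: "poisson_hermite_pos t \<mu> x \<le> ennreal \<eta>"
    if t: "0 < t" "t < e" and x: "norm (x - x0) < \<alpha> * t" "norm (x - x0) < e" for t x
  proof -
    have nx: "norm x \<le> norm x0 + 1"
      using norm_triangle_sub[of x x0] x(2) by (simp add: e_def)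
    have pt: "poisson_hermite_kernel t x y \<le>
        B * t * Phi y + C * A ^ (d + 1) * (t / (t + dist x0 y) ^ (d + 1) * indicator (ball x0 \<delta>) y)" for y
    proof -
      let ?Q = "t\<^sup>2 + (norm (x - y))\<^sup>2" and ?T = "t + dist x0 y"
      have T: "0 < ?T" using t by (simp add: add_pos_nonneg)
      have "?T \<le> A * sqrt ?Q"
      proof -
        have "dist x0 y \<le> norm (x - x0) + norm (x - y)"
          using dist_triangle[of x0 y x] by (simp add: dist_norm norm_minus_commute)
        then have "?T \<le> (1 + \<alpha>) * t + norm (x - y)" using x by (simp add: algebra_simps)
        also have "\<dots> \<le> (1 + \<alpha>) * sqrt ?Q + (1 + \<alpha>) * sqrt ?Q"
        proof (intro add_mono mult_left_mono)
          show "t \<le> sqrt ?Q" by (rule real_le_rsqrt) simp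
          have "norm (x - y) \<le> sqrt ?Q" by (rule real_le_rsqrt) simp
          also have "\<dots> \<le> (1 + \<alpha>) * sqrt ?Q" using \<alpha> by (simp add: distrib_right)
          finally show "norm (x - y) \<le> (1 + \<alpha>) * sqrt ?Q" .
        qed (use \<alpha> in auto)
        finally show ?thesis by (simp add: A_def algebra_simps)
      qed
      then have TQ: "?T / A \<le> sqrt ?Q" using A by (simp add: divide_le_eq mult.commute)
      have "?Q powr (- (real d + 1) / 2) = sqrt ?Q powr (- (real d + 1))"
        using t by (simp add: powr_half_sqrt[symmetric] powr_powr)
      also have "\<dots> \<le> (?T / A) powr (- (real d + 1))"
        using TQ T A by (intro powr_mono2') auto
      also have "\<dots> = (A / ?T) ^ (d + 1)"
      proof -
        have "(?T / A) powr (- (real d + 1)) = inverse ((?T / A) powr real (d + 1))"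
          by (simp add: powr_minus[symmetric] add.commute)
        also have "\<dots> = inverse ((?T / A) ^ (d + 1))"
          using T A by (subst powr_realpow) auto
        finally show ?thesis by (simp add: power_divide)
      qed
      finally have "?Q powr (- (real d + 1) / 2) \<le> A ^ (d + 1) / ?T ^ (d + 1)"
        by (simp only: power_divide)
      then have "C * (t * Phi y * (1 + ?Q powr (- (real d + 1) / 2)))
          \<le> C * (t * Phi y * (1 + A ^ (d + 1) / ?T ^ (d + 1)))"
        using C t Phi_pos[of y] by (intro mult_left_mono add_left_mono) auto
      then have K: "poisson_hermite_kernel t x y \<le> C * (t * Phi y * (1 + A ^ (d + 1) / ?T ^ (d + 1)))"
        using le[OF t(1) nx, of y] by (simp add: d_def)
      show ?thesis
      proof (cases "y \<in> ball x0 \<delta>")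
        case True
        have "C * A ^ (d + 1) * (t / ?T ^ (d + 1)) * Phi y \<le> C * A ^ (d + 1) * (t / ?T ^ (d + 1))"
          using C A t T Phi_le_1[of y] Phi_pos[of y] by (intro mult_left_le) auto
        moreover have "C * t * Phi y \<le> B * t * Phi y"
          using C A \<delta>(1) t Phi_pos[of y] by (intro mult_right_mono) (auto simp: B_def mult_le_cancel_left1)
        moreover have "C * (t * Phi y * (1 + A ^ (d + 1) / ?T ^ (d + 1)))
            = C * t * Phi y + C * A ^ (d + 1) * (t / ?T ^ (d + 1)) * Phi y"
          by (simp add: distrib_left)
        ultimately show ?thesis using K True by simp
      next
        case False
        then have "\<delta> ^ (d + 1) \<le> ?T ^ (d + 1)" using t \<delta>(1) by (intro power_mono) auto
        then have "A ^ (d + 1) / ?T ^ (d + 1) \<le> A ^ (d + 1) / \<delta> ^ (d + 1)"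
          using A \<delta>(1) T by (intro divide_left_mono mult_pos_pos zero_less_power) auto
        then have "C * (t * Phi y * (1 + A ^ (d + 1) / ?T ^ (d + 1))) \<le> C * (t * Phi y * (1 + A ^ (d + 1) / \<delta> ^ (d + 1)))"
          using C t Phi_pos[of y] by (intro mult_left_mono add_left_mono) auto
        also have "\<dots> = B * t * Phi y" by (simp add: B_def)
        finally show ?thesis using K False by simp
      qed
    qed
    have "poisson_hermite_pos t \<mu> x \<le> (\<integral>\<^sup>+y. ennreal (B * t) * ennreal (Phi y) +
        ennreal (C * A ^ (d + 1)) * (ennreal (t / (t + dist x0 y) ^ (d + 1)) * indicator (ball x0 \<delta>) y) \<partial>\<mu>)"
      unfolding poisson_hermite_pos_def
    proof (intro nn_integral_mono)
      fix y
      have "ennreal (poisson_hermite_kernel t x y) \<le> ennreal (B * t * Phi y +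
          C * A ^ (d + 1) * (t / (t + dist x0 y) ^ (d + 1) * indicator (ball x0 \<delta>) y))"
        by (rule ennreal_leI[OF pt])
      also have "\<dots> = ennreal (B * t * Phi y) +
          ennreal (C * A ^ (d + 1) * (t / (t + dist x0 y) ^ (d + 1) * indicator (ball x0 \<delta>) y))"
        using B C A t Phi_pos[of y] by (intro ennreal_plus mult_nonneg_nonneg divide_nonneg_nonneg) auto
      also have "ennreal (B * t * Phi y) = ennreal (B * t) * ennreal (Phi y)"
        using B t Phi_pos[of y] by (intro ennreal_mult) auto
      also have "ennreal (C * A ^ (d + 1) * (t / (t + dist x0 y) ^ (d + 1) * indicator (ball x0 \<delta>) y))
          = ennreal (C * A ^ (d + 1)) * ennreal (t / (t + dist x0 y) ^ (d + 1) * indicator (ball x0 \<delta>) y)"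
        using C A t by (intro ennreal_mult mult_nonneg_nonneg divide_nonneg_nonneg) auto
      also have "ennreal (t / (t + dist x0 y) ^ (d + 1) * indicator (ball x0 \<delta>) y)
          = ennreal (t / (t + dist x0 y) ^ (d + 1)) * indicator (ball x0 \<delta>) y"
        by (auto simp: indicator_def)
      finally show "ennreal (poisson_hermite_kernel t x y) \<le> ennreal (B * t) * ennreal (Phi y) +
        ennreal (C * A ^ (d + 1)) * (ennreal (t / (t + dist x0 y) ^ (d + 1)) * indicator (ball x0 \<delta>) y)" .
    qed
    also have "\<dots> = ennreal (B * t) * (\<integral>\<^sup>+y. ennreal (Phi y) \<partial>\<mu>) + ennreal (C * A ^ (d + 1)) *
        (\<integral>\<^sup>+y\<in>ball x0 \<delta>. ennreal (t / (t + dist x0 y) ^ (d + 1)) \<partial>\<mu>)"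
    proof -
      have [measurable_cong]: "sets \<mu> = sets borel" by (rule \<mu>)
      have m1: "(\<lambda>y. ennreal (Phi y)) \<in> borel_measurable \<mu>" by measurable
      have "(\<lambda>y. ennreal (t / (t + dist x0 y) ^ (d + 1))) \<in> borel_measurable \<mu>" by measurable
      moreover have "indicator (ball x0 \<delta>) \<in> borel_measurable \<mu>"
        by (rule borel_measurable_indicator) (simp add: \<mu>)
      ultimately have m2: "(\<lambda>y. ennreal (t / (t + dist x0 y) ^ (d + 1)) * indicator (ball x0 \<delta>) y) \<in> borel_measurable \<mu>"
        by (rule borel_measurable_times_ennreal)
      show ?thesis
        using m1 m2 by (subst nn_integral_add) (simp_all only: borel_measurable_times_ennreal
            borel_measurable_const nn_integral_cmult)
    qed
    also have "\<dots> \<le> ennreal (B * t) * ennreal F + ennreal (C * A ^ (d + 1)) * ennreal (2 ^ (d + 2) * \<epsilon>)"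
      unfolding F d_def using \<epsilon>
      by (intro add_mono mult_left_mono order_refl nn_integral_poisson_kernel_le \<mu> t \<delta>) auto
    also have "\<dots> = ennreal (B * F * t + C * A ^ (d + 1) * (2 ^ (d + 2) * \<epsilon>))"
      using B t F(2) C A \<epsilon> by (simp add: ennreal_mult[symmetric] ennreal_plus[symmetric] mult_ac del: ennreal_plus)
    also have "\<dots> \<le> ennreal \<eta>"
    proof (rule ennreal_leI)
      have "C * A ^ (d + 1) * (2 ^ (d + 2) * \<epsilon>) = (C * A ^ (d + 1) * 2 ^ (d + 2)) * \<epsilon>" by simp
      also have "\<dots> = \<eta> / 2"
        using C A by (simp add: \<epsilon>_def)
      finally have 2: "C * A ^ (d + 1) * (2 ^ (d + 2) * \<epsilon>) = \<eta> / 2" .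
      have "B * F * t \<le> (B * F + 1) * t" using t by (intro mult_right_mono) auto
      also have "\<dots> \<le> (B * F + 1) * (\<eta> / (2 * (B * F + 1)))"
        using t BF by (intro mult_left_mono) (auto simp: e_def)
      also have "\<dots> = \<eta> / 2"
      proof -
        have "K * (\<eta> / (2 * K)) = \<eta> / 2" if "0 < K" for K using that by simp
        then show ?thesis using BF .
      qed
      finally show "B * F * t + C * A ^ (d + 1) * (2 ^ (d + 2) * \<epsilon>) \<le> \<eta>" unfolding 2 by simp
    qed
    finally show ?thesis .
  qed
  show "\<forall>\<^sub>F p in nontangential \<alpha> x0. (case p of (t, x) \<Rightarrow> poisson_hermite_pos t \<mu> x) \<le> ennreal \<eta>"
    using eventually_nontangential[OF e, of x0 \<alpha>]
    by (rule eventually_mono) (auto simp: case_prod_beta intro: bound)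
qed

lemma tendsto_along_vertical:
  assumes "0 < \<alpha>" and "((\<lambda>(t, x). f t x) \<longlongrightarrow> L) (nontangential \<alpha> x0)"
  shows "((\<lambda>t. f t x0) \<longlongrightarrow> L) (at_right 0)"
proof -
  have "filterlim (\<lambda>t. (t, x0)) (nontangential \<alpha> x0) (at_right 0)"
    unfolding nontangential_def
  proof (rule filterlim_at_withinI)
    show "((\<lambda>t. (t, x0)) \<longlongrightarrow> (0, x0)) (at_right 0)" by (intro tendsto_intros)
    show "\<forall>\<^sub>F t in at_right 0. (t, x0) \<in> {(t, x). 0 < t \<and> norm (x - x0) < \<alpha> * t} - {(0, x0)}"
      by (rule eventually_mono[OF eventually_at_right_less]) (use assms in auto)
  qed
  from filterlim_compose[OF assms(2) this] show ?thesis by simp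
qed

lemma nn_integral_Phi_lborel: "(\<integral>\<^sup>+y. ennreal (Phi (y::'a::euclidean_space)) \<partial>lborel) < \<infinity>"
proof -
  have "(\<integral>\<^sup>+y. ennreal (Phi (y::'a)) \<partial>lborel) \<le> (\<integral>\<^sup>+y. ennreal (exp (- (1 / 2) * (norm (y - (0::'a)))\<^sup>2)) \<partial>lborel)"
    by (intro nn_integral_mono ennreal_leI order_trans[OF Phi_le]) simp
  also have "\<dots> < \<infinity>" by (subst nn_integral_gaussian) auto
  finally show ?thesis .
qed

lemma nn_integral_poisson_hermite_kernel_finite:
  fixes x :: "'a::euclidean_space"
  assumes t: "0 < t" and \<mu>: "sets \<mu> = sets borel" and fin: "(\<integral>\<^sup>+y. ennreal (Phi y) \<partial>\<mu>) < \<infinity>"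
  shows "(\<integral>\<^sup>+y. ennreal (poisson_hermite_kernel t x y) \<partial>\<mu>) < \<infinity>"
proof -
  obtain C where C: "0 < C" and le: "\<And>t (x'::'a) y. 0 < t \<Longrightarrow> norm x' \<le> norm x \<Longrightarrow>
    poisson_hermite_kernel t x' y
      \<le> C * (t * Phi y * (1 + (t\<^sup>2 + (norm (x' - y))\<^sup>2) powr (- (real DIM('a) + 1) / 2)))"
    by (rule poisson_hermite_kernel_le[where 'a='a, of "norm x"]) (rule that)
  let ?D = "C * t * (1 + (t\<^sup>2) powr (- (real DIM('a) + 1) / 2))"
  have "poisson_hermite_kernel t x y \<le> ?D * Phi y" for y
  proof -
    have "(t\<^sup>2 + (norm (x - y))\<^sup>2) powr (- (real DIM('a) + 1) / 2) \<le> (t\<^sup>2) powr (- (real DIM('a) + 1) / 2)"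
      using t by (intro powr_mono2') auto
    then have "C * (t * Phi y * (1 + (t\<^sup>2 + (norm (x - y))\<^sup>2) powr (- (real DIM('a) + 1) / 2)))
        \<le> C * (t * Phi y * (1 + (t\<^sup>2) powr (- (real DIM('a) + 1) / 2)))"
      using C t Phi_pos[of y] by (intro mult_left_mono add_left_mono) auto
    with le[OF t order_refl, of y] show ?thesis by (simp only: mult_ac)
  qed
  then have "(\<integral>\<^sup>+y. ennreal (poisson_hermite_kernel t x y) \<partial>\<mu>) \<le> (\<integral>\<^sup>+y. ennreal ?D * ennreal (Phi y) \<partial>\<mu>)"
  proof (intro nn_integral_mono)
    fix y assume K: "\<And>y. poisson_hermite_kernel t x y \<le> ?D * Phi y"
    have "ennreal (poisson_hermite_kernel t x y) \<le> ennreal (?D * Phi y)" by (rule ennreal_leI[OF K])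
    also have "\<dots> = ennreal ?D * ennreal (Phi y)"
      using Phi_pos[of y] by (intro ennreal_mult'') auto
    finally show "ennreal (poisson_hermite_kernel t x y) \<le> ennreal ?D * ennreal (Phi y)" .
  qed
  also have "\<dots> = ennreal ?D * (\<integral>\<^sup>+y. ennreal (Phi y) \<partial>\<mu>)"
  proof -
    have [measurable_cong]: "sets \<mu> = sets borel" by (rule \<mu>)
    show ?thesis by (rule nn_integral_cmult) measurable
  qed
  also have "\<dots> < \<infinity>" using fin by (simp add: ennreal_mult_less_top)
  finally show ?thesis .
qed

lemma lebesgue_point_value_iff_vanishing_density:
  "lebesgue_point_value \<nu> x0 l \<longleftrightarrow> vanishing_density (total_variation (minus_const_lebesgue \<nu> l)) x0"
  by (simp add: lebesgue_point_value_def vanishing_density_iff)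

lemma M_PhiD:
  fixes \<nu> :: "'a::euclidean_space set \<Rightarrow> complex"
  assumes "\<nu> \<in> M_Phi"
  shows "locally_finite_complex_measure \<nu>"
    and "(\<integral>\<^sup>+y. ennreal (Phi y) \<partial>total_variation \<nu>) < \<infinity>"
    and "(\<integral>\<^sup>+y. ennreal (Phi y) \<partial>total_variation (minus_const_lebesgue \<nu> l)) < \<infinity>"
proof -
  show \<nu>: "locally_finite_complex_measure \<nu>" and fin: "(\<integral>\<^sup>+y. ennreal (Phi y) \<partial>total_variation \<nu>) < \<infinity>"
    using assms by (auto simp: M_Phi_def)
  have "(\<integral>\<^sup>+y. ennreal (Phi y) \<partial>total_variation (minus_const_lebesgue \<nu> l))
      \<le> (\<integral>\<^sup>+y. ennreal (Phi y) \<partial>total_variation \<nu>) + ennreal (norm l) * (\<integral>\<^sup>+y. ennreal (Phi (y::'a)) \<partial>lborel)"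
    using nn_integral_total_variation_minus_le[OF \<nu>, of "\<lambda>y. ennreal (Phi y)" l] by simp
  also have "\<dots> < \<infinity>" using fin nn_integral_Phi_lborel[where 'a='a] by (simp add: ennreal_mult_less_top)
  finally show "(\<integral>\<^sup>+y. ennreal (Phi y) \<partial>total_variation (minus_const_lebesgue \<nu> l)) < \<infinity>" .
qed

lemma ball_average_tendsto:
  fixes x0 :: "'a::euclidean_space"
  assumes \<nu>: "locally_finite_complex_measure \<nu>" and l: "lebesgue_point_value \<nu> x0 l"
  shows "(ball_average \<nu> x0 \<longlongrightarrow> l) (at_right 0)"
proof -
  define V where "V = unit_ball_vol (real DIM('a))"
  have V: "0 < V" by (simp add: V_def)
  let ?\<mu> = "total_variation (minus_const_lebesgue \<nu> l)"
  show ?thesis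
    unfolding tendsto_iff
  proof (intro allI impI)
    fix \<eta> :: real assume \<eta>: "0 < \<eta>"
    have "\<forall>\<^sub>F r in at_right 0. emeasure ?\<mu> (ball x0 r) \<le> ennreal (\<eta> * V / 2 * r ^ DIM('a))"
      using l \<eta> V unfolding lebesgue_point_value_iff_vanishing_density vanishing_density_def
      by (elim allE[where x="\<eta> * V / 2"]) auto
    then show "\<forall>\<^sub>F r in at_right 0. dist (ball_average \<nu> x0 r) l < \<eta>"
      using eventually_at_right_less[of "0::real"]
    proof eventually_elim
      case (elim r)
      define v where "v = measure lborel (ball x0 r)"
      have v: "v = V * r ^ DIM('a)" "0 < v" using elim V by (auto simp: v_def V_def content_ball)
      have "ennreal (norm (minus_const_lebesgue \<nu> l (ball x0 r))) \<le> ennreal (\<eta> * V / 2 * r ^ DIM('a))"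
        using norm_le_total_variation[OF locally_finite_minus_const_lebesgue[OF \<nu>], of "ball x0 r" l] elim
        by (auto intro: order_trans)
      then have "norm (minus_const_lebesgue \<nu> l (ball x0 r)) \<le> \<eta> / 2 * v"
        using \<eta> V elim by (subst (asm) ennreal_le_iff) (auto simp: v)
      moreover have "ball_average \<nu> x0 r - l = minus_const_lebesgue \<nu> l (ball x0 r) / of_real v"
        using v(2) by (simp add: ball_average_def minus_const_lebesgue_def v_def[symmetric] field_simps)
      ultimately have "norm (ball_average \<nu> x0 r - l) \<le> \<eta> / 2"
        using v(2) by (simp add: norm_divide divide_le_eq)
      then show ?case using \<eta> by (simp add: dist_norm)
    qed
  qed
qed

text \<open>
  With \<open>J t x\<close> the total mass of the kernel, \<open>P\<^sub>t \<nu> - l * J\<close> is the integral of the kernel with respect to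
  \<open>\<nu> - l dy\<close>, which \<open>P\<^sub>t |\<nu> - l dy|\<close> controls; and \<open>J\<close> tends to 1.
\<close>

lemma poisson_hermite_tendsto:
  fixes x0 :: "'a::euclidean_space"
  assumes \<nu>: "\<nu> \<in> M_Phi"
    and lim: "((\<lambda>(t, x). poisson_hermite_pos t (total_variation (minus_const_lebesgue \<nu> l)) x) \<longlongrightarrow> 0)
      (nontangential \<alpha> x0)"
  shows "((\<lambda>(t, x). poisson_hermite t \<nu> x) \<longlongrightarrow> l) (nontangential \<alpha> x0)"
proof -
  let ?\<mu> = "total_variation (minus_const_lebesgue \<nu> l)"
  let ?J = "\<lambda>(t, x). \<integral>y. poisson_hermite_kernel t x y \<partial>lborel"
  have bound: "norm (poisson_hermite t \<nu> x - l * of_real (\<integral>y. poisson_hermite_kernel t x y \<partial>lborel))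
      \<le> 2 * enn2real (poisson_hermite_pos t ?\<mu> x)" if t: "0 < t" for t x
    unfolding poisson_hermite_def poisson_hermite_pos_def
    using t M_PhiD[OF \<nu>] nn_integral_Phi_lborel[where 'a='a]
    by (intro complex_measure_integral_minus_lborel_le nn_integral_poisson_hermite_kernel_finite
        poisson_hermite_kernel_nonneg borel_measurable_poisson_hermite_kernel) auto
  have "((\<lambda>p. enn2real (case p of (t, x) \<Rightarrow> poisson_hermite_pos t ?\<mu> x)) \<longlongrightarrow> 0) (nontangential \<alpha> x0)"
    using lim by (intro tendsto_enn2real) auto
  then have "((\<lambda>p. 2 * enn2real (case p of (t, x) \<Rightarrow> poisson_hermite_pos t ?\<mu> x)) \<longlongrightarrow> 0) (nontangential \<alpha> x0)"
    by (rule tendsto_mult_right_zero)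
  then have "((\<lambda>p. (case p of (t, x) \<Rightarrow> poisson_hermite t \<nu> x) - l * of_real (?J p)) \<longlongrightarrow> 0) (nontangential \<alpha> x0)"
    by (rule Lim_null_comparison[rotated])
       (rule eventually_mono[OF eventually_nontangential[of 1]], auto intro!: bound)
  moreover have "((\<lambda>p. l * of_real (?J p)) \<longlongrightarrow> l * of_real 1) (nontangential \<alpha> x0)"
    by (intro tendsto_intros tendsto_integral_poisson_hermite_kernel)
  ultimately have "((\<lambda>p. ((case p of (t, x) \<Rightarrow> poisson_hermite t \<nu> x) - l * of_real (?J p)) + l * of_real (?J p))
      \<longlongrightarrow> 0 + l * of_real 1) (nontangential \<alpha> x0)" by (rule tendsto_add)
  then show ?thesis by simp
qed

theorem theorem1p1:
  fixes \<nu> :: "'a::euclidean_space set \<Rightarrow> complex" and x0 :: 'a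
  assumes "\<nu> \<in> M_Phi"
  shows
    "(lebesgue_point \<nu> x0 \<longleftrightarrow>
       (\<exists>l. ((\<lambda>t. poisson_hermite_pos t (total_variation (minus_const_lebesgue \<nu> l)) x0)
               \<longlongrightarrow> 0) (at_right 0))) \<and>
     (lebesgue_point \<nu> x0 \<longleftrightarrow>
       (\<exists>l. \<exists>\<alpha>>0. ((\<lambda>(t, x). poisson_hermite_pos t (total_variation (minus_const_lebesgue \<nu> l)) x)
               \<longlongrightarrow> 0) (nontangential \<alpha> x0))) \<and>
     (lebesgue_point \<nu> x0 \<longleftrightarrow>
       (\<exists>l. \<forall>\<alpha>>0. ((\<lambda>(t, x). poisson_hermite_pos t (total_variation (minus_const_lebesgue \<nu> l)) x)
               \<longlongrightarrow> 0) (nontangential \<alpha> x0))) \<and>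
     (lebesgue_point \<nu> x0 \<longrightarrow>
       (ball_average \<nu> x0 \<longlongrightarrow> symmetric_derivative \<nu> x0) (at_right 0) \<and>
       lebesgue_point_value \<nu> x0 (symmetric_derivative \<nu> x0) \<and>
       ((\<lambda>t. poisson_hermite_pos t
               (total_variation (minus_const_lebesgue \<nu> (symmetric_derivative \<nu> x0))) x0)
           \<longlongrightarrow> 0) (at_right 0) \<and>
       (\<exists>\<alpha>>0. ((\<lambda>(t, x). poisson_hermite_pos t
               (total_variation (minus_const_lebesgue \<nu> (symmetric_derivative \<nu> x0))) x)
           \<longlongrightarrow> 0) (nontangential \<alpha> x0)) \<and>
       (\<forall>\<alpha>>0. ((\<lambda>(t, x). poisson_hermite_pos t
               (total_variation (minus_const_lebesgue \<nu> (symmetric_derivative \<nu> x0))) x)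
           \<longlongrightarrow> 0) (nontangential \<alpha> x0)) \<and>
       (\<forall>\<alpha>>0. ((\<lambda>(t, x). poisson_hermite t \<nu> x)
           \<longlongrightarrow> symmetric_derivative \<nu> x0) (nontangential \<alpha> x0)))"
proof -
  let ?D = "symmetric_derivative \<nu> x0"
  let ?P = "\<lambda>l t x. poisson_hermite_pos t (total_variation (minus_const_lebesgue \<nu> l)) x"
  define radial where "radial l \<longleftrightarrow> ((\<lambda>t. ?P l t x0) \<longlongrightarrow> 0) (at_right 0)" for l
  define cone where "cone l \<alpha> \<longleftrightarrow> ((\<lambda>(t, x). ?P l t x) \<longlongrightarrow> 0) (nontangential \<alpha> x0)" for l \<alpha>
  have cone: "cone l \<alpha>" if "lebesgue_point_value \<nu> x0 l" "0 < \<alpha>" for l \<alpha>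
    unfolding cone_def using that M_PhiD(3)[OF assms]
    by (intro poisson_hermite_pos_tendsto_0) (auto simp: lebesgue_point_value_iff_vanishing_density)
  have radial: "radial l" if "cone l \<alpha>" "0 < \<alpha>" for l \<alpha>
    using that tendsto_along_vertical[of \<alpha> "?P l"] unfolding cone_def radial_def by blast
  have point: "lebesgue_point_value \<nu> x0 l" if "radial l" for l
    using that unfolding radial_def lebesgue_point_value_iff_vanishing_density
    by (intro vanishing_density_if_poisson_hermite_pos_tendsto_0) auto
  have one: "(0::real) < 1" by simp
  have D: "?D = l" if "lebesgue_point_value \<nu> x0 l" for l
    unfolding symmetric_derivative_def
    using ball_average_tendsto[OF M_PhiD(1)[OF assms] that] by (intro tendsto_Lim) auto
  have "lebesgue_point \<nu> x0 \<longleftrightarrow> (\<exists>l. radial l)"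
    unfolding lebesgue_point_def using cone radial point one by blast
  moreover have "lebesgue_point \<nu> x0 \<longleftrightarrow> (\<exists>l. \<exists>\<alpha>>0. cone l \<alpha>)"
    unfolding lebesgue_point_def using cone radial point one by blast
  moreover have "lebesgue_point \<nu> x0 \<longleftrightarrow> (\<exists>l. \<forall>\<alpha>>0. cone l \<alpha>)"
    unfolding lebesgue_point_def using cone radial point one by blast
  moreover have "(ball_average \<nu> x0 \<longlongrightarrow> ?D) (at_right 0) \<and> lebesgue_point_value \<nu> x0 ?D \<and> radial ?D \<and>
      (\<exists>\<alpha>>0. cone ?D \<alpha>) \<and> (\<forall>\<alpha>>0. cone ?D \<alpha>) \<and>
      (\<forall>\<alpha>>0. ((\<lambda>(t, x). poisson_hermite t \<nu> x) \<longlongrightarrow> ?D) (nontangential \<alpha> x0))"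
    if "lebesgue_point \<nu> x0"
  proof -
    from that have l: "lebesgue_point_value \<nu> x0 ?D" using D unfolding lebesgue_point_def by auto
    then have c: "cone ?D \<alpha>" if "0 < \<alpha>" for \<alpha> using cone that by blast
    then have "((\<lambda>(t, x). poisson_hermite t \<nu> x) \<longlongrightarrow> ?D) (nontangential \<alpha> x0)" if "0 < \<alpha>" for \<alpha>
      using poisson_hermite_tendsto[OF assms] that unfolding cone_def by blast
    moreover have "(ball_average \<nu> x0 \<longlongrightarrow> ?D) (at_right 0)"
      by (rule ball_average_tendsto[OF M_PhiD(1)[OF assms] l])
    ultimately show ?thesis using l c radial one by blast
  qed
  ultimately show ?thesis unfolding radial_def cone_def by blast
qed

end
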